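(* Let $N\ge 1$, let $0<s<1$, and let $\Omega\subset\mathbb{R}^N$ be an arbitrary bounded open set. Let $f\in W^{-s,2}(\overline{\Omega})$ and let $u\in W_0^{s,2}(\overline{\Omega})$ be the unique weak (finite energy) solution of the Dirichlet problem $$(-\Delta)^s u=f\ \text{ in }\Omega,\qquad u=0\ \text{ on }\mathbb{R}^N\setminus\Omega.$$ If $f\in L^2(\Omega)$, then $u\in W^{2s,2}_{\rm loc}(\Omega)$, i.e. $u\eta\in W^{2s,2}(\mathbb{R}^N)$ for every $\eta\in\mathcal{D}(\Omega)$.
   Context: $\mathcal{D}(\Omega)$ denotes the infinitely differentiable functions with compact support in $\Omega$; functions on $\Omega$ are extended by zero to $\mathbb{R}^N$. Fractional Sobolev spaces: for $0<\sigma<1$ and $1\le p<\infty$, $W^{\sigma,p}(\mathbb{R}^N)$ is the space of $u\in L^p(\mathbb{R}^N)$ with $\int_{\mathbb{R}^N}\int_{\mathbb{R}^N}\frac{|u(x)-u(y)|^p}{|x-y|^{N+\sigma p}}\,dx\,dy<\infty$; $W^{1,p}$ is the usual Sobolev space; for $1<\sigma<2$, $W^{\sigma,p}(\mathbb{R}^N)$ is the space of $u\in W^{1,p}(\mathbb{R}^N)$ all of whose first-order partial derivatives belong to $W^{\sigma-1,p}(\mathbb{R}^N)$. $W_0^{s,2}(\overline{\Omega}):=\{u\in W^{s,2}(\mathbb{R}^N):\ u=0 \text{ on } \mathbb{R}^N\setminus\Omega\}$, with norm $\left(\int_{\mathbb{R}^N}\int_{\mathbb{R}^N}\frac{|u(x)-u(y)|^2}{|x-y|^{N+2s}}\,dx\,dy\right)^{1/2}$,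 and $W^{-s,2}(\overline{\Omega})$ is its dual. $L^2(\Omega)$ is embedded in $W^{-s,2}(\overline{\Omega})$ via $\langle f,v\rangle=\int_\Omega fv\,dx$. The fractional Laplacian is $(-\Delta)^su(x)=C_{N,s}\,\mathrm{P.V.}\int_{\mathbb{R}^N}\frac{u(x)-u(y)}{|x-y|^{N+2s}}\,dy$ with $C_{N,s}=\frac{s2^{2s}\Gamma\left(\frac{2s+N}{2}\right)}{\pi^{N/2}\Gamma(1-s)}$. A finite energy solution of the Dirichlet problem with datum $f\in W^{-s,2}(\overline{\Omega})$ is a function $u\in W_0^{s,2}(\overline{\Omega})$ such that for every $v\in W_0^{s,2}(\overline{\Omega})$, $$\frac{C_{N,s}}{2}\int_{\mathbb{R}^N}\int_{\mathbb{R}^N}\frac{(u(x)-u(y))(v(x)-v(y))}{|x-y|^{N+2s}}\,dx\,dy=\langle f,v\rangle_{W^{-s,2}(\overline{\Omega}),W_0^{s,2}(\overline{\Omega})}.$$ Such a solution exists and is unique (Lax–Milgram). *)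

theory Defs
  imports "HOL-Analysis.Analysis"
begin

text \<open>
  Euclidean N-space is a type of class \<^class>\<open>euclidean_space\<close>, with N the dimension of the type
  (hence at least 1). Elements of function spaces are representatives, that is Lebesgue measurable
  functions rather than classes; every space below is invariant under modification of a function
  on a Lebesgue null set.
\<close>

section \<open>Test functions\<close>

text \<open>
  By recursion on the order: all partial derivatives of order at most k exist and are continuous.
\<close>

primrec Ck :: "nat \<Rightarrow> ('a::euclidean_space \<Rightarrow> real) \<Rightarrow> bool" where
  "Ck 0 \<phi> \<longleftrightarrow> continuous_on UNIV \<phi>"
| "Ck (Suc k) \<phi> \<longleftrightarrow>
     (\<forall>x. \<phi> differentiable (at x)) \<and>
     (\<forall>b\<in>Basis. Ck k (\<lambda>x. frechet_derivative \<phi> (at x) b))"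

text \<open>
  The elements of \<open>\<D>(\<Omega>)\<close> are taken already extended by zero to the whole space.
\<close>

definition test_functions :: "'a::euclidean_space set \<Rightarrow> ('a \<Rightarrow> real) set" where
  "test_functions \<Omega> =
     {\<phi>. (\<forall>k. Ck k \<phi>) \<and> compact (closure {x. \<phi> x \<noteq> 0}) \<and> closure {x. \<phi> x \<noteq> 0} \<subseteq> \<Omega>}"

section \<open>Sobolev spaces\<close>

definition Lp :: "real \<Rightarrow> 'a::euclidean_space set \<Rightarrow> ('a \<Rightarrow> real) set" where
  "Lp p S =
     {u. set_borel_measurable lebesgue S u \<and> set_integrable lebesgue S (\<lambda>x. \<bar>u x\<bar> powr p)}"

definition gagliardo :: "real \<Rightarrow> real \<Rightarrow> ('a::euclidean_space \<Rightarrow> real) \<Rightarrow> ennreal" where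
  "gagliardo \<sigma> p u =
     (\<integral>\<^sup>+ x. (\<integral>\<^sup>+ y. ennreal (\<bar>u x - u y\<bar> powr p / norm (x - y) powr (real DIM('a) + \<sigma> * p))
        \<partial>lebesgue) \<partial>lebesgue)"

definition weak_partial ::
    "'a::euclidean_space \<Rightarrow> ('a \<Rightarrow> real) \<Rightarrow> ('a \<Rightarrow> real) \<Rightarrow> bool" where
  "weak_partial b u g \<longleftrightarrow>
     (\<forall>K. compact K \<longrightarrow> set_integrable lebesgue K u \<and> set_integrable lebesgue K g) \<and>
     (\<forall>\<phi>\<in>test_functions UNIV.
        (LINT x|lebesgue. u x * frechet_derivative \<phi> (at x) b) = - (LINT x|lebesgue. g x * \<phi> x))"

definition W_frac :: "real \<Rightarrow> real \<Rightarrow> ('a::euclidean_space \<Rightarrow> real) set" where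
  "W_frac \<sigma> p = {u \<in> Lp p UNIV. gagliardo \<sigma> p u < \<infinity>}"

definition W_one :: "real \<Rightarrow> ('a::euclidean_space \<Rightarrow> real) set" where
  "W_one p = {u \<in> Lp p UNIV. \<forall>b\<in>Basis. \<exists>g\<in>Lp p UNIV. weak_partial b u g}"

text \<open>
  The space \<open>W\<^bsup>\<sigma>,p\<^esup>\<close> on the whole space, for \<open>0 < \<sigma> < 2\<close> and \<open>1 \<le> p < \<infinity>\<close>; the last branch
  covers orders outside this range and carries no meaning. Weak partial derivatives are unique
  almost everywhere, so the existential quantifier speaks about the weak derivative.
\<close>

definition Sobolev :: "real \<Rightarrow> real \<Rightarrow> ('a::euclidean_space \<Rightarrow> real) set" where
  "Sobolev \<sigma> p =
     (if 0 < \<sigma> \<and> \<sigma> < 1 then W_frac \<sigma> p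
      else if \<sigma> = 1 then W_one p
      else if 1 < \<sigma> \<and> \<sigma> < 2
        then {u \<in> W_one p. \<forall>b\<in>Basis. \<exists>g\<in>W_frac (\<sigma> - 1) p. weak_partial b u g}
      else {})"

definition Sobolev_loc ::
    "real \<Rightarrow> real \<Rightarrow> 'a::euclidean_space set \<Rightarrow> ('a \<Rightarrow> real) set" where
  "Sobolev_loc \<sigma> p \<Omega> = {u. \<forall>\<eta>\<in>test_functions \<Omega>. (\<lambda>x. u x * \<eta> x) \<in> Sobolev \<sigma> p}"

section \<open>The energy space and its dual\<close>

definition W0 :: "real \<Rightarrow> 'a::euclidean_space set \<Rightarrow> ('a \<Rightarrow> real) set" where
  "W0 s \<Omega> = {u \<in> Sobolev s 2. AE x in lebesgue. x \<notin> \<Omega> \<longrightarrow> u x = 0}"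

definition W0_norm :: "real \<Rightarrow> ('a::euclidean_space \<Rightarrow> real) \<Rightarrow> real" where
  "W0_norm s u = sqrt (enn2real (gagliardo s 2 u))"

text \<open>
  Only the values of a functional on \<^term>\<open>W0 s \<Omega>\<close> matter. Boundedness forces it to agree on
  functions that are equal almost everywhere.
\<close>

definition W0_dual :: "real \<Rightarrow> 'a::euclidean_space set \<Rightarrow> (('a \<Rightarrow> real) \<Rightarrow> real) set" where
  "W0_dual s \<Omega> =
     {f. (\<forall>v\<in>W0 s \<Omega>. \<forall>w\<in>W0 s \<Omega>. f (\<lambda>x. v x + w x) = f v + f w) \<and>
         (\<forall>c. \<forall>v\<in>W0 s \<Omega>. f (\<lambda>x. c * v x) = c * f v) \<and>
         (\<exists>C. \<forall>v\<in>W0 s \<Omega>. \<bar>f v\<bar> \<le> C * W0_norm s v)}"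

text \<open>
  The functionals represented by some \<open>g \<in> L\<^sup>2(\<Omega>)\<close>.
\<close>

definition L2_functionals ::
    "real \<Rightarrow> 'a::euclidean_space set \<Rightarrow> (('a \<Rightarrow> real) \<Rightarrow> real) set" where
  "L2_functionals s \<Omega> =
     {f. \<exists>g\<in>Lp 2 \<Omega>. \<forall>v\<in>W0 s \<Omega>. f v = (LINT x:\<Omega>|lebesgue. g x * v x)}"

section \<open>The Dirichlet problem for the fractional Laplacian\<close>

definition frac_const :: "real \<Rightarrow> real \<Rightarrow> real" where
  "frac_const N s =
     s * 2 powr (2 * s) * Gamma ((2 * s + N) / 2) / (pi powr (N / 2) * Gamma (1 - s))"

definition energy ::
    "real \<Rightarrow> ('a::euclidean_space \<Rightarrow> real) \<Rightarrow> ('a \<Rightarrow> real) \<Rightarrow> real" where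
  "energy s u v =
     frac_const (real DIM('a)) s / 2 *
     (LINT x|lebesgue. (LINT y|lebesgue.
        (u x - u y) * (v x - v y) / norm (x - y) powr (real DIM('a) + 2 * s)))"

definition finite_energy_solution ::
    "real \<Rightarrow> 'a::euclidean_space set \<Rightarrow> (('a \<Rightarrow> real) \<Rightarrow> real) \<Rightarrow> ('a \<Rightarrow> real) \<Rightarrow> bool" where
  "finite_energy_solution s \<Omega> f u \<longleftrightarrow> u \<in> W0 s \<Omega> \<and> (\<forall>v\<in>W0 s \<Omega>. energy s u v = f v)"

end

theory Submission
  imports Defs "HOL-Probability.Probability"
begin

text \<open>
  Write \<open>w = \<eta> u\<close>. Moving \<open>\<eta>\<close> across the energy form produces a commutator which is a function in
  \<open>L\<^sup>2\<close>, so that \<open>w\<close> solves \<open>(-\<Delta>)\<^sup>s w = F\<close> on the whole space with \<open>F \<in> L\<^sup>2\<close>. Testing with second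
  differences of \<open>w\<close> and integrating against the kernel gives
  \<open>\<integral>\<integral> |h|\<^bsup>-N-2s\<^esup> |k|\<^bsup>-N-2s\<^esup> \<parallel>\<delta>\<^sub>h \<delta>\<^sub>k w\<parallel>\<^sup>2 dh dk < \<infinity>\<close>.

  To read off the regularity of \<open>w\<close> without the Fourier transform, the kernel is written as a mixture of
  Gaussians. With the heat semigroup \<open>P\<close> and \<open>\<psi>(t) = \<langle>(1 - P\<^sub>t) w, w\<rangle>\<close> the double integral becomes
  \<open>\<integral>\<integral> (t r)\<^bsup>-1-s\<^esup> D(t,r) dt dr\<close> with \<open>D(t,r) = \<psi>(t) + \<psi>(r) - \<psi>(t+r) = \<langle>(1 - P\<^sub>t) (1 - P\<^sub>r) w, w\<rangle>\<close>,
  and monotonicity of \<open>D\<close> yields \<open>\<integral> t\<^bsup>-1-2s\<^esup> D(t,t) dt < \<infinity>\<close>. Since \<open>D(t,t) = 2 \<psi>(t) - \<psi>(2t)\<close>,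
  telescoping over dyadic scales bounds \<open>\<integral> t\<^bsup>-1-2s\<^esup> \<psi>(t) dt\<close> if \<open>2s < 1\<close> and \<open>\<psi>(t) / t\<close> if
  \<open>2s \<ge> 1\<close>. In the latter case the difference quotients of \<open>w\<close> are bounded in \<open>L\<^sup>2\<close> and produce the
  weak gradient; for \<open>2s > 1\<close> the same dyadic sums control its seminorm of order \<open>2s - 1\<close>.
\<close>

section \<open>Square integrable functions\<close>

text \<open>Spectrally, with \<lambda> a quarter of the squared frequency, \<open>psi g t\<close>
  integrates 1 - exp(-t\<lambda>) against the spectral density of g, and \<open>psi2 g t r\<close>
  integrates the product of two such factors. So \<open>psi2 g t t\<close> behaves like
  min(t\<lambda>, 1)^2 and integrates against t^(-1-2s) to a multiple of \<lambda>^(2s) for every s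
  < 1, whereas \<open>psi g t\<close> behaves like min(t\<lambda>, 1) and does so only for 2s < 1.
  Hence the split at 2s = 1: the way back from \<open>psi2\<close> to \<open>psi\<close> runs
  towards large scales below this threshold and towards small scales otherwise. In the proof each
  spectral inequality becomes a positivity or monotonicity statement about Gaussian averages. A
  second obstacle is that the global estimate bounds a quantity by a multiple of its own square
  root, which says nothing until that quantity is finite; the kernel is therefore truncated to a
  finite measure first. Finally, the scale t corresponds to increments of length sqrt t, but
  difference quotients need single increments and not averages; quasi-subadditivity in the increment
  makes up for this.\<close>

lemma nn_integral_lborel_affine:
  fixes t :: "'a::euclidean_space"
  assumes [measurable]: "f \<in> borel_measurable borel" and "c \<noteq> 0"
  shows "(\<integral>\<^sup>+x. f x \<partial>lborel) = ennreal (\<bar>c\<bar> ^ DIM('a)) * (\<integral>\<^sup>+x. f (t + c *\<^sub>R x) \<partial>lborel)"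
  by (subst lborel_affine[OF \<open>c \<noteq> 0\<close>, of t])
     (simp add: nn_integral_density nn_integral_distr nn_integral_cmult)

lemma nn_integral_lborel_shift:
  fixes h :: "'a::euclidean_space"
  assumes [measurable]: "f \<in> borel_measurable borel"
  shows "(\<integral>\<^sup>+x. f (x + h) \<partial>lborel) = (\<integral>\<^sup>+x. f x \<partial>lborel)"
  using nn_integral_lborel_affine[of f 1 h] by (simp add: add.commute)

lemma nn_integral_lborel_uminus:
  fixes f :: "'a::euclidean_space \<Rightarrow> ennreal"
  assumes [measurable]: "f \<in> borel_measurable borel"
  shows "(\<integral>\<^sup>+x. f (- x) \<partial>lborel) = (\<integral>\<^sup>+x. f x \<partial>lborel)"
  using nn_integral_lborel_affine[of f "-1" 0] by simp

lemma lborel_distr_shift: "distr lborel borel (\<lambda>x. x + h) = (lborel :: 'a::euclidean_space measure)"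
proof -
  have "(\<lambda>x. x + h) = (+) h" by (auto simp: add.commute)
  then show ?thesis using lborel_distr_plus[of h] by simp
qed

lemma integral_lborel_shift:
  fixes f :: "'a::euclidean_space \<Rightarrow> real"
  assumes [measurable]: "f \<in> borel_measurable borel"
  shows "(\<integral>x. f (x + h) \<partial>lborel) = (\<integral>x. f x \<partial>lborel)"
  using integral_distr[of "\<lambda>x. x + h" lborel borel f] by (simp add: lborel_distr_shift)

lemma integrable_lborel_shift:
  fixes f :: "'a::euclidean_space \<Rightarrow> real"
  assumes "integrable lborel f"
  shows "integrable lborel (\<lambda>x. f (x + h))"
proof -
  have [measurable]: "f \<in> borel_measurable borel"
    using borel_measurable_integrable[OF assms] by simp
  show ?thesis
    using integrable_distr_eq[of "\<lambda>x. x + h" lborel borel f] assms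
    by (simp add: lborel_distr_shift)
qed

text \<open>Membership asks for a Borel function rather than a Lebesgue measurable one: translates
  g(x + h) are then jointly measurable in (x, h), on which every use of Fubini relies. Arbitrary
  representatives are matched with Borel ones at the end.\<close>

definition L2 :: "('a::euclidean_space \<Rightarrow> real) set" where
  "L2 = {g \<in> borel_measurable borel. integrable lborel (\<lambda>x. (g x)\<^sup>2)}"

definition sqnorm :: "('a::euclidean_space \<Rightarrow> real) \<Rightarrow> real" where
  "sqnorm g = (\<integral>x. (g x)\<^sup>2 \<partial>lborel)"

lemma L2_measurable [measurable_dest]: "g \<in> L2 \<Longrightarrow> g \<in> borel_measurable borel"
  by (simp add: L2_def)

lemma L2_integrable: "g \<in> L2 \<Longrightarrow> integrable lborel (\<lambda>x. (g x)\<^sup>2)"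
  by (simp add: L2_def)

lemma sqnorm_nonneg: "0 \<le> sqnorm g"
  by (simp add: sqnorm_def)

lemma L2_nn_integral: "g \<in> L2 \<Longrightarrow> (\<integral>\<^sup>+x. ennreal ((g x)\<^sup>2) \<partial>lborel) = ennreal (sqnorm g)"
  unfolding sqnorm_def by (intro nn_integral_eq_integral) (auto simp: L2_def)

lemma L2I:
  assumes [measurable]: "g \<in> borel_measurable borel"
    and "(\<integral>\<^sup>+x. ennreal ((g x)\<^sup>2) \<partial>lborel) < \<infinity>"
  shows "g \<in> L2"
  using assms by (auto simp: L2_def intro!: integrableI_bounded)

lemma L2_prod_integrable:
  assumes "f \<in> L2" "g \<in> L2"
  shows "integrable lborel (\<lambda>x. f x * g x)"
proof (rule Bochner_Integration.integrable_bound)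
  show "integrable lborel (\<lambda>x. (f x)\<^sup>2 + (g x)\<^sup>2)"
    using assms by (auto simp: L2_def)
  show "AE x in lborel. norm (f x * g x) \<le> norm ((f x)\<^sup>2 + (g x)\<^sup>2)"
  proof (rule AE_I2)
    fix x
    have "2 * \<bar>f x\<bar> * \<bar>g x\<bar> \<le> \<bar>f x\<bar>\<^sup>2 + \<bar>g x\<bar>\<^sup>2" by (rule sum_squares_bound)
    moreover have "0 \<le> \<bar>f x\<bar> * \<bar>g x\<bar>" by simp
    ultimately have "\<bar>f x\<bar> * \<bar>g x\<bar> \<le> \<bar>f x\<bar>\<^sup>2 + \<bar>g x\<bar>\<^sup>2" by linarith
    then show "norm (f x * g x) \<le> norm ((f x)\<^sup>2 + (g x)\<^sup>2)"
      by (simp add: abs_mult)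
  qed
  show "(\<lambda>x. f x * g x) \<in> borel_measurable lborel"
    using assms by measurable
qed

lemma L2_bound:
  assumes "f \<in> L2" and [measurable]: "g \<in> borel_measurable borel"
    and "\<And>x. \<bar>g x\<bar> \<le> B * \<bar>f x\<bar>"
  shows "g \<in> L2"
proof -
  have "integrable lborel (\<lambda>x. (g x)\<^sup>2)"
  proof (rule Bochner_Integration.integrable_bound)
    show "integrable lborel (\<lambda>x. B\<^sup>2 * (f x)\<^sup>2)"
      using assms by (auto simp: L2_def)
    show "AE x in lborel. norm ((g x)\<^sup>2) \<le> norm (B\<^sup>2 * (f x)\<^sup>2)"
    proof (rule AE_I2)
      fix x
      have "\<bar>g x\<bar>\<^sup>2 \<le> (B * \<bar>f x\<bar>)\<^sup>2"
        by (intro power_mono assms) auto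
      then show "norm ((g x)\<^sup>2) \<le> norm (B\<^sup>2 * (f x)\<^sup>2)"
        by (simp add: power_mult_distrib)
    qed
  qed measurable
  then show ?thesis by (simp add: L2_def)
qed

lemma L2_cmult: "f \<in> L2 \<Longrightarrow> (\<lambda>x. c * f x) \<in> L2"
  by (rule L2_bound[of f _ "\<bar>c\<bar>"]) (auto simp: abs_mult)

lemma L2_bounded_mult:
  "f \<in> L2 \<Longrightarrow> \<eta> \<in> borel_measurable borel \<Longrightarrow> (\<And>x. \<bar>\<eta> x\<bar> \<le> B) \<Longrightarrow> (\<lambda>x. \<eta> x * f x) \<in> L2"
  by (rule L2_bound[of f _ B]) (auto simp: abs_mult intro!: mult_right_mono)

lemma L2_add:
  assumes "f \<in> L2" "g \<in> L2"
  shows "(\<lambda>x. f x + g x) \<in> L2"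
proof -
  have [measurable]: "f \<in> borel_measurable borel" "g \<in> borel_measurable borel"
    using assms by auto
  have "integrable lborel (\<lambda>x. (f x)\<^sup>2 + (g x)\<^sup>2 + 2 * (f x * g x))"
    using assms L2_prod_integrable[OF assms] by (auto simp: L2_def)
  then show ?thesis
    by (simp add: L2_def power2_sum mult.assoc)
qed

lemma L2_diff: "f \<in> L2 \<Longrightarrow> g \<in> L2 \<Longrightarrow> (\<lambda>x. f x - g x) \<in> L2"
  using L2_add[of f "\<lambda>x. (-1) * g x"] L2_cmult[of g "-1"] by simp

lemma L2_shift: "g \<in> L2 \<Longrightarrow> (\<lambda>x. g (x + h)) \<in> L2"
  using integrable_lborel_shift[of "\<lambda>x. (g x)\<^sup>2"] by (auto simp: L2_def)

lemma sqnorm_shift: "g \<in> L2 \<Longrightarrow> sqnorm (\<lambda>x. g (x + h)) = sqnorm g"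
  unfolding sqnorm_def by (rule integral_lborel_shift[where f = "\<lambda>x. (g x)\<^sup>2"]) (auto simp: L2_def)

lemma sqnorm_cmult: "sqnorm (\<lambda>x. c * f x) = c\<^sup>2 * sqnorm f"
  by (simp add: sqnorm_def power_mult_distrib)

lemma sqnorm_expand:
  assumes "f \<in> L2" "g \<in> L2"
  shows "sqnorm (\<lambda>x. f x + g x) = sqnorm f + 2 * (\<integral>x. f x * g x \<partial>lborel) + sqnorm g"
    and "sqnorm (\<lambda>x. f x - g x) = sqnorm f - 2 * (\<integral>x. f x * g x \<partial>lborel) + sqnorm g"
proof -
  note i = L2_integrable[OF assms(1)] L2_integrable[OF assms(2)] L2_prod_integrable[OF assms]
  have "sqnorm (\<lambda>x. f x + g x) = (\<integral>x. (f x)\<^sup>2 + 2 * (f x * g x) + (g x)\<^sup>2 \<partial>lborel)"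
    unfolding sqnorm_def by (simp add: power2_sum algebra_simps)
  also have "\<dots> = sqnorm f + 2 * (\<integral>x. f x * g x \<partial>lborel) + sqnorm g"
    using i by (simp add: sqnorm_def)
  finally show "sqnorm (\<lambda>x. f x + g x) = sqnorm f + 2 * (\<integral>x. f x * g x \<partial>lborel) + sqnorm g" .
  have "sqnorm (\<lambda>x. f x - g x) = (\<integral>x. (f x)\<^sup>2 - 2 * (f x * g x) + (g x)\<^sup>2 \<partial>lborel)"
    unfolding sqnorm_def by (simp add: power2_diff algebra_simps)
  also have "\<dots> = sqnorm f - 2 * (\<integral>x. f x * g x \<partial>lborel) + sqnorm g"
    using i by (simp add: sqnorm_def)
  finally show "sqnorm (\<lambda>x. f x - g x) = sqnorm f - 2 * (\<integral>x. f x * g x \<partial>lborel) + sqnorm g" .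
qed

lemma sqnorm_parallelogram:
  assumes "f \<in> L2" "g \<in> L2"
  shows "sqnorm (\<lambda>x. f x + g x) + sqnorm (\<lambda>x. f x - g x) = 2 * sqnorm f + 2 * sqnorm g"
  using sqnorm_expand[OF assms] by simp

lemma sqnorm_add_le:
  assumes "f \<in> L2" "g \<in> L2"
  shows "sqnorm (\<lambda>x. f x + g x) \<le> 2 * sqnorm f + 2 * sqnorm g"
  using sqnorm_parallelogram[OF assms] sqnorm_nonneg[of "\<lambda>x. f x - g x"] by linarith

lemma sqnorm_diff_le:
  assumes "f \<in> L2" "g \<in> L2"
  shows "sqnorm (\<lambda>x. f x - g x) \<le> 2 * sqnorm f + 2 * sqnorm g"
  using sqnorm_parallelogram[OF assms] sqnorm_nonneg[of "\<lambda>x. f x + g x"] by linarith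

lemma L2_Cauchy_Schwarz_abs:
  assumes "f \<in> L2" "g \<in> L2"
  shows "(\<integral>x. \<bar>f x * g x\<bar> \<partial>lborel) \<le> sqrt (sqnorm f) * sqrt (sqnorm g)"
proof -
  have [measurable]: "f \<in> borel_measurable borel" "g \<in> borel_measurable borel"
    using assms by auto
  define I where "I = (\<integral>x. \<bar>f x * g x\<bar> \<partial>lborel)"
  have I0: "0 \<le> I" by (simp add: I_def)
  have eq: "(\<integral>\<^sup>+x. ennreal \<bar>f x\<bar> * ennreal \<bar>g x\<bar> \<partial>lborel) = ennreal I"
    unfolding I_def using integrable_abs[OF L2_prod_integrable[OF assms]]
    by (subst nn_integral_eq_integral[symmetric]) (auto simp: ennreal_mult abs_mult)
  have "(ennreal I)\<^sup>2 \<le> ennreal (sqnorm f) * ennreal (sqnorm g)"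
    using Cauchy_Schwarz_nn_integral[of "\<lambda>x. ennreal \<bar>f x\<bar>" lborel "\<lambda>x. ennreal \<bar>g x\<bar>"]
    by (simp add: eq ennreal_power L2_nn_integral assms)
  then have "ennreal (I\<^sup>2) \<le> ennreal (sqnorm f * sqnorm g)"
    by (simp add: ennreal_power I0 ennreal_mult sqnorm_nonneg)
  then have "I\<^sup>2 \<le> sqnorm f * sqnorm g"
    by (simp add: sqnorm_nonneg)
  then have "I \<le> sqrt (sqnorm f * sqnorm g)"
    by (rule real_le_rsqrt)
  then show ?thesis by (simp add: I_def real_sqrt_mult)
qed

lemma L2_Cauchy_Schwarz:
  assumes "f \<in> L2" "g \<in> L2"
  shows "\<bar>\<integral>x. f x * g x \<partial>lborel\<bar> \<le> sqrt (sqnorm f) * sqrt (sqnorm g)"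
  using L2_Cauchy_Schwarz_abs[OF assms] integral_abs_bound[of lborel "\<lambda>x. f x * g x"] by linarith

text \<open>An average over a finite measure stays square integrable by Cauchy-Schwarz against the
  constant 1; the pairing with F is Fubini, absolutely convergent by the uniform bound B. Pairing
  the average with itself and expanding both copies gives the double integral. It serves both the
  heat semigroup and the truncated fractional Laplacian.\<close>

lemma L2_mixture:
  fixes v :: "'b::euclidean_space \<Rightarrow> 'a::euclidean_space \<Rightarrow> real"
  assumes "finite_measure \<nu>" and sets: "sets \<nu> = sets borel"
    and m: "(\<lambda>(h, x). v h x) \<in> borel_measurable (borel \<Otimes>\<^sub>M borel)"
    and L: "\<And>h. v h \<in> L2" and B: "\<And>h. sqnorm (v h) \<le> B\<^sup>2"
  defines "\<Lambda> \<equiv> (\<lambda>x. \<integral>h. v h x \<partial>\<nu>)"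
  shows "\<Lambda> \<in> L2"
    and "\<And>F. F \<in> L2 \<Longrightarrow> (\<integral>x. F x * \<Lambda> x \<partial>lborel) = (\<integral>h. (\<integral>x. F x * v h x \<partial>lborel) \<partial>\<nu>)"
    and "sqnorm \<Lambda> = (\<integral>h. (\<integral>k. (\<integral>x. v h x * v k x \<partial>lborel) \<partial>\<nu>) \<partial>\<nu>)"
proof -
  interpret \<nu>: finite_measure \<nu> by fact
  interpret P: pair_sigma_finite lborel \<nu> ..
  note [measurable_cong] = sets
  note [measurable] = m L2_measurable[OF L]
  have fin: "emeasure \<nu> (space \<nu>) < \<top>"
    by (simp add: less_top[symmetric])
  have m' [measurable]: "(\<lambda>(x, h). v h x) \<in> borel_measurable (borel \<Otimes>\<^sub>M \<nu>)"
  proof -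
    have "(\<lambda>p. (\<lambda>(h, x). v h x) (snd p, fst p)) \<in> borel_measurable (borel \<Otimes>\<^sub>M \<nu>)"
      by measurable
    then show ?thesis by (simp add: case_prod_beta)
  qed
  have B': "sqrt (sqnorm (v h)) \<le> \<bar>B\<bar>" for h
    using B[of h] real_sqrt_le_iff[of "sqnorm (v h)" "B\<^sup>2"] by simp
  have [measurable]: "\<Lambda> \<in> borel_measurable borel"
    unfolding \<Lambda>_def by measurable
  have int_F: "integrable (lborel \<Otimes>\<^sub>M \<nu>) (\<lambda>(x, h). F x * v h x)" if F: "F \<in> L2" for F
  proof -
    have [measurable]: "F \<in> borel_measurable borel" using F by auto
    have "(\<integral>\<^sup>+p. ennreal (norm (case p of (x, h) \<Rightarrow> F x * v h x)) \<partial>(lborel \<Otimes>\<^sub>M \<nu>))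
       = (\<integral>\<^sup>+h. (\<integral>\<^sup>+x. ennreal \<bar>F x * v h x\<bar> \<partial>lborel) \<partial>\<nu>)"
      by (subst P.nn_integral_snd[symmetric]) (auto simp: case_prod_beta)
    also have "\<dots> \<le> (\<integral>\<^sup>+h. ennreal (sqrt (sqnorm F) * \<bar>B\<bar>) \<partial>\<nu>)"
    proof (rule nn_integral_mono)
      fix h
      have "(\<integral>\<^sup>+x. ennreal \<bar>F x * v h x\<bar> \<partial>lborel) = ennreal (\<integral>x. \<bar>F x * v h x\<bar> \<partial>lborel)"
        by (rule nn_integral_eq_integral) (use L2_prod_integrable[OF F L] in auto)
      also have "\<dots> \<le> ennreal (sqrt (sqnorm F) * \<bar>B\<bar>)"
        using L2_Cauchy_Schwarz_abs[OF F L, of h] mult_left_mono[OF B', of "sqrt (sqnorm F)" h]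
        by (intro ennreal_leI) (auto simp: sqnorm_nonneg)
      finally show "(\<integral>\<^sup>+x. ennreal \<bar>F x * v h x\<bar> \<partial>lborel) \<le> ennreal (sqrt (sqnorm F) * \<bar>B\<bar>)" .
    qed
    also have "\<dots> < \<infinity>"
      using fin by (simp add: ennreal_mult_less_top)
    finally show ?thesis
      by (intro integrableI_bounded) (auto simp: case_prod_beta)
  qed
  have swap: "(\<integral>x. F x * \<Lambda> x \<partial>lborel) = (\<integral>h. (\<integral>x. F x * v h x \<partial>lborel) \<partial>\<nu>)" if F: "F \<in> L2" for F
    using P.Fubini_integral[OF int_F[OF F]] by (simp add: \<Lambda>_def)
  then show "\<And>F. F \<in> L2 \<Longrightarrow> (\<integral>x. F x * \<Lambda> x \<partial>lborel) = (\<integral>h. (\<integral>x. F x * v h x \<partial>lborel) \<partial>\<nu>)" .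
  have "(\<integral>\<^sup>+x. ennreal ((\<Lambda> x)\<^sup>2) \<partial>lborel) \<le> (\<integral>\<^sup>+x. emeasure \<nu> (space \<nu>) * (\<integral>\<^sup>+h. ennreal ((v h x)\<^sup>2) \<partial>\<nu>) \<partial>lborel)"
  proof (rule nn_integral_mono)
    fix x
    have "ennreal ((\<Lambda> x)\<^sup>2) = (ennreal \<bar>\<Lambda> x\<bar>)\<^sup>2"
      by (simp add: ennreal_power)
    also have "\<dots> \<le> (\<integral>\<^sup>+h. ennreal \<bar>v h x\<bar> * 1 \<partial>\<nu>)\<^sup>2"
    proof (rule power_mono)
      \<comment> \<open>A non-integrable slice has Bochner integral 0 by convention, so the bound
        holds there as well.\<close>
      show "ennreal \<bar>\<Lambda> x\<bar> \<le> (\<integral>\<^sup>+h. ennreal \<bar>v h x\<bar> * 1 \<partial>\<nu>)"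
        using integral_norm_bound_ennreal[of \<nu> "\<lambda>h. v h x"]
        by (cases "integrable \<nu> (\<lambda>h. v h x)") (auto simp: \<Lambda>_def not_integrable_integral_eq)
    qed auto
    also have "\<dots> \<le> (\<integral>\<^sup>+h. (ennreal \<bar>v h x\<bar>)\<^sup>2 \<partial>\<nu>) * (\<integral>\<^sup>+h. 1\<^sup>2 \<partial>\<nu>)"
      by (rule Cauchy_Schwarz_nn_integral) auto
    also have "\<dots> = emeasure \<nu> (space \<nu>) * (\<integral>\<^sup>+h. ennreal ((v h x)\<^sup>2) \<partial>\<nu>)"
      by (simp add: ennreal_power mult.commute)
    finally show "ennreal ((\<Lambda> x)\<^sup>2) \<le> emeasure \<nu> (space \<nu>) * (\<integral>\<^sup>+h. ennreal ((v h x)\<^sup>2) \<partial>\<nu>)" .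
  qed
  also have "\<dots> = emeasure \<nu> (space \<nu>) * (\<integral>\<^sup>+x. (\<integral>\<^sup>+h. ennreal ((v h x)\<^sup>2) \<partial>\<nu>) \<partial>lborel)"
    by (rule nn_integral_cmult) measurable
  also have "(\<integral>\<^sup>+x. (\<integral>\<^sup>+h. ennreal ((v h x)\<^sup>2) \<partial>\<nu>) \<partial>lborel) = (\<integral>\<^sup>+h. (\<integral>\<^sup>+x. ennreal ((v h x)\<^sup>2) \<partial>lborel) \<partial>\<nu>)"
    by (rule P.Fubini'[symmetric]) measurable
  also have "\<dots> \<le> (\<integral>\<^sup>+h. ennreal (B\<^sup>2) \<partial>\<nu>)"
    by (intro nn_integral_mono) (simp add: L2_nn_integral[OF L] B ennreal_leI)
  also have "emeasure \<nu> (space \<nu>) * \<dots> < \<infinity>"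
    using fin by (simp add: ennreal_mult_less_top)
  finally have "(\<integral>\<^sup>+x. ennreal ((\<Lambda> x)\<^sup>2) \<partial>lborel) < \<infinity>"
    by (simp add: mult_left_mono)
  then show \<Lambda>: "\<Lambda> \<in> L2"
    by (intro L2I) auto
  have "sqnorm \<Lambda> = (\<integral>x. \<Lambda> x * \<Lambda> x \<partial>lborel)"
    by (simp add: sqnorm_def power2_eq_square)
  also have "\<dots> = (\<integral>h. (\<integral>x. v h x * \<Lambda> x \<partial>lborel) \<partial>\<nu>)"
    by (subst swap[OF \<Lambda>]) (simp add: mult.commute)
  also have "\<dots> = (\<integral>h. (\<integral>k. (\<integral>x. v h x * v k x \<partial>lborel) \<partial>\<nu>) \<partial>\<nu>)"
    by (simp add: swap[OF L])
  finally show "sqnorm \<Lambda> = (\<integral>h. (\<integral>k. (\<integral>x. v h x * v k x \<partial>lborel) \<partial>\<nu>) \<partial>\<nu>)" .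
qed

section \<open>Power weights on the half line\<close>

text \<open>Extended by zero so that integrals over scales run over the whole line; this also hides
  the default values of the Gaussian quantities at t \<le> 0.\<close>

definition pw :: "real \<Rightarrow> real \<Rightarrow> ennreal" where
  "pw a t = ennreal (if 0 < t then t powr a else 0)"

lemma pw_measurable [measurable]: "pw a \<in> borel_measurable borel"
  unfolding pw_def by measurable

lemma pw_tail_finite:
  assumes "0 < a" "0 < c"
  shows "(\<integral>\<^sup>+t. pw (-1 - a) t * indicator {c..} t \<partial>lborel) < \<infinity>"
proof -
  have "(\<integral>\<^sup>+t. pw (-1 - a) t * indicator {c..} t \<partial>lborel)
      = (\<integral>\<^sup>+t. ennreal (t powr (-1 - a)) * indicator {c..} t \<partial>lborel)"
    using assms by (intro nn_integral_cong) (auto simp: pw_def indicator_def)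
  also have "\<dots> = ennreal (0 - (- (c powr - a) / a))"
  proof (rule nn_integral_FTC_atLeast)
    show "((\<lambda>t. - (t powr - a) / a) has_real_derivative x powr (-1 - a)) (at x)" if "c \<le> x" for x
      using that assms
      by (auto intro!: derivative_eq_intros simp: powr_diff powr_minus field_simps)
    have "((\<lambda>t. t powr - a) \<longlongrightarrow> 0) at_top"
      using assms by (intro tendsto_neg_powr filterlim_ident) auto
    then have "((\<lambda>t. - (t powr - a) / a) \<longlongrightarrow> - 0 / a) at_top"
      by (intro tendsto_intros) (use assms in auto)
    then show "((\<lambda>t. - (t powr - a) / a) \<longlongrightarrow> 0) at_top" by simp
  qed auto
  finally show ?thesis by simp
qed

lemma pw_head_finite:
  assumes "-1 < a"
  shows "(\<integral>\<^sup>+t. pw a t * indicator {..1} t \<partial>lborel) < \<infinity>"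
proof -
  have "(\<integral>\<^sup>+t. pw a t * indicator {..1} t \<partial>lborel) \<le> (\<integral>\<^sup>+t. ennreal (indicator {0..1} t * t powr a) \<partial>lborel)"
    by (intro nn_integral_mono) (auto simp: pw_def indicator_def)
  also have "\<dots> = ennreal (1 powr (a + 1) / (a + 1))"
    by (rule nn_integral_has_integral_lebesgue) (use assms has_integral_powr_from_0[of a 1] in auto)
  finally show ?thesis using le_less_trans by fastforce
qed

text \<open>With c = 2^j or c = 2^(-j) the power of c produces the geometric factors of the dyadic
  series.\<close>

lemma pw_scale:
  assumes [measurable]: "f \<in> borel_measurable borel" and c: "0 < c"
  shows "(\<integral>\<^sup>+t. pw a t * f (c * t) \<partial>lborel) = ennreal (c powr (-1 - a)) * (\<integral>\<^sup>+t. pw a t * f t \<partial>lborel)"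
proof -
  have *: "pw a (c * t) = ennreal (c powr a) * pw a t" for t
    using c by (auto simp: pw_def powr_mult ennreal_mult zero_less_mult_iff)
  have "(\<integral>\<^sup>+t. pw a t * f t \<partial>lborel) = ennreal c * (\<integral>\<^sup>+t. pw a (0 + c * t) * f (0 + c * t) \<partial>lborel)"
    using c by (subst nn_integral_real_affine[where c = c and t = 0]) auto
  also have "\<dots> = ennreal c * (ennreal (c powr a) * (\<integral>\<^sup>+t. pw a t * f (c * t) \<partial>lborel))"
    by (simp add: * mult.assoc nn_integral_cmult)
  finally have "ennreal (c powr (-1 - a)) * (\<integral>\<^sup>+t. pw a t * f t \<partial>lborel)
      = ennreal (c powr (-1 - a) * c * c powr a) * (\<integral>\<^sup>+t. pw a t * f (c * t) \<partial>lborel)"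
    using c by (simp add: ennreal_mult mult.assoc)
  also have "c powr (-1 - a) * c * c powr a = 1"
    using c by (simp add: powr_diff powr_minus field_simps)
  finally show ?thesis by simp
qed

section \<open>Gaussian kernels\<close>

text \<open>The number is pi^(N/2); the proof works with its finiteness and positivity.\<close>

definition gauss_mass :: "'a::euclidean_space itself \<Rightarrow> real" where
  "gauss_mass _ = (\<integral>x. exp (- (norm (x::'a))\<^sup>2) \<partial>lborel)"

lemma nn_integral_gauss_mass:
  "(\<integral>\<^sup>+x. ennreal (exp (- (norm (x::'a::euclidean_space))\<^sup>2)) \<partial>lborel) = ennreal (gauss_mass TYPE('a))"
  and gauss_mass_pos: "0 < gauss_mass TYPE('a)"
proof -
  have one: "(\<integral>\<^sup>+y. ennreal (exp (- (y::real)\<^sup>2)) \<partial>lborel) < \<infinity>"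
  proof -
    \<comment> \<open>Standard deviation 1 / sqrt 2 gives the exponent -y^2, and sqrt pi removes the
      normalisation.\<close>
    have "integrable lborel (\<lambda>y. sqrt pi * normal_density 0 (1 / sqrt 2) y)"
      by simp
    then have "integrable lborel (\<lambda>y::real. exp (- y\<^sup>2))"
      by (simp add: normal_density_def power_divide)
    then show ?thesis
      by (subst nn_integral_eq_integral) auto
  qed
  have "(\<integral>\<^sup>+x. ennreal (exp (- (norm (x::'a))\<^sup>2)) \<partial>lborel)
      = (\<integral>\<^sup>+x. (\<Prod>b\<in>Basis. ennreal (exp (- ((x::'a) \<bullet> b)\<^sup>2))) \<partial>lborel)"
  proof (rule nn_integral_cong)
    fix x :: 'a
    have "(norm x)\<^sup>2 = (\<Sum>b\<in>Basis. (x \<bullet> b)\<^sup>2)"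
      using euclidean_inner[of x x] by (simp only: power2_norm_eq_inner power2_eq_square[of "x \<bullet> _"])
    then have "exp (- (norm x)\<^sup>2) = (\<Prod>b\<in>Basis. exp (- (x \<bullet> b)\<^sup>2))"
      by (simp only: sum_negf[symmetric] exp_sum[OF finite_Basis])
    then show "ennreal (exp (- (norm x)\<^sup>2)) = (\<Prod>b\<in>Basis. ennreal (exp (- (x \<bullet> b)\<^sup>2)))"
      by (simp only: prod_ennreal exp_ge_zero)
  qed
  also have "\<dots> = (\<Prod>b\<in>(Basis::'a set). \<integral>\<^sup>+y. ennreal (exp (- (y::real)\<^sup>2)) \<partial>lborel)"
    by (rule nn_integral_lborel_prod) auto
  also have "\<dots> < \<infinity>"
    using one by (simp add: power_less_top_ennreal)
  finally have i: "integrable lborel (\<lambda>x::'a. exp (- (norm x)\<^sup>2))"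
    by (intro integrableI_bounded) auto
  then show *: "(\<integral>\<^sup>+x. ennreal (exp (- (norm (x::'a))\<^sup>2)) \<partial>lborel) = ennreal (gauss_mass TYPE('a))"
    unfolding gauss_mass_def by (intro nn_integral_eq_integral) auto
  have "(\<integral>\<^sup>+x. ennreal (exp (- (norm (x::'a))\<^sup>2)) \<partial>lborel) \<noteq> 0"
    by (subst nn_integral_0_iff_AE) (simp_all add: ae_filter_eq_bot_iff)
  then show "0 < gauss_mass TYPE('a)"
    unfolding * by (simp add: ennreal_eq_0_iff)
qed

text \<open>For t > 0 this is the heat kernel at time t/4. Without the factor 4 in the exponent the
  spatial scale is sqrt t, and the parameters still add under convolution.\<close>

definition gauss :: "real \<Rightarrow> 'a::euclidean_space \<Rightarrow> real" where
  "gauss t h = exp (- ((norm h)\<^sup>2 / t)) / (gauss_mass TYPE('a) * t powr (real DIM('a) / 2))"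

lemma gauss_measurable2 [measurable]:
  "(\<lambda>(t, h). gauss t h) \<in> borel_measurable (borel \<Otimes>\<^sub>M borel)"
  unfolding gauss_def by measurable

lemma gauss_measurable [measurable]: "gauss t \<in> borel_measurable borel"
  unfolding gauss_def[abs_def] by measurable

lemma gauss_nonneg [simp]: "0 \<le> gauss t h"
  by (simp add: gauss_def gauss_mass_pos less_imp_le)

lemma gauss_pos: "0 < t \<Longrightarrow> 0 < gauss t h"
  by (simp add: gauss_def gauss_mass_pos)

lemma gauss_uminus [simp]: "gauss t (- h) = gauss t h"
  by (simp add: gauss_def)

lemma nn_integral_gauss:
  assumes "0 < t"
  shows "(\<integral>\<^sup>+h. ennreal (gauss t (h::'a::euclidean_space)) \<partial>lborel) = 1"
proof -
  let ?N = "DIM('a)" and ?\<gamma> = "gauss_mass TYPE('a)"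
  have c: "\<bar>sqrt t\<bar> ^ ?N = t powr (real ?N / 2)"
    using assms by (simp add: powr_half_sqrt[symmetric] powr_realpow[symmetric] powr_powr)
  have assoc3: "ennreal x * (ennreal y * ennreal z) = ennreal (x * (y * z))"
    if "0 \<le> x" "0 \<le> y" "0 \<le> z" for x y z
    using that by (simp add: ennreal_mult)
  have "(\<integral>\<^sup>+h. ennreal (gauss t (h::'a)) \<partial>lborel)
    = ennreal (\<bar>sqrt t\<bar> ^ ?N) * (\<integral>\<^sup>+h. ennreal (gauss t (0 + sqrt t *\<^sub>R (h::'a))) \<partial>lborel)"
    using assms by (intro nn_integral_lborel_affine) auto
  also have "(\<lambda>h::'a. ennreal (gauss t (0 + sqrt t *\<^sub>R h)))
    = (\<lambda>h. ennreal (1 / (?\<gamma> * t powr (real ?N / 2))) * ennreal (exp (- (norm h)\<^sup>2)))"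
    using assms gauss_mass_pos[where 'a='a]
    by (auto simp: gauss_def fun_eq_iff power_mult_distrib ennreal_mult[symmetric])
  also have "(\<integral>\<^sup>+h. ennreal (1 / (?\<gamma> * t powr (real ?N / 2))) * ennreal (exp (- (norm (h::'a))\<^sup>2)) \<partial>lborel)
     = ennreal (1 / (?\<gamma> * t powr (real ?N / 2))) * ennreal ?\<gamma>"
    by (subst nn_integral_cmult) (auto simp: nn_integral_gauss_mass)
  also have "ennreal (\<bar>sqrt t\<bar> ^ ?N) * \<dots> = ennreal (t powr (real ?N / 2) * (1 / (?\<gamma> * t powr (real ?N / 2)) * ?\<gamma>))"
    using gauss_mass_pos[where 'a='a] unfolding c by (intro assoc3) (auto intro!: divide_nonneg_nonneg)
  also have "t powr (real ?N / 2) * (1 / (?\<gamma> * t powr (real ?N / 2)) * ?\<gamma>) = 1"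
    using assms gauss_mass_pos[where 'a='a] by simp
  finally show ?thesis by simp
qed

text \<open>Completing the square in the exponent of \<^term>\<open>gauss t h * gauss r (m - h)\<close>.\<close>

lemma gauss_mult:
  fixes a m :: "'a::euclidean_space"
  assumes "0 < t" "0 < r"
  shows "gauss t (a + (t / (t + r)) *\<^sub>R m) * gauss r (m - (a + (t / (t + r)) *\<^sub>R m))
    = gauss (t + r) m * gauss (t * r / (t + r)) a"
proof -
  let ?\<alpha> = "t / (t + r)" and ?\<gamma> = "gauss_mass TYPE('a)" and ?n = "real DIM('a) / 2"
  have \<beta>: "1 - ?\<alpha> = r / (t + r)" using assms by (simp add: field_simps)
  have m: "m - (a + ?\<alpha> *\<^sub>R m) = (r / (t + r)) *\<^sub>R m - a"
    unfolding \<beta>[symmetric] by (simp add: algebra_simps)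
  have n1: "(norm (a + ?\<alpha> *\<^sub>R m))\<^sup>2 = (norm a)\<^sup>2 + 2 * ?\<alpha> * (a \<bullet> m) + ?\<alpha>\<^sup>2 * (norm m)\<^sup>2"
    unfolding power2_norm_eq_inner by (simp add: inner_left_distrib inner_right_distrib inner_commute power2_eq_square)
  have n2: "(norm ((r / (t + r)) *\<^sub>R m - a))\<^sup>2
      = (norm a)\<^sup>2 - 2 * (r / (t + r)) * (a \<bullet> m) + (r / (t + r))\<^sup>2 * (norm m)\<^sup>2"
    unfolding power2_norm_eq_inner by (simp add: inner_diff_left inner_diff_right inner_commute power2_eq_square)
  have e: "(norm (a + ?\<alpha> *\<^sub>R m))\<^sup>2 / t + (norm (m - (a + ?\<alpha> *\<^sub>R m)))\<^sup>2 / r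
     = (norm m)\<^sup>2 / (t + r) + (norm a)\<^sup>2 / (t * r / (t + r))"
  proof -
    define A where "A = (norm a)\<^sup>2"
    define M where "M = (norm m)\<^sup>2"
    define P where "P = a \<bullet> m"
    have tr: "t + r \<noteq> 0" using assms by simp
    have "(A + 2 * ?\<alpha> * P + ?\<alpha>\<^sup>2 * M) / t = A / t + 2 * P / (t + r) + t * M / (t + r)\<^sup>2"
      using assms tr by (simp add: add_divide_distrib power2_eq_square)
    moreover have "(A - 2 * (r / (t + r)) * P + (r / (t + r))\<^sup>2 * M) / r = A / r - 2 * P / (t + r) + r * M / (t + r)\<^sup>2"
      using assms tr by (simp add: add_divide_distrib diff_divide_distrib power2_eq_square)
    moreover have "t * M / (t + r)\<^sup>2 + r * M / (t + r)\<^sup>2 = M / (t + r)"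
      using tr by (simp add: add_divide_distrib[symmetric] distrib_right[symmetric] power2_eq_square)
    moreover have "A / t + A / r = A / (t * r / (t + r))"
      using assms tr by (simp add: field_simps)
    ultimately show ?thesis
      unfolding m n1 n2 A_def[symmetric] M_def[symmetric] P_def[symmetric] by linarith
  qed
  have p: "t powr ?n * r powr ?n = (t + r) powr ?n * (t * r / (t + r)) powr ?n"
    using assms by (simp add: powr_mult[symmetric])
  have "exp (- ((norm (a + ?\<alpha> *\<^sub>R m))\<^sup>2 / t)) * exp (- ((norm (m - (a + ?\<alpha> *\<^sub>R m)))\<^sup>2 / r))
     = exp (- ((norm m)\<^sup>2 / (t + r))) * exp (- ((norm a)\<^sup>2 / (t * r / (t + r))))"
    unfolding exp_add[symmetric] using e by (intro arg_cong[where f = exp]) linarith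
  moreover have "(?\<gamma> * t powr ?n) * (?\<gamma> * r powr ?n) = (?\<gamma> * (t + r) powr ?n) * (?\<gamma> * (t * r / (t + r)) powr ?n)"
    using p by (simp add: mult.assoc mult.left_commute)
  ultimately show ?thesis
    unfolding gauss_def times_divide_times_eq by (simp only:)
qed

text \<open>Centring h at t/(t+r) m makes the product split into a function of m and a Gaussian in
  the new variable, of total mass one.\<close>

lemma nn_integral_gauss_convolution:
  fixes m :: "'a::euclidean_space"
  assumes "0 < t" "0 < r"
  shows "(\<integral>\<^sup>+h. ennreal (gauss t h * gauss r (m - h)) \<partial>lborel) = ennreal (gauss (t + r) m)"
proof -
  have "(\<integral>\<^sup>+h. ennreal (gauss t h * gauss r (m - h)) \<partial>lborel)
     = (\<integral>\<^sup>+a. ennreal (gauss t (a + (t / (t + r)) *\<^sub>R m) * gauss r (m - (a + (t / (t + r)) *\<^sub>R m))) \<partial>lborel)"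
    by (rule nn_integral_lborel_shift[symmetric]) measurable
  also have "\<dots> = (\<integral>\<^sup>+a. ennreal (gauss (t + r) m) * ennreal (gauss (t * r / (t + r)) (a::'a)) \<partial>lborel)"
    by (simp only: gauss_mult[OF assms] ennreal_mult gauss_nonneg)
  also have "\<dots> = ennreal (gauss (t + r) m)"
    using assms by (simp add: nn_integral_cmult nn_integral_gauss)
  finally show ?thesis .
qed

section \<open>Gaussian probability measures and their semigroup law\<close>

definition heat :: "real \<Rightarrow> 'a::euclidean_space measure" where
  "heat t = density lborel (\<lambda>h. ennreal (gauss t h))"

lemma sets_heat [simp, measurable_cong]: "sets (heat t) = sets borel"
  by (simp add: heat_def)

lemma space_heat [simp]: "space (heat t) = UNIV"
  by (simp add: heat_def)

lemma prob_space_heat: "0 < t \<Longrightarrow> prob_space (heat t)"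
  by (rule prob_spaceI) (simp add: heat_def emeasure_density nn_integral_gauss)

lemma integral_heat:
  fixes f :: "'a::euclidean_space \<Rightarrow> real"
  shows "f \<in> borel_measurable borel \<Longrightarrow> (\<integral>h. f h \<partial>heat t) = (\<integral>h. gauss t h * f h \<partial>lborel)"
  unfolding heat_def by (subst integral_density) auto

lemma nn_integral_heat:
  "f \<in> borel_measurable borel \<Longrightarrow> (\<integral>\<^sup>+h. f h \<partial>heat t) = (\<integral>\<^sup>+h. ennreal (gauss t h) * f h \<partial>lborel)"
  unfolding heat_def by (subst nn_integral_density) auto

lemma heat_uminus: "distr (heat t) borel uminus = (heat t :: 'a::euclidean_space measure)"
proof (rule measure_eqI)
  fix A :: "'a set" assume "A \<in> sets (distr (heat t) borel uminus)"
  then have [measurable]: "A \<in> sets borel" by simp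
  have "emeasure (distr (heat t) borel uminus) A = (\<integral>\<^sup>+h. indicator A h \<partial>distr (heat t) borel uminus)"
    by simp
  also have "\<dots> = (\<integral>\<^sup>+h. ennreal (gauss t h) * indicator A (- h) \<partial>lborel)"
    by (subst nn_integral_distr) (auto simp: nn_integral_heat)
  also have "\<dots> = (\<integral>\<^sup>+h. ennreal (gauss t (- h)) * indicator A (- (- h)) \<partial>lborel)"
    by (rule nn_integral_lborel_uminus[symmetric]) measurable
  also have "\<dots> = (\<integral>\<^sup>+h. indicator A h \<partial>heat t)"
    by (simp add: nn_integral_heat del: nn_integral_indicator)
  finally show "emeasure (distr (heat t) borel uminus) A = emeasure (heat t) A"
    by simp
qed simp

lemma integral_heat_uminus:
  fixes f :: "'a::euclidean_space \<Rightarrow> real"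
  assumes [measurable]: "f \<in> borel_measurable borel"
  shows "(\<integral>h. f (- h) \<partial>heat t) = (\<integral>h. f h \<partial>heat t)"
  using integral_distr[of uminus "heat t" borel f] by (simp add: heat_uminus)

text \<open>Stated for image measures, the semigroup law can be tested on indicators, where Tonelli
  asks for no integrability; bounded functions of either sign follow by transfer.\<close>

lemma heat_convolution:
  assumes "0 < t" "0 < r"
  shows "distr (heat t \<Otimes>\<^sub>M heat r) borel (\<lambda>p. fst p + snd p) = (heat (t + r) :: 'a::euclidean_space measure)"
proof (rule measure_eqI)
  interpret T: prob_space "heat t :: 'a measure" using assms by (intro prob_space_heat)
  interpret R: prob_space "heat r :: 'a measure" using assms by (intro prob_space_heat)
  fix A :: "'a set" assume "A \<in> sets (distr (heat t \<Otimes>\<^sub>M heat r) borel (\<lambda>p. fst p + snd p))"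
  then have [measurable]: "A \<in> sets borel" by simp
  have "emeasure (distr (heat t \<Otimes>\<^sub>M heat r) borel (\<lambda>p. fst p + snd p)) A
     = (\<integral>\<^sup>+h. indicator A h \<partial>distr (heat t \<Otimes>\<^sub>M heat r) borel (\<lambda>p. fst p + snd p))"
    by simp
  also have "\<dots> = (\<integral>\<^sup>+p. indicator A (fst p + snd p) \<partial>(heat t \<Otimes>\<^sub>M heat r))"
    by (rule nn_integral_distr) auto
  also have "\<dots> = (\<integral>\<^sup>+h. (\<integral>\<^sup>+k. indicator A (h + k) \<partial>heat r) \<partial>heat t)"
    by (subst R.nn_integral_fst[symmetric]) auto
  also have "\<dots> = (\<integral>\<^sup>+h. (\<integral>\<^sup>+k. ennreal (gauss t h) * (ennreal (gauss r k) * indicator A (h + k)) \<partial>lborel) \<partial>lborel)"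
    by (simp add: nn_integral_heat nn_integral_cmult)
  also have "\<dots> = (\<integral>\<^sup>+h. (\<integral>\<^sup>+m. ennreal (gauss t h) * (ennreal (gauss r (m - h)) * indicator A m) \<partial>lborel) \<partial>lborel)"
  proof (rule nn_integral_cong)
    fix h :: 'a
    show "(\<integral>\<^sup>+k. ennreal (gauss t h) * (ennreal (gauss r k) * indicator A (h + k)) \<partial>lborel)
      = (\<integral>\<^sup>+m. ennreal (gauss t h) * (ennreal (gauss r (m - h)) * indicator A m) \<partial>lborel)"
      using nn_integral_lborel_shift[of "\<lambda>k. ennreal (gauss t h) * (ennreal (gauss r k) * indicator A (h + k))" "- h"]
      by simp
  qed
  also have "\<dots> = (\<integral>\<^sup>+m. (\<integral>\<^sup>+h. ennreal (gauss t h) * (ennreal (gauss r (m - h)) * indicator A m) \<partial>lborel) \<partial>lborel)"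
    by (rule lborel_pair.Fubini'[symmetric]) measurable
  also have "\<dots> = (\<integral>\<^sup>+m. (\<integral>\<^sup>+h. ennreal (gauss t h * gauss r (m - h)) \<partial>lborel) * indicator A m \<partial>lborel)"
    by (subst nn_integral_multc[symmetric]) (auto simp: ennreal_mult mult.assoc)
  also have "\<dots> = (\<integral>\<^sup>+m. indicator A m \<partial>heat (t + r))"
    using assms by (simp add: nn_integral_gauss_convolution nn_integral_heat del: nn_integral_indicator)
  finally show "emeasure (distr (heat t \<Otimes>\<^sub>M heat r) borel (\<lambda>p. fst p + snd p)) A = emeasure (heat (t + r)) A"
    by simp
qed simp

lemma integral_heat_convolution:
  fixes f :: "'a::euclidean_space \<Rightarrow> real"
  assumes "0 < t" "0 < r" and [measurable]: "f \<in> borel_measurable borel" and B: "\<And>x. \<bar>f x\<bar> \<le> B"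
  shows "(\<integral>h. (\<integral>k. f (h + k) \<partial>heat r) \<partial>heat t) = (\<integral>h. f h \<partial>heat (t + r))"
proof -
  interpret T: prob_space "heat t :: 'a measure" using assms by (intro prob_space_heat)
  interpret R: prob_space "heat r :: 'a measure" using assms by (intro prob_space_heat)
  interpret TR: pair_prob_space "heat t :: 'a measure" "heat r :: 'a measure" ..
  have "integrable (heat t \<Otimes>\<^sub>M heat r) (\<lambda>(h, k). f (h + k))"
    by (rule TR.P.integrable_const_bound[where B = B]) (use B in auto)
  from TR.integral_fst'[OF this[unfolded case_prod_beta]]
  have "(\<integral>h. (\<integral>k. f (h + k) \<partial>heat r) \<partial>heat t) = (\<integral>p. f (fst p + snd p) \<partial>(heat t \<Otimes>\<^sub>M heat r))"
    by simp
  also have "\<dots> = (\<integral>h. f h \<partial>heat (t + r))"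
    using integral_distr[of "\<lambda>p. fst p + snd p" "heat t \<Otimes>\<^sub>M heat r" borel f] assms
    by (simp add: heat_convolution)
  finally show ?thesis .
qed

section \<open>Differences and the heat semigroup\<close>

definition sd :: "'a::euclidean_space \<Rightarrow> ('a \<Rightarrow> real) \<Rightarrow> 'a \<Rightarrow> real" where
  "sd h g = (\<lambda>x. g (x + h) - g x)"

definition modulus :: "('a::euclidean_space \<Rightarrow> real) \<Rightarrow> 'a \<Rightarrow> real" where
  "modulus g h = sqnorm (sd h g)"

definition corr :: "('a::euclidean_space \<Rightarrow> real) \<Rightarrow> 'a \<Rightarrow> real" where
  "corr g h = (\<integral>x. g (x + h) * g x \<partial>lborel)"

lemma sd_L2: "g \<in> L2 \<Longrightarrow> sd h g \<in> L2"
  unfolding sd_def by (intro L2_diff L2_shift)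

lemma sd_commute: "sd h (sd k g) = sd k (sd h g)"
  by (auto simp: sd_def fun_eq_iff algebra_simps)

lemma corr_measurable [measurable]:
  assumes "g \<in> L2"
  shows "corr g \<in> borel_measurable borel"
proof -
  have [measurable]: "g \<in> borel_measurable borel" using assms by auto
  show ?thesis unfolding corr_def[abs_def] by measurable
qed

lemma modulus_measurable [measurable]:
  assumes "g \<in> L2"
  shows "modulus g \<in> borel_measurable borel"
proof -
  have [measurable]: "g \<in> borel_measurable borel" using assms by auto
  show ?thesis unfolding modulus_def[abs_def] sqnorm_def sd_def by measurable
qed

lemma modulus_sd_measurable [measurable]:
  fixes g :: "'a::euclidean_space \<Rightarrow> real"
  assumes "g \<in> L2"
  shows "(\<lambda>p. modulus (sd (fst p) g) (snd p)) \<in> borel_measurable (borel \<Otimes>\<^sub>M borel)"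
proof -
  have [measurable]: "g \<in> borel_measurable borel" using assms by auto
  show ?thesis unfolding modulus_def[abs_def] sqnorm_def sd_def by measurable
qed

lemma modulus_nonneg: "0 \<le> modulus g h"
  by (simp add: modulus_def sqnorm_nonneg)

lemma corr_bound: "g \<in> L2 \<Longrightarrow> \<bar>corr g h\<bar> \<le> sqnorm g"
  using L2_Cauchy_Schwarz[OF L2_shift[of g h], of g]
  by (simp add: corr_def sqnorm_shift sqnorm_nonneg)

lemma corr_shift:
  assumes "g \<in> L2"
  shows "(\<integral>x. g (x + a) * g (x + b) \<partial>lborel) = corr g (a - b)"
proof -
  have [measurable]: "g \<in> borel_measurable borel" using assms by auto
  show ?thesis
    unfolding corr_def
    using integral_lborel_shift[of "\<lambda>x. g (x + (a - b)) * g x" b]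
    by (simp add: algebra_simps)
qed

lemma modulus_corr:
  assumes "g \<in> L2"
  shows "modulus g h = 2 * sqnorm g - 2 * corr g h"
  using sqnorm_expand(2)[OF L2_shift[OF assms, of h] assms]
  by (simp add: modulus_def sd_def sqnorm_shift assms corr_def)

lemma modulus_le: "g \<in> L2 \<Longrightarrow> modulus g h \<le> 4 * sqnorm g"
  using modulus_corr[of g h] corr_bound[of g h] by linarith

text \<open>On the Fourier side a difference with increment h multiplies the spectral density by 2
  minus two conjugate phases; this is the same identity for the autocorrelation.\<close>

lemma corr_sd:
  assumes "g \<in> L2"
  shows "corr (sd h g) m = 2 * corr g m - corr g (m + h) - corr g (m - h)"
proof -
  have i: "integrable lborel (\<lambda>x. g (x + a) * g (x + b))" for a b
    using assms by (intro L2_prod_integrable L2_shift)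
  have "corr (sd h g) m = (\<integral>x. g (x + (m + h)) * g (x + h) - g (x + (m + h)) * g (x + 0)
      - g (x + m) * g (x + h) + g (x + m) * g (x + 0) \<partial>lborel)"
    unfolding corr_def sd_def by (simp add: algebra_simps)
  also have "\<dots> = corr g m - corr g (m + h) - corr g (m - h) + corr g m"
    using i by (simp add: corr_shift[OF assms] del: add_0_right)
  finally show ?thesis by simp
qed

lemma modulus_add_le:
  assumes "f \<in> L2" "g \<in> L2"
  shows "modulus (\<lambda>x. f x + g x) h \<le> 2 * modulus f h + 2 * modulus g h"
proof -
  have "sd h (\<lambda>x. f x + g x) = (\<lambda>x. sd h f x + sd h g x)"
    by (auto simp: sd_def)
  then show ?thesis
    using sqnorm_add_le[OF sd_L2[OF assms(1)] sd_L2[OF assms(2)], of h h] by (simp add: modulus_def)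
qed

text \<open>A translation by h + k is made in two moves, and translating does not change the norm;
  the factors 2 come from squaring. This quasi-subadditivity is what lets Gaussian averages control
  single increments.\<close>

lemma modulus_subadditive:
  assumes "g \<in> L2"
  shows "modulus g (h + k) \<le> 2 * modulus g h + 2 * modulus g k"
proof -
  have "sd (h + k) g = (\<lambda>x. sd h g (x + k) + sd k g x)"
    by (auto simp: sd_def algebra_simps)
  then show ?thesis
    unfolding modulus_def
    using sqnorm_add_le[OF L2_shift[OF sd_L2[OF assms, of h]] sd_L2[OF assms, of k], of k]
    by (simp add: sqnorm_shift sd_L2 assms)
qed

lemma modulus_shift:
  assumes "g \<in> L2"
  shows "modulus (\<lambda>x. g (x + h)) k = modulus g k"
proof -
  have "sd k (\<lambda>x. g (x + h)) = (\<lambda>x. sd k g (x + h))"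
    by (auto simp: sd_def algebra_simps)
  then show ?thesis by (simp add: modulus_def sqnorm_shift sd_L2 assms)
qed

lemma modulus_cmult: "modulus (\<lambda>x. c * g x) h = c\<^sup>2 * modulus g h"
proof -
  have "sd h (\<lambda>x. c * g x) = (\<lambda>x. c * sd h g x)"
    by (auto simp: sd_def algebra_simps)
  then show ?thesis by (simp add: modulus_def sqnorm_cmult)
qed

section \<open>Quadratic forms of the heat semigroup\<close>

definition phi :: "('a::euclidean_space \<Rightarrow> real) \<Rightarrow> real \<Rightarrow> real" where
  "phi g t = (\<integral>h. corr g h \<partial>heat t)"

definition psi :: "('a::euclidean_space \<Rightarrow> real) \<Rightarrow> real \<Rightarrow> real" where
  "psi g t = (\<integral>h. modulus g h \<partial>heat t) / 2"

text \<open>With P_t averaging over \<open>heat t\<close>, \<open>phi g t\<close> is <P_t g, g>,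
  \<open>psi g t\<close> is <(1 - P_t) g, g>, whence its factor 1/2, and \<open>psi2 g t r\<close>
  is the D(t,r) of the overview. It is written through \<open>psi\<close> alone, so that the
  operators P_t never have to be composed.\<close>

definition psi2 :: "('a::euclidean_space \<Rightarrow> real) \<Rightarrow> real \<Rightarrow> real \<Rightarrow> real" where
  "psi2 g t r = psi g t + psi g r - psi g (t + r)"

lemma integrable_heat:
  fixes f :: "'a::euclidean_space \<Rightarrow> real"
  assumes "0 < t" "f \<in> borel_measurable borel" "\<And>x. \<bar>f x\<bar> \<le> B"
  shows "integrable (heat t) f"
proof -
  interpret prob_space "heat t :: 'a measure" using assms(1) by (rule prob_space_heat)
  show ?thesis using assms by (intro integrable_const_bound[of _ B]) auto
qed

lemma integrable_heat_corr: "0 < t \<Longrightarrow> g \<in> L2 \<Longrightarrow> integrable (heat t) (corr g)"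
  by (rule integrable_heat[where B = "sqnorm g"]) (auto intro: corr_bound)

lemma integrable_heat_modulus: "0 < t \<Longrightarrow> g \<in> L2 \<Longrightarrow> integrable (heat t) (modulus g)"
  by (rule integrable_heat[where B = "4 * sqnorm g"]) (auto intro: modulus_le simp: modulus_nonneg)

lemma integral_heat_const: "0 < t \<Longrightarrow> (\<integral>h. c \<partial>(heat t :: 'a::euclidean_space measure)) = (c::real)"
  using prob_space.prob_space[OF prob_space_heat[of t, where 'a='a]] by simp

lemma integrable_heat_const: "0 < t \<Longrightarrow> integrable (heat t :: 'a::euclidean_space measure) (\<lambda>_. c::real)"
  by (rule integrable_heat[where B = "\<bar>c\<bar>"]) auto

lemma psi_phi: "0 < t \<Longrightarrow> g \<in> L2 \<Longrightarrow> psi g t = sqnorm g - phi g t"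
  unfolding psi_def phi_def
  by (subst ext[OF modulus_corr])
     (simp_all add: integrable_heat_corr integrable_heat_const integral_heat_const diff_divide_distrib
      del: lebesgue_integral_const)

text \<open>Positivity is that of \<open>\<langle>P\<^sub>t g, g\<rangle> = \<parallel>P\<^bsub>t/2\<^esub> g\<parallel>\<^sup>2\<close> for the heat semigroup \<open>P\<close>.\<close>

lemma phi_nonneg:
  fixes g :: "'a::euclidean_space \<Rightarrow> real"
  assumes "0 < t" and g: "g \<in> L2"
  shows "0 \<le> phi g t"
proof -
  let ?\<nu> = "heat (t / 2) :: 'a measure"
  interpret \<nu>: prob_space ?\<nu> using assms by (intro prob_space_heat) auto
  have [measurable]: "g \<in> borel_measurable borel" "corr g \<in> borel_measurable borel"
    using g by auto
  have "phi g t = (\<integral>h. (\<integral>k. corr g (h + k) \<partial>?\<nu>) \<partial>?\<nu>)"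
    unfolding phi_def using assms corr_bound[OF g]
    by (subst integral_heat_convolution[where B = "sqnorm g"]) auto
  also have "\<dots> = (\<integral>h. (\<integral>k. corr g (h - k) \<partial>?\<nu>) \<partial>?\<nu>)"
  proof -
    have "(\<integral>k. corr g (h + k) \<partial>?\<nu>) = (\<integral>k. corr g (h - k) \<partial>?\<nu>)" for h
      using integral_heat_uminus[of "\<lambda>k. corr g (h - k)" "t / 2"] by simp
    then show ?thesis by (simp only:)
  qed
  also have "\<dots> = (\<integral>h. (\<integral>k. (\<integral>x. g (x + h) * g (x + k) \<partial>lborel) \<partial>?\<nu>) \<partial>?\<nu>)"
    by (simp add: corr_shift[OF g])
  also have "\<dots> = sqnorm (\<lambda>x. \<integral>h. g (x + h) \<partial>?\<nu>)"
    by (rule L2_mixture(3)[where B = "sqrt (sqnorm g)", symmetric])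
       (auto simp: L2_shift g sqnorm_shift sqnorm_nonneg \<nu>.finite_measure_axioms)
  finally show ?thesis by (simp add: sqnorm_nonneg)
qed

text \<open>Average \<open>corr_sd\<close> over h: the terms with shifts h and -h agree because the
  Gaussian is even, and each of them convolves \<open>heat r\<close> with \<open>heat t\<close>. The
  right-hand side is 2 <(1 - P_t) P_r g, g>.\<close>

lemma phi_sd:
  fixes g :: "'a::euclidean_space \<Rightarrow> real"
  assumes t: "0 < t" and r: "0 < r" and g: "g \<in> L2"
  shows "(\<integral>h. phi (sd h g) r \<partial>heat t) = 2 * phi g r - 2 * phi g (t + r)"
proof -
  interpret T: prob_space "heat t :: 'a measure" using t by (rule prob_space_heat)
  interpret R: prob_space "heat r :: 'a measure" using r by (rule prob_space_heat)
  have [measurable]: "corr g \<in> borel_measurable borel"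
    using g by auto
  note cb = corr_bound[OF g]
  have ic: "integrable (heat r) (\<lambda>m. corr g (m + h))" "integrable (heat r) (\<lambda>m. corr g (m - h))" for h
    by (rule integrable_heat[where B = "sqnorm g"]; use cb r in auto)+
  have b: "\<bar>\<integral>m. corr g (m + h) \<partial>heat r\<bar> \<le> sqnorm g" for h
  proof -
    have "\<bar>\<integral>m. corr g (m + h) \<partial>heat r\<bar> \<le> (\<integral>m. \<bar>corr g (m + h)\<bar> \<partial>heat r)"
      by (rule integral_abs_bound)
    also have "\<dots> \<le> (\<integral>m. sqnorm g \<partial>(heat r :: 'a measure))"
      using ic cb r by (intro integral_mono integrable_abs integrable_heat_const) auto
    also have "\<dots> = sqnorm g" by (rule integral_heat_const[OF r])
    finally show ?thesis .
  qed
  have i1: "integrable (heat t) (\<lambda>h. \<integral>m. corr g (m + h) \<partial>heat r)"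
    by (rule integrable_heat[where B = "sqnorm g"]) (use b t in auto)
  have i2: "integrable (heat t) (\<lambda>h. \<integral>m. corr g (m - h) \<partial>heat r)"
    by (rule integrable_heat[where B = "sqnorm g"]) (use b[of "- h" for h] t in auto)
  have "(\<integral>h. phi (sd h g) r \<partial>heat t)
     = (\<integral>h. 2 * phi g r - (\<integral>m. corr g (m + h) \<partial>heat r) - (\<integral>m. corr g (m - h) \<partial>heat r) \<partial>heat t)"
    unfolding phi_def
    by (subst ext[OF corr_sd[OF g]]) (use ic r g in \<open>simp add: integrable_heat_corr\<close>)
  also have "\<dots> = 2 * phi g r - (\<integral>h. \<integral>m. corr g (m + h) \<partial>heat r \<partial>heat t) - (\<integral>h. \<integral>m. corr g (m - h) \<partial>heat r \<partial>heat t)"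
    using i1 i2 t T.prob_space by simp
  also have "(\<integral>h. \<integral>m. corr g (m - h) \<partial>heat r \<partial>heat t) = (\<integral>h. \<integral>m. corr g (m + h) \<partial>heat r \<partial>heat t)"
    using integral_heat_uminus[of "\<lambda>h. \<integral>m. corr g (m + h) \<partial>heat r" t] by simp
  also have "(\<integral>h. \<integral>m. corr g (m + h) \<partial>heat r \<partial>heat t) = phi g (t + r)"
    using integral_heat_convolution[OF t r, of "corr g" "sqnorm g"] cb
    by (simp add: phi_def add.commute)
  finally show ?thesis by simp
qed

lemma psi_nonneg: "0 \<le> psi g t"
  by (simp add: psi_def modulus_nonneg)

lemma psi_le: "0 < t \<Longrightarrow> g \<in> L2 \<Longrightarrow> psi g t \<le> sqnorm g"
  using psi_phi[of t g] phi_nonneg[of t g] by simp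

text \<open>For t < r the difference of the two values is half of an average over
  \<open>heat (r - t)\<close> of the nonnegative numbers \<open>phi (sd h g) t\<close>.\<close>

lemma psi_mono:
  assumes "0 < t" "t \<le> r" "g \<in> L2"
  shows "psi g t \<le> psi g r"
proof (cases "t = r")
  case False
  have "0 \<le> (\<integral>h. phi (sd h g) t \<partial>heat (r - t))"
    using assms by (intro integral_nonneg_AE) (auto intro!: phi_nonneg sd_L2)
  then show ?thesis
    using assms False phi_sd[of "r - t" t g] by (simp add: psi_phi)
qed simp

lemma psi_measurable [measurable]:
  assumes "g \<in> L2"
  shows "psi g \<in> borel_measurable borel"
proof -
  have [measurable]: "modulus g \<in> borel_measurable borel" using assms by auto
  show ?thesis
    unfolding psi_def[abs_def] integral_heat[OF \<open>modulus g \<in> borel_measurable borel\<close>] by measurable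
qed

lemma psi_sd_measurable [measurable]:
  fixes g :: "'a::euclidean_space \<Rightarrow> real"
  assumes g: "g \<in> L2"
  shows "(\<lambda>p. psi (sd (fst p) g) (snd p)) \<in> borel_measurable (borel \<Otimes>\<^sub>M borel)"
proof -
  note [measurable] = modulus_sd_measurable[OF g]
  have *: "psi (sd h g) t = (\<integral>k. gauss t k * modulus (sd h g) k \<partial>lborel) / 2" for h t
    unfolding psi_def by (subst integral_heat) (auto simp: sd_L2 g)
  have "(\<lambda>(p::'a \<times> real, k::'a). modulus (sd (fst p) g) k) \<in> borel_measurable ((borel \<Otimes>\<^sub>M borel) \<Otimes>\<^sub>M borel)"
    using measurable_compose[of "\<lambda>q. (fst (fst q), snd q)" "(borel \<Otimes>\<^sub>M borel) \<Otimes>\<^sub>M borel" "borel \<Otimes>\<^sub>M borel", OF _ modulus_sd_measurable[OF g]]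
    by (simp add: split_beta')
  then show ?thesis unfolding * by measurable
qed

text \<open>The squared norm of \<open>sd h g\<close> is \<open>modulus g h\<close>, so
  \<open>phi_sd\<close> combines with the average that defines \<open>psi\<close>. The identity
  exhibits \<open>psi2\<close> as an average of values of \<open>psi\<close>, and through it
  positivity, monotonicity and comparison pass from \<open>psi\<close> to
  \<open>psi2\<close>.\<close>

lemma psi_sd:
  assumes "0 < t" "0 < r" "g \<in> L2"
  shows "(\<integral>h. psi (sd h g) r \<partial>heat t) = 2 * psi2 g t r"
proof -
  have m: "(\<lambda>h. psi (sd h g) r) \<in> borel_measurable borel"
    using measurable_compose[of "\<lambda>h. (h, r)" borel "borel \<Otimes>\<^sub>M borel", OF _ psi_sd_measurable[OF assms(3)]]
    by simp
  have bd: "\<bar>psi (sd h g) r\<bar> \<le> 4 * sqnorm g" for h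
    using psi_le[of r "sd h g"] modulus_le[of g h] assms
    by (simp add: sd_L2 psi_nonneg modulus_def)
  have i: "integrable (heat t) (\<lambda>h. psi (sd h g) r)"
    by (rule integrable_heat[OF assms(1) m bd])
  have e: "phi (sd h g) r = modulus g h - psi (sd h g) r" for h
    using assms by (simp add: psi_phi sd_L2 modulus_def)
  have "(\<integral>h. phi (sd h g) r \<partial>heat t) = 2 * psi g t - (\<integral>h. psi (sd h g) r \<partial>heat t)"
    unfolding e using i assms by (simp add: integrable_heat_modulus psi_def)
  then show ?thesis
    using assms by (simp add: phi_sd psi2_def psi_phi)
qed

lemma integrable_heat_psi_sd:
  assumes "0 < t" "0 < r" "g \<in> L2"
  shows "integrable (heat t) (\<lambda>h. psi (sd h g) r)"
proof (rule integrable_heat[OF assms(1)])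
  show "(\<lambda>h. psi (sd h g) r) \<in> borel_measurable borel"
    using measurable_compose[of "\<lambda>h. (h, r)" borel "borel \<Otimes>\<^sub>M borel", OF _ psi_sd_measurable[OF assms(3)]]
    by simp
  show "\<bar>psi (sd h g) r\<bar> \<le> 4 * sqnorm g" for h
    using psi_le[of r "sd h g"] modulus_le[of g h] assms
    by (simp add: sd_L2 psi_nonneg modulus_def)
qed

lemma psi2_commute: "psi2 g t r = psi2 g r t"
  by (simp add: psi2_def add.commute)

lemma psi2_nonneg:
  assumes "0 < t" "0 < r" "g \<in> L2"
  shows "0 \<le> psi2 g t r"
proof -
  have "0 \<le> (\<integral>h. psi (sd h g) r \<partial>heat t)" by (simp add: psi_nonneg)
  then show ?thesis using assms by (simp add: psi_sd)
qed

text \<open>In the second scale this is \<open>psi_mono\<close> under the average of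
  \<open>psi_sd\<close>; symmetry supplies the first scale.\<close>

lemma psi2_mono:
  assumes "0 < t" "t \<le> t'" "0 < r" "r \<le> r'" "g \<in> L2"
  shows "psi2 g t r \<le> psi2 g t' r'"
proof -
  have *: "psi2 g t r \<le> psi2 g t r'" if "0 < t" "0 < r" "r \<le> r'" for t r r'
  proof -
    have "(\<integral>h. psi (sd h g) r \<partial>heat t) \<le> (\<integral>h. psi (sd h g) r' \<partial>heat t)"
      using that assms(5) by (intro integral_mono integrable_heat_psi_sd psi_mono sd_L2) auto
    then show ?thesis using that assms(5) by (simp add: psi_sd)
  qed
  from *[of t r r'] *[of r' t t'] assms show ?thesis
    by (simp add: psi2_commute[of g r'])
qed

lemma psi_add_le:
  assumes "0 < t" "f \<in> L2" "g \<in> L2"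
  shows "psi (\<lambda>x. f x + g x) t \<le> 2 * psi f t + 2 * psi g t"
proof -
  have "(\<integral>h. modulus (\<lambda>x. f x + g x) h \<partial>heat t) \<le> (\<integral>h. 2 * modulus f h + 2 * modulus g h \<partial>heat t)"
    using assms by (intro integral_mono modulus_add_le integrable_heat_modulus L2_add Bochner_Integration.integrable_add) (auto intro: integrable_heat_modulus)
  then show ?thesis using assms by (simp add: psi_def integrable_heat_modulus)
qed

lemma psi_shift: "g \<in> L2 \<Longrightarrow> psi (\<lambda>x. g (x + h)) t = psi g t"
  by (simp add: psi_def modulus_shift)

lemma psi_cmult: "psi (\<lambda>x. c * g x) t = c\<^sup>2 * psi g t"
  by (simp add: psi_def modulus_cmult)

lemma psi_sd_subadditive:
  assumes "0 < t" "g \<in> L2"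
  shows "psi (sd (h + k) g) t \<le> 2 * psi (sd h g) t + 2 * psi (sd k g) t"
proof -
  have "sd (h + k) g = (\<lambda>x. sd h g (x + k) + sd k g x)"
    by (auto simp: sd_def algebra_simps)
  then show ?thesis
    using psi_add_le[OF assms(1) L2_shift[OF sd_L2[OF assms(2), of h]] sd_L2[OF assms(2), of k], of k]
    by (simp add: psi_shift sd_L2 assms)
qed

lemma psi_sd_le:
  assumes "0 < t" "g \<in> L2"
  shows "psi (sd h g) t \<le> 4 * psi g t"
proof -
  have "sd h g = (\<lambda>x. g (x + h) + (-1) * g x)"
    by (auto simp: sd_def)
  then show ?thesis
    using psi_add_le[OF assms(1) L2_shift[OF assms(2)] L2_cmult[OF assms(2), of "-1"], of h]
    by (simp only: psi_shift[OF assms(2)] psi_cmult) simp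
qed

lemma psi2_sd_le:
  assumes "0 < t" "0 < r" "g \<in> L2"
  shows "psi2 (sd h g) t r \<le> 4 * psi2 g t r"
proof -
  have "(\<integral>k. psi (sd k (sd h g)) r \<partial>heat t) \<le> (\<integral>k. 4 * psi (sd k g) r \<partial>heat t)"
  proof (intro integral_mono)
    show "psi (sd k (sd h g)) r \<le> 4 * psi (sd k g) r" for k
      using psi_sd_le[of r "sd k g" h] assms by (simp add: sd_L2 sd_commute[of k h])
  qed (use assms in \<open>auto intro: integrable_heat_psi_sd sd_L2\<close>)
  then show ?thesis using assms by (simp add: psi_sd sd_L2)
qed

text \<open>For each increment h, 2 psi(r) - psi(2r) taken for \<open>sd h g\<close> is a diagonal
  value of \<open>psi2\<close>, at most four times that of g; averaging over \<open>heat t\<close>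
  gives the claim. Hence halving r raises \<open>psi2 g r t / r\<close> by at most a diagonal term,
  the step of a telescoping sum.\<close>

lemma psi2_double:
  assumes "0 < t" "0 < r" "g \<in> L2"
  shows "2 * psi2 g r t \<le> psi2 g (2 * r) t + 2 * psi2 g r r"
proof -
  have "(\<integral>h. 2 * psi (sd h g) r - psi (sd h g) (2 * r) \<partial>heat t) \<le> (\<integral>h. 4 * psi2 g r r \<partial>(heat t :: 'a measure))"
  proof (intro integral_mono)
    show "2 * psi (sd h g) r - psi (sd h g) (2 * r) \<le> 4 * psi2 g r r" for h
      using psi2_sd_le[OF assms(2,2,3), of h] unfolding psi2_def[of "sd h g"] mult_2[symmetric] .
    show "integrable (heat t) (\<lambda>h. 2 * psi (sd h g) r - psi (sd h g) (2 * r))"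
      using assms
      by (intro Bochner_Integration.integrable_diff integrable_mult_right integrable_heat_psi_sd) auto
    show "integrable (heat t) (\<lambda>h::'a. 4 * psi2 g r r)"
      using assms by (intro integrable_heat_const)
  qed
  then show ?thesis
    using assms by (simp add: integral_heat_const psi_sd integrable_heat_psi_sd psi2_commute[of g t]
        del: lebesgue_integral_const)
qed

section \<open>The Gagliardo seminorm as a mixture of Gaussian moduli\<close>

text \<open>At the origin \<open>powr\<close> returns 0, so the singularity is not visible as a
  value; the origin is a null set.\<close>

definition kern :: "real \<Rightarrow> 'a::euclidean_space \<Rightarrow> real" where
  "kern \<sigma> h = norm h powr (- (real DIM('a) + 2 * \<sigma>))"

lemma kern_measurable [measurable]: "kern \<sigma> \<in> borel_measurable borel"
  unfolding kern_def[abs_def] by measurable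

lemma kern_nonneg [simp]: "0 \<le> kern \<sigma> h"
  by (simp add: kern_def)

lemma kern_uminus [simp]: "kern \<sigma> (- h) = kern \<sigma> h"
  by (simp add: kern_def)

text \<open>The substitution of 1/t shows the integral to be Gamma(a). Near 0 the m-th Taylor term
  of exp(1/t), with m \<ge> 1 + a, dominates the power; beyond 1 the power itself is
  integrable.\<close>

lemma mixing_constant:
  assumes a: "0 < a"
  obtains c :: real where "0 < c" "(\<integral>\<^sup>+t. pw (-1 - a) t * ennreal (exp (- (1 / t))) \<partial>lborel) = ennreal c"
proof -
  let ?I = "\<integral>\<^sup>+t. pw (-1 - a) t * ennreal (exp (- (1 / t))) \<partial>lborel"
  obtain m :: nat where m: "1 + a \<le> real m" using real_arch_simple by blast
  have bound: "t powr (-1 - a) * exp (- (1 / t)) \<le> fact m" if t: "0 < t" "t < 1" for t :: real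
  proof -
    have x1: "1 \<le> 1 / t" using t by simp
    have "(1 / t) ^ m / fact m \<le> exp (1 / t)"
    proof -
      have "(1 / t) ^ m /\<^sub>R fact m = (\<Sum>n\<in>{m}. (1 / t) ^ n /\<^sub>R fact n)" by simp
      also have "\<dots> \<le> (\<Sum>n. (1 / t) ^ n /\<^sub>R fact n)"
        using t by (intro sum_le_suminf summable_exp_generic) auto
      finally show ?thesis by (simp add: exp_def divide_inverse mult.commute)
    qed
    then have "(1 / t) ^ m \<le> fact m * exp (1 / t)"
      by (simp only: pos_divide_le_eq fact_gt_zero mult.commute)
    then have "(1 / t) ^ m * exp (- (1 / t)) \<le> fact m * exp (1 / t) * exp (- (1 / t))"
      by (rule mult_right_mono) simp
    then have "(1 / t) ^ m * exp (- (1 / t)) \<le> fact m"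
      by (simp add: mult.assoc mult_exp_exp)
    moreover have "t powr (-1 - a) \<le> (1 / t) ^ m"
    proof -
      have "t powr (-1 - a) = (1 / t) powr (1 + a)"
        using t powr_minus[of t "1 + a"] powr_divide[of 1 t "1 + a"] by (simp add: divide_inverse)
      also have "\<dots> \<le> (1 / t) powr real m"
        using x1 m by (intro powr_mono) auto
      finally show ?thesis using t by (simp add: powr_realpow)
    qed
    ultimately show ?thesis
      by (meson exp_ge_zero mult_right_mono order_trans)
  qed
  have "?I \<le> (\<integral>\<^sup>+t. ennreal (fact m) * indicator {0..1} t + pw (-1 - a) t * indicator {1..} t \<partial>lborel)"
  proof (rule nn_integral_mono)
    fix t :: real
    consider "t \<le> 0" | "0 < t" "t < 1" | "1 \<le> t" by linarith
    then show "pw (-1 - a) t * ennreal (exp (- (1 / t)))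
      \<le> ennreal (fact m) * indicator {0..1} t + pw (-1 - a) t * indicator {1..} t"
    proof cases
      case 2
      then have "pw (-1 - a) t * ennreal (exp (- (1 / t))) = ennreal (t powr (-1 - a) * exp (- (1 / t)))"
        by (simp add: pw_def ennreal_mult)
      also have "\<dots> \<le> ennreal (fact m)"
        using bound[OF 2] by (rule ennreal_leI)
      finally show ?thesis using 2 by simp
    next
      case 3
      have "pw (-1 - a) t * ennreal (exp (- (1 / t))) \<le> pw (-1 - a) t * 1"
        using 3 by (intro mult_left_mono) (auto simp flip: ennreal_1 intro!: ennreal_leI)
      then show ?thesis using 3 by (simp add: add_increasing)
    qed (simp add: pw_def)
  qed
  also have "\<dots> = (\<integral>\<^sup>+t. ennreal (fact m) * indicator {0..1} (t::real) \<partial>lborel) + (\<integral>\<^sup>+t. pw (-1 - a) t * indicator {1..} t \<partial>lborel)"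
    by (subst nn_integral_add) auto
  also have "\<dots> < \<infinity>"
    using pw_tail_finite[OF a, of 1] by (simp add: nn_integral_cmult_indicator)
  finally have fin: "?I < \<infinity>" .
  have "?I \<noteq> 0"
  proof
    assume "?I = 0"
    then have "AE t in lborel. pw (-1 - a) t * ennreal (exp (- (1 / t))) = 0"
      by (subst (asm) nn_integral_0_iff_AE) auto
    then have "AE t in lborel. (t::real) \<notin> {1..2}"
      by eventually_elim (auto simp: pw_def)
    then have "{1..2::real} \<in> null_sets lborel"
      by (subst (asm) AE_iff_null_sets[symmetric]) auto
    then show False by (simp add: null_sets_def)
  qed
  with fin show ?thesis
    by (intro that[of "enn2real ?I"]) (auto simp: enn2real_positive_iff zero_less_iff_neq_zero)
qed

text \<open>Rescaling t by the squared norm of h extracts the homogeneity: the normalisation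
  t^(-N/2) raises the exponent to \<sigma> + N/2, whose double is the exponent in
  \<open>kern\<close>. At h = 0 the mixture is infinite while \<open>kern\<close> is 0.\<close>

lemma gauss_mixture:
  assumes \<sigma>: "0 < \<sigma>"
  obtains C where "0 < C" "\<And>h :: 'a::euclidean_space. h \<noteq> 0 \<Longrightarrow>
    (\<integral>\<^sup>+t. pw (-1 - \<sigma>) t * ennreal (gauss t h) \<partial>lborel) = ennreal (C * kern \<sigma> h)"
proof -
  let ?N = "real DIM('a)" and ?\<gamma> = "gauss_mass TYPE('a)"
  have "0 < \<sigma> + ?N / 2" using \<sigma> by (simp add: add_pos_nonneg)
  then obtain c where c: "0 < c"
      "(\<integral>\<^sup>+t. pw (-1 - (\<sigma> + ?N / 2)) t * ennreal (exp (- (1 / t))) \<partial>lborel) = ennreal c"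
    by (rule mixing_constant)
  have main: "(\<integral>\<^sup>+t. pw (-1 - \<sigma>) t * ennreal (gauss t h) \<partial>lborel) = ennreal (c / ?\<gamma> * kern \<sigma> h)"
    if h: "h \<noteq> 0" for h :: 'a
  proof -
    let ?b = "-1 - (\<sigma> + ?N / 2)" and ?n = "(norm h)\<^sup>2"
    have n: "0 < ?n" using h by simp
    have "pw (-1 - \<sigma>) t * ennreal (gauss t h) = ennreal (1 / ?\<gamma>) * (pw ?b t * ennreal (exp (- (1 / ((1 / ?n) * t)))))" for t
    proof (cases "0 < t")
      case True
      have "t powr ?b = t powr (-1 - \<sigma>) / t powr (?N / 2)"
        by (simp only: powr_diff[symmetric]) (simp add: algebra_simps)
      then show ?thesis
        using gauss_mass_pos[where 'a='a] True
        by (simp add: pw_def gauss_def ennreal_mult[symmetric])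
    qed (simp add: pw_def)
    then have "(\<integral>\<^sup>+t. pw (-1 - \<sigma>) t * ennreal (gauss t h) \<partial>lborel)
      = ennreal (1 / ?\<gamma>) * (\<integral>\<^sup>+t. pw ?b t * ennreal (exp (- (1 / ((1 / ?n) * t)))) \<partial>lborel)"
      by (simp add: nn_integral_cmult)
    also have "(\<integral>\<^sup>+t. pw ?b t * ennreal (exp (- (1 / ((1 / ?n) * t)))) \<partial>lborel)
       = ennreal ((1 / ?n) powr (-1 - ?b)) * ennreal c"
      using n by (subst pw_scale[where f = "\<lambda>t. ennreal (exp (- (1 / t)))"]) (auto simp: c)
    also have "(1 / ?n) powr (-1 - ?b) = kern \<sigma> h"
    proof -
      have "1 / ?n = norm h powr -2" using h by (simp add: powr_minus divide_inverse)
      moreover have "-1 - ?b = \<sigma> + ?N / 2" by simp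
      ultimately have "(1 / ?n) powr (-1 - ?b) = (norm h powr -2) powr (\<sigma> + ?N / 2)" by (simp only:)
      also have "\<dots> = kern \<sigma> h"
        by (simp add: powr_powr kern_def algebra_simps)
      finally show ?thesis .
    qed
    finally show ?thesis
      using gauss_mass_pos[where 'a='a] c(1) by (simp add: ennreal_mult[symmetric] mult.commute)
  qed
  show ?thesis
    by (rule that[of "c / ?\<gamma>"]) (use c gauss_mass_pos[where 'a='a] main in auto)
qed

text \<open>The squared Gagliardo seminorm in terms of the increments h = y - x. Its values are in
  \<open>ennreal\<close>, so mixtures and Tonelli apply before finiteness is known.\<close>

definition gag :: "real \<Rightarrow> ('a::euclidean_space \<Rightarrow> real) \<Rightarrow> ennreal" where
  "gag \<sigma> g = (\<integral>\<^sup>+h. ennreal (kern \<sigma> h) * ennreal (modulus g h) \<partial>lborel)"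

text \<open>Keeping f arbitrary makes one formula serve for moduli, for the seminorms of differences
  and for the weight \<open>theta\<close>.\<close>

lemma nn_integral_kern_mixture:
  assumes \<sigma>: "0 < \<sigma>"
  obtains C where "0 < C" "\<And>f :: 'a::euclidean_space \<Rightarrow> ennreal. f \<in> borel_measurable borel \<Longrightarrow>
    ennreal C * (\<integral>\<^sup>+h. ennreal (kern \<sigma> h) * f h \<partial>lborel) = (\<integral>\<^sup>+t. pw (-1 - \<sigma>) t * (\<integral>\<^sup>+h. f h \<partial>heat t) \<partial>lborel)"
proof -
  obtain C where C: "0 < C" "\<And>h :: 'a. h \<noteq> 0 \<Longrightarrow>
    (\<integral>\<^sup>+t. pw (-1 - \<sigma>) t * ennreal (gauss t h) \<partial>lborel) = ennreal (C * kern \<sigma> h)"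
    using gauss_mixture[OF \<sigma>] by blast
  show ?thesis
  proof (rule that[OF C(1)])
    fix f :: "'a \<Rightarrow> ennreal" assume [measurable]: "f \<in> borel_measurable borel"
    have "ennreal C * (\<integral>\<^sup>+h. ennreal (kern \<sigma> h) * f h \<partial>lborel) = (\<integral>\<^sup>+h. ennreal (C * kern \<sigma> h) * f h \<partial>lborel)"
      using C(1) by (simp add: nn_integral_cmult[symmetric] ennreal_mult mult.assoc)
    also have "\<dots> = (\<integral>\<^sup>+h. (\<integral>\<^sup>+t. pw (-1 - \<sigma>) t * ennreal (gauss t h) \<partial>lborel) * f h \<partial>lborel)"
      by (rule nn_integral_cong_AE) (use AE_lborel_singleton[of 0] C(2) in \<open>auto elim!: eventually_mono\<close>)
    also have "\<dots> = (\<integral>\<^sup>+h. (\<integral>\<^sup>+t. pw (-1 - \<sigma>) t * (ennreal (gauss t h) * f h) \<partial>lborel) \<partial>lborel)"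
      by (subst nn_integral_multc[symmetric]) (auto simp: mult.assoc)
    also have "\<dots> = (\<integral>\<^sup>+t. (\<integral>\<^sup>+h. pw (-1 - \<sigma>) t * (ennreal (gauss t h) * f h) \<partial>lborel) \<partial>lborel)"
      by (rule lborel_pair.Fubini') measurable
    also have "\<dots> = (\<integral>\<^sup>+t. pw (-1 - \<sigma>) t * (\<integral>\<^sup>+h. f h \<partial>heat t) \<partial>lborel)"
      by (simp add: nn_integral_cmult nn_integral_heat)
    finally show "ennreal C * (\<integral>\<^sup>+h. ennreal (kern \<sigma> h) * f h \<partial>lborel)
      = (\<integral>\<^sup>+t. pw (-1 - \<sigma>) t * (\<integral>\<^sup>+h. f h \<partial>heat t) \<partial>lborel)" .
  qed
qed

lemma nn_integral_modulus_heat: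
  "0 < t \<Longrightarrow> g \<in> L2 \<Longrightarrow> (\<integral>\<^sup>+h. ennreal (modulus g h) \<partial>heat t) = ennreal (2 * psi g t)"
  by (subst nn_integral_eq_integral) (auto simp: integrable_heat_modulus modulus_nonneg psi_def)

lemma gag_mixture:
  assumes "0 < \<sigma>"
  obtains C where "0 < C" "\<And>g :: 'a::euclidean_space \<Rightarrow> real. g \<in> L2 \<Longrightarrow>
    ennreal C * gag \<sigma> g = (\<integral>\<^sup>+t. pw (-1 - \<sigma>) t * ennreal (psi g t) \<partial>lborel)"
proof -
  obtain C where C: "0 < C" "\<And>f :: 'a::euclidean_space \<Rightarrow> ennreal. f \<in> borel_measurable borel \<Longrightarrow>
    ennreal C * (\<integral>\<^sup>+h. ennreal (kern \<sigma> h) * f h \<partial>lborel) = (\<integral>\<^sup>+t. pw (-1 - \<sigma>) t * (\<integral>\<^sup>+h. f h \<partial>heat t) \<partial>lborel)"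
    using nn_integral_kern_mixture[OF assms] by blast
  have "ennreal (C / 2) * gag \<sigma> g = (\<integral>\<^sup>+t. pw (-1 - \<sigma>) t * ennreal (psi g t) \<partial>lborel)" if g: "g \<in> L2" for g :: "'a \<Rightarrow> real"
  proof -
    have "ennreal C * gag \<sigma> g = (\<integral>\<^sup>+t. pw (-1 - \<sigma>) t * (\<integral>\<^sup>+h. ennreal (modulus g h) \<partial>heat t) \<partial>lborel)"
      unfolding gag_def using g by (intro C(2)) auto
    also have "\<dots> = (\<integral>\<^sup>+t. ennreal 2 * (pw (-1 - \<sigma>) t * ennreal (psi g t)) \<partial>lborel)"
    proof (rule nn_integral_cong)
      fix t
      show "pw (-1 - \<sigma>) t * (\<integral>\<^sup>+h. ennreal (modulus g h) \<partial>heat t) = ennreal 2 * (pw (-1 - \<sigma>) t * ennreal (psi g t))"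
        using g by (cases "0 < t")
          (simp_all add: pw_def nn_integral_modulus_heat ennreal_mult psi_nonneg mult.left_commute)
    qed
    also have "\<dots> = ennreal 2 * (\<integral>\<^sup>+t. pw (-1 - \<sigma>) t * ennreal (psi g t) \<partial>lborel)"
      using g by (intro nn_integral_cmult) auto
    finally have "ennreal (1 / 2) * (ennreal C * gag \<sigma> g) = ennreal (1 / 2) * (ennreal 2 * (\<integral>\<^sup>+t. pw (-1 - \<sigma>) t * ennreal (psi g t) \<partial>lborel))"
      by (simp only:)
    moreover have "ennreal (1 / 2) * (ennreal C * gag \<sigma> g) = ennreal (C / 2) * gag \<sigma> g"
    proof -
      have "ennreal (C / 2) = ennreal (1 / 2) * ennreal C"
        using C(1) by (subst ennreal_mult[symmetric]) auto
      then show ?thesis by (simp only: mult.assoc)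
    qed
    moreover have "ennreal (1 / 2) * (ennreal 2 * X) = X" for X
    proof -
      have "ennreal (1 / 2) * ennreal 2 = 1"
        by (subst ennreal_mult[symmetric]) auto
      then show ?thesis by (simp only: mult.assoc[symmetric] mult_1_left)
    qed
    ultimately show ?thesis by (simp only:)
  qed
  with C(1) show ?thesis by (intro that[of "C / 2"]) auto
qed

lemma gag_finite_iff:
  assumes "0 < \<sigma>" "g \<in> L2"
  shows "gag \<sigma> g < \<infinity> \<longleftrightarrow> (\<integral>\<^sup>+t. pw (-1 - \<sigma>) t * ennreal (psi g t) \<partial>lborel) < \<infinity>"
proof -
  obtain C where C: "0 < C" "ennreal C * gag \<sigma> g = (\<integral>\<^sup>+t. pw (-1 - \<sigma>) t * ennreal (psi g t) \<partial>lborel)"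
    using gag_mixture[OF assms(1), where 'a='a] assms(2) by blast
  show ?thesis
    unfolding C(2)[symmetric] using C(1) by (auto simp: ennreal_mult_less_top)
qed

lemma gag_sd_measurable:
  assumes "g \<in> L2"
  shows "(\<lambda>h. gag \<sigma> (sd h g)) \<in> borel_measurable borel"
proof -
  note [measurable] = modulus_sd_measurable[OF assms]
  have "(\<lambda>(h, k). ennreal (kern \<sigma> k) * ennreal (modulus (sd h g) k)) \<in> borel_measurable (borel \<Otimes>\<^sub>M borel)"
    using modulus_sd_measurable[OF assms] by (simp add: split_beta')
  then show ?thesis unfolding gag_def by measurable
qed

text \<open>The double integral is restricted to \<open>t \<le> r \<le> 2 t\<close>, where \<^term>\<open>psi2 g t t \<le> psi2 g t r\<close>.\<close>

lemma diagonal_estimate: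
  assumes s: "0 < s" and g: "g \<in> L2"
    and fin: "(\<integral>\<^sup>+h. ennreal (kern s h) * gag s (sd h g) \<partial>lborel) < \<infinity>"
  shows "(\<integral>\<^sup>+t. pw (-1 - 2 * s) t * ennreal (psi2 g t t) \<partial>lborel) < \<infinity>"
proof -
  note [measurable] = gag_sd_measurable[OF g] psi_measurable[OF g]
  obtain C where C: "0 < C" "\<And>f :: 'a::euclidean_space \<Rightarrow> ennreal. f \<in> borel_measurable borel \<Longrightarrow>
    ennreal C * (\<integral>\<^sup>+h. ennreal (kern s h) * f h \<partial>lborel) = (\<integral>\<^sup>+t. pw (-1 - s) t * (\<integral>\<^sup>+h. f h \<partial>heat t) \<partial>lborel)"
    using nn_integral_kern_mixture[OF s] by blast
  obtain C' where C': "0 < C'" "\<And>g :: 'a::euclidean_space \<Rightarrow> real. g \<in> L2 \<Longrightarrow>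
    ennreal C' * gag s g = (\<integral>\<^sup>+t. pw (-1 - s) t * ennreal (psi g t) \<partial>lborel)"
    using gag_mixture[OF s] by blast
  \<comment> \<open>The seminorm of the difference is written as a mixture over r; averaging over h
    under \<open>heat t\<close>, \<open>psi_sd\<close> then produces
    \<open>psi2 g t r\<close>.\<close>
  have *: "(\<integral>\<^sup>+h. ennreal C' * gag s (sd h g) \<partial>heat t) = (\<integral>\<^sup>+r. pw (-1 - s) r * ennreal (2 * psi2 g t r) \<partial>lborel)"
    if t: "0 < t" for t
  proof -
    interpret T: prob_space "heat t :: 'a measure" using t by (rule prob_space_heat)
    interpret P: pair_sigma_finite lborel "heat t :: 'a measure" ..
    have [measurable]: "(\<lambda>(r, h). psi (sd h g) r) \<in> borel_measurable (borel \<Otimes>\<^sub>M borel)"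
      using measurable_compose[of "\<lambda>q. (snd q, fst q)" "borel \<Otimes>\<^sub>M borel" "borel \<Otimes>\<^sub>M borel", OF _ psi_sd_measurable[OF g]]
      by (simp add: split_beta')
    have "(\<integral>\<^sup>+h. ennreal C' * gag s (sd h g) \<partial>heat t) = (\<integral>\<^sup>+h. (\<integral>\<^sup>+r. pw (-1 - s) r * ennreal (psi (sd h g) r) \<partial>lborel) \<partial>heat t)"
      by (simp add: C'(2) sd_L2 g)
    also have "\<dots> = (\<integral>\<^sup>+r. (\<integral>\<^sup>+h. pw (-1 - s) r * ennreal (psi (sd h g) r) \<partial>heat t) \<partial>lborel)"
      by (rule P.Fubini') measurable
    also have "\<dots> = (\<integral>\<^sup>+r. pw (-1 - s) r * ennreal (2 * psi2 g t r) \<partial>lborel)"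
    proof (rule nn_integral_cong)
      fix r
      show "(\<integral>\<^sup>+h. pw (-1 - s) r * ennreal (psi (sd h g) r) \<partial>heat t) = pw (-1 - s) r * ennreal (2 * psi2 g t r)"
      proof (cases "0 < r")
        case True
        have "(\<integral>\<^sup>+h. ennreal (psi (sd h g) r) \<partial>heat t) = ennreal (2 * psi2 g t r)"
          using True t g
          by (subst nn_integral_eq_integral) (auto simp: integrable_heat_psi_sd psi_nonneg psi_sd)
        then show ?thesis by (subst nn_integral_cmult) auto
      qed (simp add: pw_def)
    qed
    finally show ?thesis .
  qed
  have "(\<integral>\<^sup>+t. pw (-1 - s) t * (\<integral>\<^sup>+r. pw (-1 - s) r * ennreal (2 * psi2 g t r) \<partial>lborel) \<partial>lborel)
    = (\<integral>\<^sup>+t. pw (-1 - s) t * (\<integral>\<^sup>+h. ennreal C' * gag s (sd h g) \<partial>heat t) \<partial>lborel)"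
    by (intro nn_integral_cong) (auto simp: * pw_def)
  also have "\<dots> = ennreal C * (\<integral>\<^sup>+h. ennreal (kern s h) * (ennreal C' * gag s (sd h g)) \<partial>lborel)"
    by (rule C(2)[symmetric]) measurable
  also have "\<dots> = ennreal C * (ennreal C' * (\<integral>\<^sup>+h. ennreal (kern s h) * gag s (sd h g) \<partial>lborel))"
    by (subst nn_integral_cmult[symmetric]) (auto simp: mult.left_commute)
  also have "\<dots> < \<infinity>"
    using fin by (simp add: ennreal_mult_less_top)
  finally have A: "(\<integral>\<^sup>+t. pw (-1 - s) t * (\<integral>\<^sup>+r. pw (-1 - s) r * ennreal (2 * psi2 g t r) \<partial>lborel) \<partial>lborel) < \<infinity>" .
  \<comment> \<open>On t \<le> r \<le> 2t the weight r^(-1-s) is at least c t^(-1-s), and the length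
    t of that interval turns t^(-1-s) t^(-1-s) into t^(-1-2s).\<close>
  define c where "c = 2 powr (-1 - s)"
  have low: "ennreal c * (pw (-1 - 2 * s) t * ennreal (psi2 g t t))
      \<le> pw (-1 - s) t * (\<integral>\<^sup>+r. pw (-1 - s) r * ennreal (2 * psi2 g t r) \<partial>lborel)" for t
  proof (cases "0 < t")
    case t: True
    have "ennreal ((2 * t) powr (-1 - s) * psi2 g t t) * ennreal t
       = (\<integral>\<^sup>+r. ennreal ((2 * t) powr (-1 - s) * psi2 g t t) * indicator {t..2 * t} r \<partial>lborel)"
      using t by (subst nn_integral_cmult_indicator) auto
    also have "\<dots> \<le> (\<integral>\<^sup>+r. pw (-1 - s) r * ennreal (2 * psi2 g t r) \<partial>lborel)"
    proof (rule nn_integral_mono)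
      fix r
      show "ennreal ((2 * t) powr (-1 - s) * psi2 g t t) * indicator {t..2 * t} r
        \<le> pw (-1 - s) r * ennreal (2 * psi2 g t r)"
      proof (cases "r \<in> {t..2 * t}")
        case True
        have nn: "0 \<le> psi2 g t r" using t True g by (intro psi2_nonneg) auto
        have "(2 * t) powr (-1 - s) * psi2 g t t \<le> r powr (-1 - s) * (2 * psi2 g t r)"
        proof (rule mult_mono)
          show "(2 * t) powr (-1 - s) \<le> r powr (-1 - s)"
            using True t s by (intro powr_mono2') auto
          have "psi2 g t t \<le> psi2 g t r"
            using True t g by (intro psi2_mono) auto
          then show "psi2 g t t \<le> 2 * psi2 g t r" using nn by linarith
        qed (use t g in \<open>auto intro: psi2_nonneg\<close>)
        then show ?thesis
          using True t nn by (simp add: pw_def ennreal_mult[symmetric] ennreal_leI)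
      qed simp
    qed
    finally have 1: "ennreal ((2 * t) powr (-1 - s) * psi2 g t t) * ennreal t
      \<le> (\<integral>\<^sup>+r. pw (-1 - s) r * ennreal (2 * psi2 g t r) \<partial>lborel)" .
    have "c * (t powr (-1 - 2 * s) * psi2 g t t) = t powr (-1 - s) * ((2 * t) powr (-1 - s) * psi2 g t t * t)"
    proof -
      have "t powr (-1 - 2 * s) = t powr (-1 - s) * t powr (-1 - s) * t powr 1"
        by (simp only: powr_add[symmetric]) (simp add: algebra_simps)
      then show ?thesis using t by (simp add: c_def powr_mult)
    qed
    then have "ennreal c * (pw (-1 - 2 * s) t * ennreal (psi2 g t t))
      = pw (-1 - s) t * (ennreal ((2 * t) powr (-1 - s) * psi2 g t t) * ennreal t)"
      using t g psi2_nonneg[OF t t g] by (simp add: pw_def c_def ennreal_mult[symmetric])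
    also have "\<dots> \<le> pw (-1 - s) t * (\<integral>\<^sup>+r. pw (-1 - s) r * ennreal (2 * psi2 g t r) \<partial>lborel)"
      by (rule mult_left_mono[OF 1]) simp
    finally show ?thesis .
  qed (simp add: pw_def)
  have [measurable]: "(\<lambda>t. psi2 g t t) \<in> borel_measurable borel"
    unfolding psi2_def by measurable
  have "ennreal c * (\<integral>\<^sup>+t. pw (-1 - 2 * s) t * ennreal (psi2 g t t) \<partial>lborel)
     = (\<integral>\<^sup>+t. ennreal c * (pw (-1 - 2 * s) t * ennreal (psi2 g t t)) \<partial>lborel)"
    by (rule nn_integral_cmult[symmetric]) measurable
  also have "\<dots> \<le> (\<integral>\<^sup>+t. pw (-1 - s) t * (\<integral>\<^sup>+r. pw (-1 - s) r * ennreal (2 * psi2 g t r) \<partial>lborel) \<partial>lborel)"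
    by (rule nn_integral_mono[OF low])
  also have "\<dots> < \<infinity>" by (rule A)
  finally show ?thesis
    by (auto simp: ennreal_mult_less_top c_def)
qed

section \<open>Consequences of the diagonal estimate\<close>

lemma psi2_diag_measurable [measurable]:
  assumes "g \<in> L2"
  shows "(\<lambda>t. psi2 g t t) \<in> borel_measurable borel"
proof -
  note [measurable] = psi_measurable[OF assms]
  show ?thesis unfolding psi2_def by measurable
qed

lemma suminf_geometric_finite:
  assumes "0 \<le> r" "r < 1" "B < \<infinity>"
  shows "(\<Sum>j::nat. ennreal (r ^ j) * B) < \<infinity>"
proof -
  have "(\<Sum>j::nat. ennreal (r ^ j)) = ennreal (\<Sum>j. r ^ j)"
    using assms by (intro suminf_ennreal2 summable_geometric) auto
  then show ?thesis
    using assms(3) by (simp add: ennreal_suminf_multc ennreal_mult_less_top)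
qed

text \<open>Iterate psi(t) = psi(2t)/2 + D(t,t)/2 towards large scales. The remainder 2^(-J) psi(2^J
  t) is at most 2^(-J) times the squared norm of g and vanishes in the limit; the e of the proof
  absorbs it.\<close>

lemma psi_le_dyadic_sum:
  assumes t: "0 < t" and g: "g \<in> L2"
  shows "ennreal (psi g t) \<le> (\<Sum>j. ennreal ((1/2) ^ Suc j) * ennreal (psi2 g (2 ^ j * t) (2 ^ j * t)))"
    (is "_ \<le> ?S")
proof (rule ennreal_le_epsilon)
  fix e :: real assume e: "0 < e"
  define D where "D j = psi2 g (2 ^ j * t) (2 ^ j * t)" for j :: nat
  have nn: "0 \<le> D j" for j
    unfolding D_def using t g by (intro psi2_nonneg) auto
  have eq: "psi g t = (1/2) ^ J * psi g (2 ^ J * t) + (\<Sum>j<J. (1/2) ^ Suc j * D j)" for J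
  proof (induction J)
    case (Suc J)
    have "2 ^ J * t + 2 ^ J * t = 2 ^ Suc J * t" by simp
    then have "psi g (2 ^ J * t) = psi g (2 ^ Suc J * t) / 2 + D J / 2"
      unfolding D_def psi2_def by (simp only:) (simp add: field_simps)
    then have "(1/2) ^ J * psi g (2 ^ J * t) = (1/2) ^ Suc J * psi g (2 ^ Suc J * t) + (1/2) ^ Suc J * D J"
      by (simp only: distrib_left power_Suc)
    with Suc.IH show ?case by (simp only: sum.lessThan_Suc)
  qed simp
  have "(\<lambda>J. (1/2) ^ J * sqnorm g) \<longlonglongrightarrow> 0 * sqnorm g"
    by (intro tendsto_intros LIMSEQ_power_zero) auto
  then have "\<forall>\<^sub>F J in sequentially. (1/2) ^ J * sqnorm g < e"
    using e by (intro order_tendstoD(2)) auto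
  then obtain J where J: "(1/2) ^ J * sqnorm g < e"
    by (auto simp: eventually_sequentially)
  have "(1/2) ^ J * psi g (2 ^ J * t) \<le> (1/2) ^ J * sqnorm g"
    using t g by (intro mult_left_mono psi_le) auto
  with J have "(1/2) ^ J * psi g (2 ^ J * t) \<le> e" by linarith
  then have "ennreal (psi g t) \<le> ennreal (e + (\<Sum>j<J. (1/2) ^ Suc j * D j))"
    using eq[of J] by (intro ennreal_leI) linarith
  also have "\<dots> = ennreal e + (\<Sum>j<J. ennreal ((1/2) ^ Suc j * D j))"
    using e nn by (subst ennreal_plus) (auto simp: sum_nonneg sum_ennreal)
  also have "\<dots> = ennreal e + (\<Sum>j<J. ennreal ((1/2) ^ Suc j) * ennreal (D j))"
    using nn by (subst ennreal_mult) auto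
  also have "\<dots> \<le> ennreal e + ?S"
    unfolding D_def by (intro add_left_mono sum_le_suminf) auto
  finally show "ennreal (psi g t) \<le> ?S + ennreal e" by (simp only: add.commute)
qed

text \<open>Against t^(-1-2s) the j-th dyadic term scales by 2^(2sj) and carries the weight 2^(-j):
  the series is geometric with ratio 2^(2s-1), which is where 2s < 1 enters.\<close>

lemma low_order_estimate:
  assumes s: "0 < s" "2 * s < 1" and g: "g \<in> L2"
    and fin: "(\<integral>\<^sup>+t. pw (-1 - 2 * s) t * ennreal (psi2 g t t) \<partial>lborel) < \<infinity>" (is "?B < _")
  shows "(\<integral>\<^sup>+t. pw (-1 - 2 * s) t * ennreal (psi g t) \<partial>lborel) < \<infinity>"
proof -
  note [measurable] = psi2_diag_measurable[OF g]
  let ?a = "-1 - 2 * s"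
  have "(\<integral>\<^sup>+t. pw ?a t * ennreal (psi g t) \<partial>lborel)
     \<le> (\<integral>\<^sup>+t. (\<Sum>j. ennreal ((1/2) ^ Suc j) * (pw ?a t * ennreal (psi2 g (2 ^ j * t) (2 ^ j * t)))) \<partial>lborel)"
  proof (rule nn_integral_mono)
    fix t
    show "pw ?a t * ennreal (psi g t)
      \<le> (\<Sum>j. ennreal ((1/2) ^ Suc j) * (pw ?a t * ennreal (psi2 g (2 ^ j * t) (2 ^ j * t))))"
    proof (cases "0 < t")
      case True
      have "pw ?a t * ennreal (psi g t) \<le> pw ?a t * (\<Sum>j. ennreal ((1/2) ^ Suc j) * ennreal (psi2 g (2 ^ j * t) (2 ^ j * t)))"
        by (rule mult_left_mono[OF psi_le_dyadic_sum[OF True g]]) simp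
      then show ?thesis by (simp only: ennreal_suminf_cmult[symmetric] mult.left_commute)
    qed (simp add: pw_def)
  qed
  also have "\<dots> = (\<Sum>j. \<integral>\<^sup>+t. ennreal ((1/2) ^ Suc j) * (pw ?a t * ennreal (psi2 g (2 ^ j * t) (2 ^ j * t))) \<partial>lborel)"
    by (rule nn_integral_suminf) measurable
  also have "\<dots> = (\<Sum>j. ennreal ((2 powr (2 * s - 1)) ^ j) * (ennreal (1/2) * ?B))"
  proof (intro suminf_cong)
    fix j :: nat
    have "(\<integral>\<^sup>+t. ennreal ((1/2) ^ Suc j) * (pw ?a t * ennreal (psi2 g (2 ^ j * t) (2 ^ j * t))) \<partial>lborel)
        = ennreal ((1/2) ^ Suc j) * (\<integral>\<^sup>+t. pw ?a t * ennreal (psi2 g (2 ^ j * t) (2 ^ j * t)) \<partial>lborel)"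
      by (rule nn_integral_cmult) measurable
    also have "\<dots> = ennreal ((1/2) ^ Suc j) * (ennreal ((2 ^ j) powr (-1 - ?a)) * ?B)"
      by (subst pw_scale[where f = "\<lambda>t. ennreal (psi2 g t t)"]) auto
    finally have 1: "(\<integral>\<^sup>+t. ennreal ((1/2) ^ Suc j) * (pw ?a t * ennreal (psi2 g (2 ^ j * t) (2 ^ j * t))) \<partial>lborel)
      = ennreal ((1/2) ^ Suc j) * (ennreal ((2 ^ j) powr (-1 - ?a)) * ?B)" .
    have 2: "(2 ^ j) powr (-1 - ?a) = (2 powr (2 * s)) ^ j"
      by (simp add: powr_realpow[symmetric] powr_powr mult.commute)
    have "(1/2) ^ Suc j * (2 powr (2 * s)) ^ j = (2 powr (2 * s - 1)) ^ j * (1/2)"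
      by (simp add: powr_diff power_divide)
    then have "ennreal ((1/2) ^ Suc j) * ennreal ((2 powr (2 * s)) ^ j) = ennreal ((2 powr (2 * s - 1)) ^ j) * ennreal (1/2)"
      by (subst (1 2) ennreal_mult[symmetric]) auto
    then show "(\<integral>\<^sup>+t. ennreal ((1/2) ^ Suc j) * (pw ?a t * ennreal (psi2 g (2 ^ j * t) (2 ^ j * t))) \<partial>lborel)
      = ennreal ((2 powr (2 * s - 1)) ^ j) * (ennreal (1/2) * ?B)"
      unfolding 1 2 by (simp only: mult.assoc[symmetric])
  qed
  also have "\<dots> < \<infinity>"
  proof (rule suminf_geometric_finite)
    have "2 powr (2 * s - 1) < 2 powr (0::real)" using s by (intro powr_less_mono) auto
    then show "2 powr (2 * s - 1) < (1::real)" by simp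
    show "ennreal (1/2) * ?B < \<infinity>" using fin by (simp add: ennreal_mult_less_top del: ennreal_half)
  qed simp
  finally show ?thesis .
qed

text \<open>Spectrally, the sum of min(r\<lambda>, 1)^2 / r over r = t, t/2, t/4, ... is comparable
  to \<lambda> min(t\<lambda>, 1). So \<open>dyad g t\<close> plays the role of \<open>psi\<close>
  of the gradient of g at scale t, before a gradient is available.\<close>

definition dyad :: "('a::euclidean_space \<Rightarrow> real) \<Rightarrow> real \<Rightarrow> ennreal" where
  "dyad g t = (\<Sum>i. ennreal (psi2 g ((1/2) ^ i * t) ((1/2) ^ i * t) / ((1/2) ^ i * t)))"

lemma dyad_partial:
  assumes "0 < t" "g \<in> L2" "dyad g t < \<infinity>"
  shows "(\<Sum>i<n. psi2 g ((1/2) ^ i * t) ((1/2) ^ i * t) / ((1/2) ^ i * t)) \<le> enn2real (dyad g t)"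
proof -
  define D where "D i = psi2 g ((1/2) ^ i * t) ((1/2) ^ i * t) / ((1/2) ^ i * t)" for i :: nat
  have nn: "0 \<le> D i" for i :: nat
    unfolding D_def using assms by (intro divide_nonneg_pos psi2_nonneg) auto
  have "ennreal (\<Sum>i<n. D i) = (\<Sum>i<n. ennreal (D i))"
    using nn by simp
  also have "\<dots> \<le> dyad g t"
    unfolding dyad_def D_def[symmetric] by (intro sum_le_suminf) auto
  finally have "enn2real (ennreal (\<Sum>i<n. D i)) \<le> enn2real (dyad g t)"
    using assms(3) by (intro enn2real_mono) auto
  then show ?thesis unfolding D_def[symmetric] by (simp add: sum_nonneg nn)
qed

lemma dyadic_scale:
  fixes t t0 :: real
  assumes "0 < t" "t \<le> t0"
  obtains J :: nat where "(1/2) ^ Suc J * t0 < t" "t \<le> (1/2) ^ J * t0"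
proof -
  have t0: "0 < t0" using assms by simp
  obtain n :: nat where "(1/2) ^ n < t / t0"
    using real_arch_pow_inv[of "t / t0" "1/2"] assms t0 by auto
  then have ex: "\<exists>J::nat. (1/2) ^ J * t0 < t"
    using t0 by (intro exI[of _ n]) (simp add: pos_less_divide_eq)
  define K where "K = (LEAST J::nat. (1/2) ^ J * t0 < t)"
  have K: "(1/2) ^ K * t0 < t" unfolding K_def by (rule LeastI_ex[OF ex])
  then have "K \<noteq> 0" using assms by (cases K) auto
  then obtain J where J: "K = Suc J" by (cases K) auto
  have "\<not> (1/2) ^ J * t0 < t"
    using not_less_Least[of J "\<lambda>J. (1/2) ^ J * t0 < t"] J unfolding K_def by auto
  then show ?thesis using K J by (intro that[of J]) auto
qed

text \<open>Halving r raises psi(r)/r by exactly half of the diagonal quotient at the new scale, so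
  along t0, t0/2, t0/4, ... it stays below its first value plus \<open>dyad g t0\<close>.
  Monotonicity of \<open>psi\<close> fills in the scales between.\<close>

lemma psi_linear_bound:
  assumes t0: "0 < t0" and g: "g \<in> L2" and fin: "dyad g t0 < \<infinity>"
  obtains M where "\<And>t. 0 < t \<Longrightarrow> psi g t \<le> M * t"
proof -
  define D where "D i = psi2 g ((1/2) ^ i * t0) ((1/2) ^ i * t0) / ((1/2) ^ i * t0)" for i :: nat
  define q where "q i = psi g ((1/2) ^ i * t0) / ((1/2) ^ i * t0)" for i :: nat
  have Dn: "0 \<le> D i" for i
    unfolding D_def using t0 g by (intro divide_nonneg_pos psi2_nonneg) auto
  have step: "q (Suc i) = q i + D (Suc i) / 2" for i
  proof -
    define r where "r = (1/2) ^ Suc i * t0"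
    have r: "0 < r" "(1/2) ^ i * t0 = 2 * r" using t0 by (auto simp: r_def)
    have "psi g (2 * r) = 2 * psi g r - psi2 g r r" unfolding psi2_def mult_2[symmetric] by simp
    then show ?thesis
      unfolding q_def D_def r_def[symmetric] r(2) using r(1) by (simp add: field_simps)
  qed
  have q: "q J \<le> q 0 + (\<Sum>i<Suc J. D i)" for J
  proof (induction J)
    case (Suc J)
    then show ?case using Dn[of "Suc J"] step[of J] sum.lessThan_Suc[of D "Suc J"] by linarith
  qed (simp add: Dn)
  define M where "M = q 0 + enn2real (dyad g t0)"
  have M: "psi g ((1/2) ^ J * t0) \<le> M * ((1/2) ^ J * t0)" for J
  proof -
    have "q J \<le> M"
      using q[of J] dyad_partial[OF t0 g fin, of "Suc J"] unfolding M_def D_def by linarith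
    then show ?thesis using t0 by (simp add: q_def pos_divide_le_eq)
  qed
  have M0: "0 \<le> M" using t0 by (simp add: M_def q_def psi_nonneg)
  show ?thesis
  \<comment> \<open>The factor 2 pays for rounding t up to a dyadic scale; the second summand covers
    t > t0, where \<open>psi g t\<close> is at most \<open>sqnorm g\<close>.\<close>
  proof (rule that[of "2 * M + sqnorm g / t0"])
    fix t :: real assume t: "0 < t"
    have sq: "0 \<le> sqnorm g / t0 * t" using t t0 by (simp add: sqnorm_nonneg)
    show "psi g t \<le> (2 * M + sqnorm g / t0) * t"
    proof (cases "t \<le> t0")
      case True
      from dyadic_scale[OF t this] obtain J where J: "(1/2) ^ Suc J * t0 < t" "t \<le> (1/2) ^ J * t0" .
      have "psi g t \<le> psi g ((1/2) ^ J * t0)" by (rule psi_mono[OF t J(2) g])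
      also have "\<dots> \<le> M * ((1/2) ^ J * t0)" by (rule M)
      also have "\<dots> \<le> M * (2 * t)" using J(1) M0 by (intro mult_left_mono) auto
      finally show ?thesis using sq by (simp add: algebra_simps)
    next
      case False
      have "psi g t \<le> sqnorm g" by (rule psi_le[OF t g])
      also have "\<dots> = sqnorm g / t0 * t0" using t0 by simp
      also have "\<dots> \<le> sqnorm g / t0 * t"
        using False t0 sqnorm_nonneg[of g] by (intro mult_left_mono) auto
      finally show ?thesis using M0 t mult_nonneg_nonneg[of "2 * M" t] unfolding distrib_right by linarith
    qed
  qed
qed

text \<open>The same descent as for \<open>psi\<close>, now with \<open>psi2_double\<close> as its
  step: on the way from t down to r, \<open>psi2 g r t / r\<close> collects at most the terms of
  \<open>dyad g t\<close>. The factor 2 again rounds r to a dyadic scale.\<close>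

lemma psi2_linear_bound:
  assumes t: "0 < t" and r: "0 < r" "r \<le> t" and g: "g \<in> L2" and fin: "dyad g t < \<infinity>"
  shows "psi2 g r t \<le> 2 * r * enn2real (dyad g t)"
proof -
  define D where "D i = psi2 g ((1/2) ^ i * t) ((1/2) ^ i * t) / ((1/2) ^ i * t)" for i :: nat
  have *: "psi2 g ((1/2) ^ J * t) t / ((1/2) ^ J * t) \<le> (\<Sum>i<Suc J. D i)" for J
  proof (induction J)
    case 0
    then show ?case by (simp add: D_def)
  next
    case (Suc J)
    define r where "r = (1/2) ^ Suc J * t"
    have r: "0 < r" "(1/2) ^ J * t = 2 * r" using t by (auto simp: r_def)
    have "psi2 g r t / r \<le> psi2 g (2 * r) t / (2 * r) + psi2 g r r / r"
      using psi2_double[OF t r(1) g] r(1) by (simp add: field_simps)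
    then show ?case
      using Suc.IH unfolding r(2) sum.lessThan_Suc[of _ "Suc J"] D_def[of "Suc J"] r_def[symmetric] by linarith
  qed
  from dyadic_scale[OF r] obtain J where J: "(1/2) ^ Suc J * t < r" "r \<le> (1/2) ^ J * t" .
  have e0: "0 \<le> enn2real (dyad g t)" by simp
  have "psi2 g r t \<le> psi2 g ((1/2) ^ J * t) t"
    using r t g J by (intro psi2_mono) auto
  also have "\<dots> \<le> enn2real (dyad g t) * ((1/2) ^ J * t)"
  proof -
    have "psi2 g ((1/2) ^ J * t) t / ((1/2) ^ J * t) \<le> enn2real (dyad g t)"
      using *[of J] dyad_partial[OF t g fin, of "Suc J"] unfolding D_def by linarith
    then show ?thesis using t by (simp add: pos_divide_le_eq)
  qed
  also have "\<dots> \<le> enn2real (dyad g t) * (2 * r)"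
    using J(1) e0 by (intro mult_left_mono) auto
  finally show ?thesis by (simp only: mult.commute)
qed

lemma dyad_measurable [measurable]:
  assumes "g \<in> L2"
  shows "dyad g \<in> borel_measurable borel"
proof -
  have [measurable]: "(\<lambda>t. psi2 g (c * t) (c * t)) \<in> borel_measurable borel" for c
    using measurable_compose[of "\<lambda>t. c * t" borel borel, OF _ psi2_diag_measurable[OF assms]] by simp
  show ?thesis unfolding dyad_def[abs_def] by measurable
qed

text \<open>Scaling the j-th term gives 2^j 2^(-2sj), a geometric series of ratio 2^(1-2s). The
  weight t^(-2s) is t^(-1-\<sigma>) with \<sigma> = 2s - 1, so this is the seminorm of order
  \<sigma> of the gradient that \<open>dyad\<close> stands for.\<close>

lemma high_order_estimate:
  assumes s: "1 < 2 * s" and g: "g \<in> L2"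
    and fin: "(\<integral>\<^sup>+t. pw (-1 - 2 * s) t * ennreal (psi2 g t t) \<partial>lborel) < \<infinity>" (is "?B < _")
  shows "(\<integral>\<^sup>+t. pw (- 2 * s) t * dyad g t \<partial>lborel) < \<infinity>"
proof -
  let ?a = "-1 - 2 * s"
  have [measurable]: "(\<lambda>t. psi2 g (c * t) (c * t)) \<in> borel_measurable borel" for c
    using measurable_compose[of "\<lambda>t. c * t" borel borel, OF _ psi2_diag_measurable[OF g]] by simp
  have "(\<integral>\<^sup>+t. pw (- 2 * s) t * dyad g t \<partial>lborel)
     = (\<integral>\<^sup>+t. (\<Sum>j. ennreal (2 ^ j) * (pw ?a t * ennreal (psi2 g ((1/2) ^ j * t) ((1/2) ^ j * t)))) \<partial>lborel)"
  proof (rule nn_integral_cong)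
    fix t
    show "pw (- 2 * s) t * dyad g t
      = (\<Sum>j. ennreal (2 ^ j) * (pw ?a t * ennreal (psi2 g ((1/2) ^ j * t) ((1/2) ^ j * t))))"
    proof (cases "0 < t")
      case t: True
      have "pw (- 2 * s) t * ennreal (psi2 g ((1/2) ^ j * t) ((1/2) ^ j * t) / ((1/2) ^ j * t))
         = ennreal (2 ^ j) * (pw ?a t * ennreal (psi2 g ((1/2) ^ j * t) ((1/2) ^ j * t)))" for j
      proof -
        define X where "X = psi2 g ((1/2) ^ j * t) ((1/2) ^ j * t)"
        have n: "0 \<le> X" unfolding X_def using t g by (intro psi2_nonneg) auto
        have "t powr ?a = t powr (- 2 * s) / t" using t by (simp add: powr_diff powr_minus divide_inverse mult.commute)
        then have e: "t powr (- 2 * s) * (X / ((1/2) ^ j * t)) = 2 ^ j * (t powr ?a * X)"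
          using t by (simp add: power_divide)
        have "pw (- 2 * s) t * ennreal (X / ((1/2) ^ j * t)) = ennreal (t powr (- 2 * s) * (X / ((1/2) ^ j * t)))"
          using n t by (simp add: pw_def ennreal_mult[symmetric])
        also have "\<dots> = ennreal (2 ^ j) * (pw ?a t * ennreal X)"
          unfolding e using n t by (simp add: pw_def ennreal_mult)
        finally show ?thesis unfolding X_def .
      qed
      then show ?thesis
        unfolding dyad_def ennreal_suminf_cmult[symmetric] by (simp only:)
    qed (simp add: pw_def)
  qed
  also have "\<dots> = (\<Sum>j. \<integral>\<^sup>+t. ennreal (2 ^ j) * (pw ?a t * ennreal (psi2 g ((1/2) ^ j * t) ((1/2) ^ j * t))) \<partial>lborel)"
    by (rule nn_integral_suminf) measurable
  also have "\<dots> = (\<Sum>j. ennreal ((2 powr (1 - 2 * s)) ^ j) * ?B)"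
  proof (intro suminf_cong)
    fix j :: nat
    have "(\<integral>\<^sup>+t. ennreal (2 ^ j) * (pw ?a t * ennreal (psi2 g ((1/2) ^ j * t) ((1/2) ^ j * t))) \<partial>lborel)
      = ennreal (2 ^ j) * (\<integral>\<^sup>+t. pw ?a t * ennreal (psi2 g ((1/2) ^ j * t) ((1/2) ^ j * t)) \<partial>lborel)"
      by (rule nn_integral_cmult) measurable
    also have "\<dots> = ennreal (2 ^ j) * (ennreal (((1/2) ^ j) powr (-1 - ?a)) * ?B)"
      using psi2_diag_measurable[OF g] by (subst pw_scale[where f = "\<lambda>t. ennreal (psi2 g t t)"]) auto
    finally have 1: "(\<integral>\<^sup>+t. ennreal (2 ^ j) * (pw ?a t * ennreal (psi2 g ((1/2) ^ j * t) ((1/2) ^ j * t))) \<partial>lborel)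
      = ennreal (2 ^ j) * (ennreal (((1/2) ^ j) powr (-1 - ?a)) * ?B)" .
    have "((1/2::real) ^ j) powr (2 * s) = ((1/2) powr (2 * s)) ^ j"
      by (induction j) (simp_all only: power.simps powr_mult powr_one_eq_one)
    then have 2: "((1/2) ^ j) powr (-1 - ?a) = ((1/2::real) powr (2 * s)) ^ j"
      by simp
    have 3: "(1/2::real) powr (2 * s) = 2 powr (- (2 * s))"
      by (simp only: powr_divide powr_one_eq_one powr_minus_divide)
    have "2 * 2 powr (- (2 * s)) = 2 powr (1 - 2 * s)"
      using powr_add[of 2 1 "- (2 * s)"] by simp
    then have "2 ^ j * (2 powr (- (2 * s))) ^ j = (2 powr (1 - 2 * s)) ^ j"
      by (simp only: power_mult_distrib[symmetric])
    then have "ennreal (2 ^ j) * ennreal ((2 powr (- (2 * s))) ^ j) = ennreal ((2 powr (1 - 2 * s)) ^ j)"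
      by (subst ennreal_mult[symmetric]) auto
    then show "(\<integral>\<^sup>+t. ennreal (2 ^ j) * (pw ?a t * ennreal (psi2 g ((1/2) ^ j * t) ((1/2) ^ j * t))) \<partial>lborel)
      = ennreal ((2 powr (1 - 2 * s)) ^ j) * ?B"
      unfolding 1 2 3 by (simp only: mult.assoc[symmetric])
  qed
  also have "\<dots> < \<infinity>"
  proof (rule suminf_geometric_finite)
    have "2 powr (1 - 2 * s) < 2 powr (0::real)" using s by (intro powr_less_mono) auto
    then show "2 powr (1 - 2 * s) < (1::real)" by simp
  qed (use fin in auto)
  finally show ?thesis .
qed

text \<open>At 2s = 1 that geometric ratio is 1, so finiteness is sought at a single scale.
  Integrate \<open>dyad\<close> over [1,2) and undo the dilations: the intervals 2^(-i) [1,2) tile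
  (0,2) without overlap, and the series of integrals becomes one integral dominated by the
  hypothesis.\<close>

lemma critical_order_estimate:
  assumes s: "1 \<le> 2 * s" and g: "g \<in> L2"
    and fin: "(\<integral>\<^sup>+t. pw (-1 - 2 * s) t * ennreal (psi2 g t t) \<partial>lborel) < \<infinity>" (is "?B < _")
  obtains t0 where "0 < t0" "dyad g t0 < \<infinity>"
proof -
  note [measurable] = psi2_diag_measurable[OF g] dyad_measurable[OF g]
  let ?a = "-1 - 2 * s"
  define F where "F r = ennreal (psi2 g r r / r)" for r
  have [measurable]: "F \<in> borel_measurable borel" unfolding F_def by measurable
  \<comment> \<open>On the tile containing r one has 2^i < 2/r and r < 2, so 2^i / r is at most 2
    r^(-2) = 2 r^(2s-1) r^(-1-2s), and r^(2s-1) is at most 2^(2s-1) because 2s \<ge> 1.\<close>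
  define c where "c = 2 * 2 powr (2 * s - 1)"
  have c0: "0 \<le> c" by (simp add: c_def)
  have "(\<integral>\<^sup>+t. indicator {1..<2} t * dyad g t \<partial>lborel) = (\<integral>\<^sup>+t. (\<Sum>i. indicator {1..<2} t * F ((1/2) ^ i * t)) \<partial>lborel)"
    unfolding dyad_def F_def by (simp only: ennreal_suminf_cmult)
  also have "\<dots> = (\<Sum>i. \<integral>\<^sup>+t. indicator {1..<2} t * F ((1/2) ^ i * t) \<partial>lborel)"
    by (rule nn_integral_suminf) measurable
  also have "\<dots> = (\<Sum>i. \<integral>\<^sup>+r. ennreal (2 ^ i) * (indicator {1..<2} (2 ^ i * r) * F r) \<partial>lborel)"
  proof (intro suminf_cong)
    fix i :: nat
    have *: "(1/2) ^ i * (0 + 2 ^ i * r) = r" for r :: real by (simp add: power_divide)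
    have "(\<integral>\<^sup>+t. indicator {1..<2} t * F ((1/2) ^ i * t) \<partial>lborel)
      = ennreal \<bar>2 ^ i\<bar> * (\<integral>\<^sup>+r. indicator {1..<2} (0 + 2 ^ i * r) * F ((1/2) ^ i * (0 + 2 ^ i * r)) \<partial>lborel)"
      by (rule nn_integral_real_affine) auto
    also have "\<dots> = ennreal (2 ^ i) * (\<integral>\<^sup>+r. indicator {1..<2} (2 ^ i * r) * F r \<partial>lborel)"
      unfolding * by simp
    also have "\<dots> = (\<integral>\<^sup>+r. ennreal (2 ^ i) * (indicator {1..<2} (2 ^ i * r) * F r) \<partial>lborel)"
      by (rule nn_integral_cmult[symmetric]) measurable
    finally show "(\<integral>\<^sup>+t. indicator {1..<2} t * F ((1/2) ^ i * t) \<partial>lborel)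
      = (\<integral>\<^sup>+r. ennreal (2 ^ i) * (indicator {1..<2} (2 ^ i * r) * F r) \<partial>lborel)" .
  qed
  also have "\<dots> = (\<integral>\<^sup>+r. (\<Sum>i. ennreal (2 ^ i) * (indicator {1..<2} (2 ^ i * r) * F r)) \<partial>lborel)"
    by (rule nn_integral_suminf[symmetric]) measurable
  also have "\<dots> \<le> (\<integral>\<^sup>+r. ennreal c * (pw ?a r * ennreal (psi2 g r r)) \<partial>lborel)"
  proof (rule nn_integral_mono)
    fix r :: real
    show "(\<Sum>i. ennreal (2 ^ i) * (indicator {1..<2} (2 ^ i * r) * F r)) \<le> ennreal c * (pw ?a r * ennreal (psi2 g r r))"
    proof (cases "\<exists>i::nat. 2 ^ i * r \<in> {1..<2}")
      case True
      then obtain i :: nat where i: "1 \<le> 2 ^ i * r" "2 ^ i * r < 2" by auto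
      have r: "0 < r"
      proof (rule ccontr)
        assume "\<not> 0 < r"
        then have "2 ^ i * r \<le> 0" by (simp add: mult_nonneg_nonpos)
        then show False using i(1) by simp
      qed
      have "1 * r \<le> 2 ^ i * r" using r by (intro mult_right_mono) auto
      then have r2: "r < 2" using i(2) by simp
      \<comment> \<open>The interval is half open: two different dyadic multiples of r differ by a
        factor of at least 2 and cannot both lie in it.\<close>
      have uniq: "j = i" if "2 ^ j * r \<in> {1..<2}" for j :: nat
      proof (rule ccontr)
        have *: False if "a < b" "1 \<le> 2 ^ a * r" "2 ^ b * r < 2" for a b :: nat
        proof -
          have "2 ^ Suc a * r \<le> 2 ^ b * r" using that r by (intro mult_right_mono power_increasing) auto
          then show False using that by simp
        qed
        assume "j \<noteq> i"
        then show False using *[of i j] *[of j i] i that by (auto simp: nat_neq_iff)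
      qed
      have P: "0 \<le> psi2 g r r" by (rule psi2_nonneg[OF r r g])
      have "(\<Sum>j. ennreal (2 ^ j) * (indicator {1..<2} (2 ^ j * r) * F r)) = (\<Sum>j\<in>{i}. ennreal (2 ^ j) * (indicator {1..<2} (2 ^ j * r) * F r))"
        by (rule suminf_finite) (use uniq in \<open>auto simp: indicator_def\<close>)
      also have "\<dots> = ennreal (2 ^ i) * F r" using i by simp
      also have "\<dots> = ennreal (2 ^ i * (psi2 g r r / r))"
        using r P unfolding F_def by (subst ennreal_mult) auto
      also have "\<dots> \<le> ennreal (c * (r powr ?a * psi2 g r r))"
      proof (rule ennreal_leI)
        have "2 ^ i \<le> 2 / r" using i(2) r by (simp add: pos_le_divide_eq)
        then have "2 ^ i / r \<le> 2 / r / r" using r by (intro divide_right_mono) auto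
        also have "2 / r / r \<le> c * r powr ?a"
        proof -
          have "r powr (2 * s - 1) \<le> 2 powr (2 * s - 1)"
            using r r2 s by (intro powr_mono2) auto
          then have "2 * r powr (2 * s - 1) * r powr ?a \<le> c * r powr ?a"
            unfolding c_def by (intro mult_right_mono) auto
          also have "2 * r powr (2 * s - 1) * r powr ?a = 2 * r powr (-2)"
            by (simp add: mult.assoc powr_add[symmetric])
          also have "\<dots> = 2 / r / r" using r by (simp add: powr_minus divide_inverse power2_eq_square)
          finally show ?thesis .
        qed
        finally have "2 ^ i / r * psi2 g r r \<le> c * r powr ?a * psi2 g r r"
          using P by (rule mult_right_mono)
        then show "2 ^ i * (psi2 g r r / r) \<le> c * (r powr ?a * psi2 g r r)" by (simp add: mult.assoc)
      qed
      also have "\<dots> = ennreal c * (pw ?a r * ennreal (psi2 g r r))"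
        using r P c0 by (simp add: pw_def ennreal_mult)
      finally show ?thesis .
    next
      case False
      then have "(\<lambda>i::nat. ennreal (2 ^ i) * (indicator {1..<2} (2 ^ i * r) * F r)) = (\<lambda>_. 0)"
        by (auto simp: fun_eq_iff indicator_def)
      then show ?thesis by simp
    qed
  qed
  also have "\<dots> = ennreal c * ?B" by (rule nn_integral_cmult) measurable
  also have "\<dots> < \<infinity>" using fin by (simp add: ennreal_mult_less_top)
  finally have "(\<integral>\<^sup>+t. indicator {1..<2} t * dyad g t \<partial>lborel) \<noteq> \<infinity>" by simp
  then have ae: "AE t in lborel. indicator {1..<2} t * dyad g t \<noteq> \<infinity>"
    by (intro nn_integral_noteq_infinite) auto
  have "\<exists>t>0. dyad g t < \<infinity>"
  proof (rule ccontr)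
    assume "\<not> (\<exists>t>0. dyad g t < \<infinity>)"
    then have *: "dyad g t = \<infinity>" if "0 < t" for t
      using that by (metis less_top infinity_ennreal_def)
    from ae have "AE t in lborel. (t::real) \<notin> {1..<2}"
      by eventually_elim (auto simp: *)
    then have "{1..<2::real} \<in> null_sets lborel"
      by (subst (asm) AE_iff_null_sets[symmetric]) auto
    then show False by (simp add: null_sets_def)
  qed
  then show ?thesis using that by blast
qed

section \<open>From Gaussian averages to pointwise bounds\<close>

text \<open>Average n(h) \<le> 2 n(k) + 2 n(h - k) over k in the ball of radius |h|: both k and h -
  k stay in the ball of radius 2|h|, on which the Gaussian of parameter |h|^2 is at least exp(-4)
  over its normalisation.\<close>

lemma pointwise_from_heat_average:
  obtains C where "0 < C"
    "\<And>(n :: 'a::euclidean_space \<Rightarrow> real) h B. n \<in> borel_measurable borel \<Longrightarrow> (\<And>h. 0 \<le> n h) \<Longrightarrow> (\<And>h. n h \<le> B) \<Longrightarrow>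
      (\<And>h k. n (h + k) \<le> 2 * n h + 2 * n k) \<Longrightarrow> h \<noteq> 0 \<Longrightarrow> n h \<le> C * (\<integral>k. n k \<partial>heat ((norm h)\<^sup>2))"
proof -
  let ?N = "DIM('a)"
  define \<gamma> where "\<gamma> = gauss_mass TYPE('a)"
  have \<gamma>: "0 < \<gamma>" unfolding \<gamma>_def by (rule gauss_mass_pos)
  define \<omega> where "\<omega> = unit_ball_vol (real ?N)"
  have \<omega>: "0 < \<omega>" by (simp add: \<omega>_def)
  \<comment> \<open>The 4 is 2 + 2 from the two terms, \<gamma> exp 4 comes from the lower bound for
    the Gaussian and \<omega> from the volume of the averaging ball; the powers of |h|
    cancel.\<close>
  define C where "C = 4 * \<gamma> * exp 4 / \<omega>"
  have C: "0 < C" using \<omega> \<gamma> by (simp add: C_def)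
  show ?thesis
  proof (rule that[OF C])
    fix n :: "'a \<Rightarrow> real" and h :: 'a and B
    assume [measurable]: "n \<in> borel_measurable borel" and n0: "\<And>h. 0 \<le> n h" and nB: "\<And>h. n h \<le> B"
      and sub: "\<And>h k. n (h + k) \<le> 2 * n h + 2 * n k" and h: "h \<noteq> 0"
    define r where "r = norm h"
    have r: "0 < r" using h by (simp add: r_def)
    define c where "c = \<gamma> * r ^ ?N * exp 4"
    have c: "0 < c" using r \<gamma> by (simp add: c_def)
    define Q where "Q = (\<integral>k. n k \<partial>heat (r\<^sup>2))"
    have Q: "0 \<le> Q" unfolding Q_def using n0 by (intro integral_nonneg_AE) auto
    let ?I = "\<integral>\<^sup>+k. indicator (ball 0 (2 * r)) k * ennreal (n k) \<partial>lborel"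
    have I: "?I \<le> ennreal (c * Q)"
    proof -
      have "?I \<le> (\<integral>\<^sup>+k. ennreal c * (ennreal (gauss (r\<^sup>2) k) * ennreal (n k)) \<partial>lborel)"
      proof (rule nn_integral_mono)
        fix k :: 'a
        have "1 \<le> c * gauss (r\<^sup>2) k" if k: "norm k < 2 * r"
        proof -
          have "(norm k)\<^sup>2 \<le> (2 * r)\<^sup>2" using k by (intro power_mono) auto
          then have "(norm k)\<^sup>2 / r\<^sup>2 \<le> 4" using r by (simp add: divide_le_eq power_mult_distrib)
          then have "exp (-4) \<le> exp (- ((norm k)\<^sup>2 / r\<^sup>2))" by simp
          then have "exp 4 * exp (-4) \<le> exp 4 * exp (- ((norm k)\<^sup>2 / r\<^sup>2))" by (intro mult_left_mono) auto
          then have "1 \<le> exp 4 * exp (- ((norm k)\<^sup>2 / r\<^sup>2))" by (simp add: mult_exp_exp)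
          moreover have "(r\<^sup>2) powr (real ?N / 2) = r ^ ?N"
          proof -
            have "r\<^sup>2 = r powr 2" using r by simp
            then show ?thesis using r by (simp only: powr_powr) (simp add: powr_realpow)
          qed
          ultimately show ?thesis
            using r \<gamma> by (simp add: gauss_def c_def \<gamma>_def[symmetric])
        qed
        then have "n k \<le> c * (gauss (r\<^sup>2) k * n k)" if "norm k < 2 * r"
          using that n0[of k] mult_right_mono[of 1 "c * gauss (r\<^sup>2) k" "n k"] by (simp add: mult.assoc)
        then have "ennreal (n k) \<le> ennreal c * (ennreal (gauss (r\<^sup>2) k) * ennreal (n k))" if "norm k < 2 * r"
          using that n0[of k] c by (simp add: ennreal_mult[symmetric] ennreal_leI)
        then show "indicator (ball 0 (2 * r)) k * ennreal (n k) \<le> ennreal c * (ennreal (gauss (r\<^sup>2) k) * ennreal (n k))"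
          by (cases "norm k < 2 * r") auto
      qed
      also have "\<dots> = ennreal c * (\<integral>\<^sup>+k. ennreal (n k) \<partial>heat (r\<^sup>2))"
        by (subst nn_integral_cmult) (auto simp: nn_integral_heat)
      also have "(\<integral>\<^sup>+k. ennreal (n k) \<partial>heat (r\<^sup>2)) = ennreal Q"
        unfolding Q_def using r n0 nB by (intro nn_integral_eq_integral integrable_heat[where B = B]) auto
      finally show ?thesis using c Q by (simp add: ennreal_mult)
    qed
    have [measurable]: "ball (0::'a) r \<in> sets borel" by simp
    have m1: "(\<lambda>k. indicator (ball 0 r) k * ennreal (n k)) \<in> borel_measurable borel"
      by measurable
    have m2: "(\<lambda>k. indicator (ball 0 r) k * ennreal (n (h - k))) \<in> borel_measurable borel"
      by measurable
    have "ennreal (n h * (\<omega> * r ^ ?N)) = ennreal (n h) * ennreal (\<omega> * r ^ ?N)"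
      using n0[of h] \<omega> r by (intro ennreal_mult) auto
    also have "\<dots> = (\<integral>\<^sup>+k. ennreal (n h) * indicator (ball 0 r) (k::'a) \<partial>lborel)"
      using r by (subst nn_integral_cmult_indicator) (auto simp: emeasure_ball \<omega>_def)
    also have "\<dots> \<le> (\<integral>\<^sup>+k. 2 * (indicator (ball 0 r) k * ennreal (n k)) + 2 * (indicator (ball 0 r) k * ennreal (n (h - k))) \<partial>lborel)"
    proof (rule nn_integral_mono)
      fix k :: 'a
      have "ennreal (n h) \<le> ennreal (2 * n k + 2 * n (h - k))"
        using sub[of k "h - k"] by (intro ennreal_leI) simp
      also have "\<dots> = 2 * ennreal (n k) + 2 * ennreal (n (h - k))"
        using n0 by (simp add: ennreal_plus ennreal_mult)
      finally show "ennreal (n h) * indicator (ball 0 r) k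
        \<le> 2 * (indicator (ball 0 r) k * ennreal (n k)) + 2 * (indicator (ball 0 r) k * ennreal (n (h - k)))"
        by (cases "k \<in> ball 0 r") auto
    qed
    also have "\<dots> = 2 * (\<integral>\<^sup>+k. indicator (ball 0 r) k * ennreal (n k) \<partial>lborel)
        + 2 * (\<integral>\<^sup>+k. indicator (ball 0 r) k * ennreal (n (h - k)) \<partial>lborel)"
      using m1 m2 by (simp add: nn_integral_add nn_integral_cmult)
    also have "\<dots> \<le> 2 * ?I + 2 * ?I"
    proof (intro add_mono mult_left_mono)
      show "(\<integral>\<^sup>+k. indicator (ball 0 r) k * ennreal (n k) \<partial>lborel) \<le> ?I"
        using r by (intro nn_integral_mono) (auto simp: indicator_def)
      have "(\<integral>\<^sup>+k. indicator (ball 0 r) k * ennreal (n (h - k)) \<partial>lborel)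
        = (\<integral>\<^sup>+k. indicator (ball 0 r) (- k) * ennreal (n (h - (- k))) \<partial>lborel)"
        by (rule nn_integral_lborel_uminus[symmetric]) measurable
      also have "\<dots> = (\<integral>\<^sup>+k. indicator (ball 0 r) (- (k + (- h))) * ennreal (n (h - (- (k + (- h))))) \<partial>lborel)"
        by (rule nn_integral_lborel_shift[symmetric]) measurable
      also have "\<dots> \<le> ?I"
      proof (rule nn_integral_mono)
        fix k
        have "norm k < 2 * r" if "norm (h - k) < r"
          using norm_triangle_ineq4[of h "h - k"] that by (simp add: r_def)
        then show "indicator (ball 0 r) (- (k + (- h))) * ennreal (n (h - (- (k + (- h))))) \<le> indicator (ball 0 (2 * r)) k * ennreal (n k)"
          by (cases "norm (h - k) < r") auto
      qed
      finally show "(\<integral>\<^sup>+k. indicator (ball 0 r) k * ennreal (n (h - k)) \<partial>lborel) \<le> ?I" .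
    qed auto
    also have "\<dots> \<le> 2 * ennreal (c * Q) + 2 * ennreal (c * Q)"
      by (intro add_mono mult_left_mono I) auto
    also have "\<dots> = ennreal (4 * (c * Q))"
      using c Q by (subst (1 2) ennreal_numeral[symmetric]) (simp add: ennreal_mult[symmetric] ennreal_plus[symmetric] del: ennreal_plus ennreal_numeral)
    finally have "n h * (\<omega> * r ^ ?N) \<le> 4 * (c * Q)"
      using c Q by (simp add: ennreal_le_iff)
    then have "n h \<le> 4 * (c * Q) / (\<omega> * r ^ ?N)"
      using \<omega> r by (simp add: pos_le_divide_eq)
    also have "\<dots> = C * Q" using r \<omega> by (simp add: C_def c_def)
    finally show "n h \<le> C * (\<integral>k. n k \<partial>heat ((norm h)\<^sup>2))"
      by (simp only: Q_def r_def)
  qed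
qed

text \<open>The Gaussian average of the modulus at the parameter |h|^2 is 2 psi, and the linear
  bound on \<open>psi\<close> makes it quadratic in |h|. This bounds the difference quotients
  uniformly in L2.\<close>

lemma modulus_quadratic_bound:
  fixes g :: "'a::euclidean_space \<Rightarrow> real"
  assumes g: "g \<in> L2" and M: "\<And>t. 0 < t \<Longrightarrow> psi g t \<le> M * t"
  obtains C where "0 \<le> C" "\<And>h. modulus g h \<le> C * (norm h)\<^sup>2"
proof -
  obtain C where C: "0 < C"
    "\<And>(n :: 'a \<Rightarrow> real) h B. n \<in> borel_measurable borel \<Longrightarrow> (\<And>h. 0 \<le> n h) \<Longrightarrow> (\<And>h. n h \<le> B) \<Longrightarrow>
      (\<And>h k. n (h + k) \<le> 2 * n h + 2 * n k) \<Longrightarrow> h \<noteq> 0 \<Longrightarrow> n h \<le> C * (\<integral>k. n k \<partial>heat ((norm h)\<^sup>2))"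
    using pointwise_from_heat_average by blast
  have M0: "0 \<le> M" using M[of 1] psi_nonneg[of g 1] by simp
  show ?thesis
  proof (rule that[of "C * (2 * M)"])
    fix h :: 'a
    show "modulus g h \<le> C * (2 * M) * (norm h)\<^sup>2"
    proof (cases "h = 0")
      case True
      then show ?thesis by (simp add: modulus_def sd_def sqnorm_def)
    next
      case False
      have "modulus g h \<le> C * (\<integral>k. modulus g k \<partial>heat ((norm h)\<^sup>2))"
        by (rule C(2)[OF modulus_measurable[OF g] modulus_nonneg modulus_le[OF g] modulus_subadditive[OF g] False])
      also have "\<dots> = C * (2 * psi g ((norm h)\<^sup>2))" by (simp add: psi_def)
      also have "\<dots> \<le> C * (2 * (M * (norm h)\<^sup>2))"
        using C(1) M[of "(norm h)\<^sup>2"] False by (intro mult_left_mono) auto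
      finally show ?thesis by (simp add: mult.assoc)
    qed
  qed (use C M0 in auto)
qed

text \<open>The pointwise principle applies with t fixed to n(h) = psi (sd h g) t, whose
  quasi-subadditivity is \<open>psi_sd_subadditive\<close>.\<close>

lemma psi_sd_bound:
  obtains C where "0 < C"
    "\<And>(g :: 'a::euclidean_space \<Rightarrow> real) t h. g \<in> L2 \<Longrightarrow> 0 < t \<Longrightarrow> h \<noteq> 0 \<Longrightarrow> psi (sd h g) t \<le> C * psi2 g ((norm h)\<^sup>2) t"
proof -
  obtain C where C: "0 < C"
    "\<And>(n :: 'a \<Rightarrow> real) h B. n \<in> borel_measurable borel \<Longrightarrow> (\<And>h. 0 \<le> n h) \<Longrightarrow> (\<And>h. n h \<le> B) \<Longrightarrow>
      (\<And>h k. n (h + k) \<le> 2 * n h + 2 * n k) \<Longrightarrow> h \<noteq> 0 \<Longrightarrow> n h \<le> C * (\<integral>k. n k \<partial>heat ((norm h)\<^sup>2))"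
    using pointwise_from_heat_average by blast
  show ?thesis
  proof (rule that[of "2 * C"])
    fix g :: "'a \<Rightarrow> real" and t :: real and h :: 'a
    assume g: "g \<in> L2" and t: "0 < t" and h: "h \<noteq> 0"
    have m: "(\<lambda>h. psi (sd h g) t) \<in> borel_measurable borel"
      using measurable_compose[of "\<lambda>h. (h, t)" borel "borel \<Otimes>\<^sub>M borel", OF _ psi_sd_measurable[OF g]] by simp
    have "psi (sd h g) t \<le> C * (\<integral>k. psi (sd k g) t \<partial>heat ((norm h)\<^sup>2))"
      by (rule C(2)[OF m psi_nonneg psi_sd_le[OF t g] psi_sd_subadditive[OF t g] h])
    then show "psi (sd h g) t \<le> 2 * C * psi2 g ((norm h)\<^sup>2) t"
      using psi_sd[of "(norm h)\<^sup>2" t g] g t h by simp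
  qed (use C in auto)
qed

section \<open>Limits in \<open>L\<^sup>2\<close>\<close>

text \<open>Riesz-Fischer: a subsequence whose increments have squared norm below 4^(-j) converges
  almost everywhere, and Fatou's lemma along it gives convergence in norm of the whole
  sequence.\<close>

lemma L2_complete:
  fixes v :: "nat \<Rightarrow> 'a::euclidean_space \<Rightarrow> real"
  assumes v: "\<And>n. v n \<in> L2"
    and Cauchy: "\<And>e. 0 < e \<Longrightarrow> \<exists>M. \<forall>m\<ge>M. \<forall>n\<ge>M. sqnorm (\<lambda>x. v m x - v n x) < e"
  obtains g where "g \<in> L2" "(\<lambda>n. sqnorm (\<lambda>x. v n x - g x)) \<longlonglongrightarrow> 0"
proof -
  have [measurable]: "v n \<in> borel_measurable borel" for n using v by auto
  have "\<exists>M. \<forall>m\<ge>M. \<forall>n\<ge>M. sqnorm (\<lambda>x. v m x - v n x) < (1/4) ^ j" for j :: nat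
    by (rule Cauchy) simp
  then obtain M where M: "\<And>j m n. M j \<le> m \<Longrightarrow> M j \<le> n \<Longrightarrow> sqnorm (\<lambda>x. v m x - v n x) < (1/4) ^ j"
    by metis
  \<comment> \<open>Partial sums make the index nondecreasing and at least both \<open>M j\<close>
    and j.\<close>
  define k where "k j = (\<Sum>i\<le>j. M i + 1)" for j
  have kM: "M j \<le> k j" for j
    unfolding k_def using member_le_sum[of j "{..j}" "\<lambda>i. M i + 1"] by auto
  have kS: "k j \<le> k (Suc j)" for j by (simp add: k_def)
  have kj: "j \<le> k j" for j
    by (induction j) (auto simp: k_def)
  define d where "d j x = v (k (Suc j)) x - v (k j) x" for j x
  have [measurable]: "d j \<in> borel_measurable borel" for j unfolding d_def[abs_def] by measurable
  have dL: "d j \<in> L2" for j unfolding d_def[abs_def] using v by (intro L2_diff)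
  have ds: "sqnorm (d j) \<le> (1/4) ^ j" for j
    unfolding d_def[abs_def] using M[of j "k (Suc j)" "k j"] kM[of j] kS[of j] by simp
  have "(\<integral>\<^sup>+x. (\<Sum>j. ennreal (2 ^ j * (d j x)\<^sup>2)) \<partial>lborel) = (\<Sum>j. \<integral>\<^sup>+x. ennreal (2 ^ j * (d j x)\<^sup>2) \<partial>lborel)"
    by (rule nn_integral_suminf) measurable
  also have "\<dots> \<le> (\<Sum>j. ennreal ((1/2) ^ j))"
  proof (intro suminf_le)
    fix j :: nat
    have "(\<integral>\<^sup>+x. ennreal (2 ^ j * (d j x)\<^sup>2) \<partial>lborel) = ennreal (2 ^ j) * ennreal (sqnorm (d j))"
      by (simp add: ennreal_mult nn_integral_cmult L2_nn_integral[OF dL] del: ennreal_power)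
    also have "\<dots> \<le> ennreal (2 ^ j * (1/4) ^ j)"
      using ds[of j] by (subst ennreal_mult[symmetric]) (auto simp: sqnorm_nonneg intro!: ennreal_leI)
    also have "2 ^ j * (1/4) ^ j = (1/2::real) ^ j" by (simp add: power_mult_distrib[symmetric])
    finally show "(\<integral>\<^sup>+x. ennreal (2 ^ j * (d j x)\<^sup>2) \<partial>lborel) \<le> ennreal ((1/2) ^ j)" .
  qed auto
  also have "\<dots> < \<infinity>"
  proof -
    have "(\<Sum>j. ennreal ((1/2) ^ j) * 1) < \<infinity>" by (rule suminf_geometric_finite) auto
    then show ?thesis by (simp only: mult_1_right)
  qed
  finally have "(\<integral>\<^sup>+x. (\<Sum>j. ennreal (2 ^ j * (d j x)\<^sup>2)) \<partial>lborel) \<noteq> \<infinity>" by simp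
  then have "AE x in lborel. (\<Sum>j. ennreal (2 ^ j * (d j x)\<^sup>2)) \<noteq> \<infinity>"
    by (intro nn_integral_noteq_infinite) auto
  then have conv: "AE x in lborel. convergent (\<lambda>j. v (k j) x)"
  proof eventually_elim
    case (elim x)
    have sm: "summable (\<lambda>j. 2 ^ j * (d j x)\<^sup>2)"
      by (rule summable_suminf_not_top) (use elim in auto)
    have sm2: "summable (\<lambda>j. (1/2::real) ^ j)" by (rule summable_geometric) simp
    have "summable (\<lambda>j. d j x)"
    proof (rule summable_comparison_test[OF _ summable_add[OF sm sm2]], intro exI allI impI)
      fix j :: nat
      \<comment> \<open>Young's inequality with the weights 2^j and 2^(-j): the weighted squares are
        summable at this x, the inverse weights form a geometric series.\<close>
      have "2 * (\<bar>d j x\<bar> * sqrt (2 ^ j)) * sqrt ((1/2) ^ j) \<le> (\<bar>d j x\<bar> * sqrt (2 ^ j))\<^sup>2 + (sqrt ((1/2) ^ j))\<^sup>2"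
        by (rule sum_squares_bound)
      moreover have "sqrt (2 ^ j) * sqrt ((1/2) ^ j) = 1"
        by (simp add: real_sqrt_mult[symmetric] power_mult_distrib[symmetric])
      moreover have "2 * (\<bar>d j x\<bar> * sqrt (2 ^ j)) * sqrt ((1/2) ^ j) = 2 * \<bar>d j x\<bar> * (sqrt (2 ^ j) * sqrt ((1/2) ^ j))"
        by (simp only: mult_ac)
      moreover have "(\<bar>d j x\<bar> * sqrt (2 ^ j))\<^sup>2 + (sqrt ((1/2) ^ j))\<^sup>2 = 2 ^ j * (d j x)\<^sup>2 + (1/2) ^ j"
        by (simp add: power_mult_distrib)
      ultimately have "2 * \<bar>d j x\<bar> \<le> 2 ^ j * (d j x)\<^sup>2 + (1/2) ^ j"
        by simp
      then show "norm (d j x) \<le> 2 ^ j * (d j x)\<^sup>2 + (1/2) ^ j" by simp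
    qed
    then have "convergent (\<lambda>n. \<Sum>j<n. d j x)" by (simp add: summable_iff_convergent)
    moreover have "(\<Sum>j<n. d j x) = v (k n) x - v (k 0) x" for n
      unfolding d_def by (rule sum_lessThan_telescope)
    ultimately have "convergent (\<lambda>n. (v (k n) x - v (k 0) x) + v (k 0) x)"
      by (intro convergent_add convergent_const) simp
    then show ?case by simp
  qed
  define g where "g x = lim (\<lambda>j. v (k j) x)" for x
  have [measurable]: "g \<in> borel_measurable borel"
    unfolding g_def[abs_def] by measurable
  have le: "(\<integral>\<^sup>+x. ennreal ((v n x - g x)\<^sup>2) \<partial>lborel) \<le> ennreal e"
    if e: "0 < e" and n: "\<forall>m\<ge>N. sqnorm (\<lambda>x. v n x - v m x) < e" for n N e
  proof -
    have "(\<integral>\<^sup>+x. ennreal ((v n x - g x)\<^sup>2) \<partial>lborel) = (\<integral>\<^sup>+x. liminf (\<lambda>j. ennreal ((v n x - v (k j) x)\<^sup>2)) \<partial>lborel)"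
    proof (rule nn_integral_cong_AE, use conv in eventually_elim)
      case (elim x)
      then have "(\<lambda>j. v (k j) x) \<longlonglongrightarrow> g x" by (simp add: g_def convergent_LIMSEQ_iff)
      then have "(\<lambda>j. ennreal ((v n x - v (k j) x)\<^sup>2)) \<longlonglongrightarrow> ennreal ((v n x - g x)\<^sup>2)"
        by (intro tendsto_intros)
      from lim_imp_Liminf[OF trivial_limit_sequentially this] show ?case by (rule sym)
    qed
    also have "\<dots> \<le> liminf (\<lambda>j. \<integral>\<^sup>+x. ennreal ((v n x - v (k j) x)\<^sup>2) \<partial>lborel)"
      by (rule nn_integral_liminf) measurable
    also have "\<dots> = liminf (\<lambda>j. ennreal (sqnorm (\<lambda>x. v n x - v (k j) x)))"
      by (simp add: L2_nn_integral[OF L2_diff[OF v v]])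
    also have "\<dots> \<le> ennreal e"
    proof (rule Liminf_le)
      show "\<forall>\<^sub>F j in sequentially. ennreal (sqnorm (\<lambda>x. v n x - v (k j) x)) \<le> ennreal e"
        using n kj by (intro eventually_sequentiallyI[of N]) (meson ennreal_leI less_imp_le order_trans)
    qed simp
    finally show ?thesis .
  qed
  obtain N1 where N1: "\<forall>m\<ge>N1. \<forall>n\<ge>N1. sqnorm (\<lambda>x. v m x - v n x) < 1" using Cauchy[of 1] by auto
  have "(\<lambda>x. v N1 x - g x) \<in> L2"
    using le[of 1 N1 N1] N1 by (intro L2I) (auto intro: le_less_trans)
  from L2_diff[OF v[of N1] this] have gL: "g \<in> L2" by simp
  have "(\<lambda>n. sqnorm (\<lambda>x. v n x - g x)) \<longlonglongrightarrow> 0"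
  proof (rule LIMSEQ_I)
    fix e :: real assume e: "0 < e"
    obtain N where N: "\<forall>m\<ge>N. \<forall>n\<ge>N. sqnorm (\<lambda>x. v m x - v n x) < e / 2" using Cauchy[of "e / 2"] e by auto
    have "sqnorm (\<lambda>x. v n x - g x) \<le> e / 2" if "N \<le> n" for n
      using le[of "e / 2" N n] N e that by (simp add: L2_nn_integral[OF L2_diff[OF v gL]] sqnorm_nonneg)
    then show "\<exists>N. \<forall>n\<ge>N. norm (sqnorm (\<lambda>x. v n x - g x) - 0) < e"
      using e by (intro exI[of _ N]) (force simp: sqnorm_nonneg)
  qed
  with gL show ?thesis by (rule that)
qed

text \<open>A substitute for weak compactness: near-minimisers of the norm in a decreasing sequence of
  convex sets form a Cauchy sequence.\<close>

lemma convex_sets_limit: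
  fixes T :: "nat \<Rightarrow> ('a::euclidean_space \<Rightarrow> real) set"
  assumes TL: "\<And>n. T n \<subseteq> L2" and dec: "\<And>n. T (Suc n) \<subseteq> T n"
    and mid: "\<And>n f g. f \<in> T n \<Longrightarrow> g \<in> T n \<Longrightarrow> (\<lambda>x. (f x + g x) / 2) \<in> T n"
    and ne: "\<And>n. f0 n \<in> T n" "\<And>n. sqnorm (f0 n) \<le> C"
  obtains f g where "\<And>n. f n \<in> T n" "g \<in> L2" "(\<lambda>n. sqnorm (\<lambda>x. f n x - g x)) \<longlonglongrightarrow> 0"
proof -
  define d where "d n = Inf (sqnorm ` T n)" for n
  have bb: "bdd_below (sqnorm ` T n)" for n
    by (rule bdd_belowI[of _ 0]) (auto simp: sqnorm_nonneg)
  have dle: "d n \<le> sqnorm f" if "f \<in> T n" for n f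
    unfolding d_def using that by (intro cInf_lower bb) auto
  have dC: "d n \<le> C" for n using dle[OF ne(1)] ne(2)[of n] by (rule order_trans)
  have dmono: "d n \<le> d (Suc n)" for n
    unfolding d_def using ne(1)[of "Suc n"] dec[of n] by (intro cInf_superset_mono bb) auto
  have inc: "incseq d" using dmono by (rule incseq_SucI)
  then obtain D where D: "d \<longlonglongrightarrow> D" "\<And>n. d n \<le> D"
    using incseq_convergent[of d C] dC by metis
  have "\<exists>f\<in>T n. sqnorm f < d n + 1 / real (Suc n)" for n
  proof -
    have "Inf (sqnorm ` T n) < d n + 1 / real (Suc n)" by (simp add: d_def)
    then show ?thesis using ne(1)[of n] by (subst (asm) cInf_less_iff[OF _ bb]) auto
  qed
  then obtain f where f: "\<And>n. f n \<in> T n" "\<And>n. sqnorm (f n) < d n + 1 / real (Suc n)" by metis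
  have fL: "f n \<in> L2" for n using f(1) TL by blast
  have decT: "T m \<subseteq> T n" if "n \<le> m" for n m using lift_Suc_antimono_le[of T, OF dec that] .
  \<comment> \<open>Parallelogram law: the midpoint belongs to \<open>T n\<close> and so has squared
    norm at least \<open>d n\<close>, which leaves little room for the difference.\<close>
  have est: "sqnorm (\<lambda>x. f m x - f n x) \<le> 4 * (D - d n) + 4 / real (Suc n)" if nm: "n \<le> m" for n m
  proof -
    have "(\<lambda>x. (f m x + f n x) / 2) \<in> T n" using f(1) decT[OF nm] by (intro mid) auto
    from dle[OF this] have "4 * d n \<le> sqnorm (\<lambda>x. f m x + f n x)"
      using sqnorm_cmult[of "1/2" "\<lambda>x. f m x + f n x"] by (simp add: power_divide)
    moreover have "sqnorm (\<lambda>x. f m x + f n x) + sqnorm (\<lambda>x. f m x - f n x) = 2 * sqnorm (f m) + 2 * sqnorm (f n)"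
      by (rule sqnorm_parallelogram[OF fL fL])
    moreover have "1 / real (Suc m) \<le> 1 / real (Suc n)" using nm by (simp add: frac_le)
    moreover have "d n \<le> D" "d m \<le> D" by (rule D(2))+
    ultimately show ?thesis using f(2)[of m] f(2)[of n] by simp
  qed
  have "(\<lambda>n. 4 * (D - d n) + 4 * (1 / real (Suc n))) \<longlonglongrightarrow> 4 * (D - D) + 4 * 0"
    using LIMSEQ_inverse_real_of_nat by (intro tendsto_intros D(1)) (simp add: inverse_eq_divide)
  then have lim: "(\<lambda>n. 4 * (D - d n) + 4 / real (Suc n)) \<longlonglongrightarrow> 0" by simp
  have "\<exists>M. \<forall>m\<ge>M. \<forall>n\<ge>M. sqnorm (\<lambda>x. f m x - f n x) < e" if e: "0 < e" for e
  proof -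
    have "\<forall>\<^sub>F n in sequentially. 4 * (D - d n) + 4 / real (Suc n) < e / 4"
      using lim e by (intro order_tendstoD(2)) auto
    then obtain M where M: "4 * (D - d M) + 4 / real (Suc M) < e / 4"
      by (auto simp: eventually_sequentially)
    have "sqnorm (\<lambda>x. f m x - f n x) < e" if "M \<le> m" "M \<le> n" for m n
    proof -
      have "sqnorm (\<lambda>x. (f m x - f M x) - (f n x - f M x)) \<le> 2 * sqnorm (\<lambda>x. f m x - f M x) + 2 * sqnorm (\<lambda>x. f n x - f M x)"
        by (intro sqnorm_diff_le L2_diff fL)
      then show ?thesis using est[OF that(1)] est[OF that(2)] M by simp
    qed
    then show ?thesis by blast
  qed
  from L2_complete[OF fL this] obtain g where "g \<in> L2" "(\<lambda>n. sqnorm (\<lambda>x. f n x - g x)) \<longlonglongrightarrow> 0" by blast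
  with f(1) show ?thesis by (rule that)
qed

lemma L2_inner_tendsto:
  assumes f: "\<And>n. f n \<in> L2" and g: "g \<in> L2" and h: "h \<in> L2"
    and lim: "(\<lambda>n. sqnorm (\<lambda>x. f n x - g x)) \<longlonglongrightarrow> 0"
  shows "(\<lambda>n. \<integral>x. f n x * h x \<partial>lborel) \<longlonglongrightarrow> (\<integral>x. g x * h x \<partial>lborel)"
proof (rule LIM_zero_cancel, rule Lim_null_comparison)
  show "\<forall>\<^sub>F n in sequentially. norm ((\<integral>x. f n x * h x \<partial>lborel) - (\<integral>x. g x * h x \<partial>lborel))
      \<le> sqrt (sqnorm (\<lambda>x. f n x - g x)) * sqrt (sqnorm h)"
  proof (rule always_eventually, rule allI)
    fix n
    have "(\<integral>x. f n x * h x \<partial>lborel) - (\<integral>x. g x * h x \<partial>lborel) = (\<integral>x. (f n x - g x) * h x \<partial>lborel)"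
      using L2_prod_integrable[OF f h] L2_prod_integrable[OF g h] by (simp add: left_diff_distrib)
    then show "norm ((\<integral>x. f n x * h x \<partial>lborel) - (\<integral>x. g x * h x \<partial>lborel)) \<le> sqrt (sqnorm (\<lambda>x. f n x - g x)) * sqrt (sqnorm h)"
      using L2_Cauchy_Schwarz[OF L2_diff[OF f g] h] by simp
  qed
  have "(\<lambda>n. sqrt (sqnorm (\<lambda>x. f n x - g x)) * sqrt (sqnorm h)) \<longlonglongrightarrow> sqrt 0 * sqrt (sqnorm h)"
    by (intro tendsto_intros lim)
  then show "(\<lambda>n. sqrt (sqnorm (\<lambda>x. f n x - g x)) * sqrt (sqnorm h)) \<longlonglongrightarrow> 0" by simp
qed

section \<open>Test functions\<close>

lemma test_continuous: "\<phi> \<in> test_functions \<Omega> \<Longrightarrow> continuous_on UNIV \<phi>"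
  unfolding test_functions_def by (drule CollectD) (metis Ck.simps(1))

lemma test_measurable: "\<phi> \<in> test_functions \<Omega> \<Longrightarrow> \<phi> \<in> borel_measurable borel"
  by (rule borel_measurable_continuous_onI[OF test_continuous])

lemma test_differentiable: "\<phi> \<in> test_functions \<Omega> \<Longrightarrow> \<phi> differentiable (at x)"
  unfolding test_functions_def by (drule CollectD) (metis Ck.simps(2))

lemma test_has_derivative: "\<phi> \<in> test_functions \<Omega> \<Longrightarrow> (\<phi> has_derivative frechet_derivative \<phi> (at x)) (at x)"
  using test_differentiable frechet_derivative_works by blast

lemma test_partial:
  assumes \<phi>: "\<phi> \<in> test_functions \<Omega>" and b: "b \<in> Basis"
  shows "(\<lambda>x. frechet_derivative \<phi> (at x) b) \<in> test_functions \<Omega>"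
proof -
  let ?S = "closure {x. \<phi> x \<noteq> 0}" and ?T = "{x. frechet_derivative \<phi> (at x) b \<noteq> 0}"
  have "frechet_derivative \<phi> (at x) b = 0" if x: "x \<notin> ?S" for x
  proof -
    have "((\<lambda>_. 0) has_derivative frechet_derivative \<phi> (at x)) (at x)"
    proof (rule has_derivative_transform_within_open[OF test_has_derivative[OF \<phi>]])
      show "open (- ?S)" by auto
      show "x \<in> - ?S" using x by simp
      show "\<phi> y = 0" if "y \<in> - ?S" for y using that closure_subset[of "{x. \<phi> x \<noteq> 0}"] by auto
    qed
    then have "frechet_derivative \<phi> (at x) = (\<lambda>_. 0)"
      using has_derivative_unique has_derivative_const by blast
    then show ?thesis by simp
  qed
  then have "?T \<subseteq> ?S" by auto
  then have sub: "closure ?T \<subseteq> ?S" by (rule closure_minimal) simp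
  have cS: "compact ?S" "?S \<subseteq> \<Omega>" using \<phi> by (auto simp: test_functions_def)
  have "compact (closure ?T)"
    using compact_Int_closed[OF cS(1), of "closure ?T"] sub by (simp add: Int_absorb1)
  moreover have "\<forall>k. Ck k (\<lambda>x. frechet_derivative \<phi> (at x) b)"
  proof
    fix k
    have "Ck (Suc k) \<phi>" using \<phi> by (simp add: test_functions_def del: Ck.simps)
    then show "Ck k (\<lambda>x. frechet_derivative \<phi> (at x) b)" using b unfolding Ck.simps by blast
  qed
  ultimately show ?thesis using sub cS(2) unfolding test_functions_def by auto
qed

lemma test_bounded:
  assumes "\<phi> \<in> test_functions \<Omega>"
  obtains B where "0 \<le> B" "\<And>x. \<bar>\<phi> x\<bar> \<le> B"
proof -
  have "compact (\<phi> ` closure {x. \<phi> x \<noteq> 0})"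
    using assms test_continuous[OF assms]
    by (intro compact_continuous_image) (auto simp: test_functions_def intro: continuous_on_subset)
  then have "bounded (\<phi> ` closure {x. \<phi> x \<noteq> 0})" by (rule compact_imp_bounded)
  then obtain B where B: "\<And>x. x \<in> closure {x. \<phi> x \<noteq> 0} \<Longrightarrow> \<bar>\<phi> x\<bar> \<le> B"
    unfolding bounded_iff by (metis imageI real_norm_def)
  have "\<bar>\<phi> x\<bar> \<le> max B 0" for x
    using B[of x] closure_subset[of "{x. \<phi> x \<noteq> 0}"] by (cases "\<phi> x = 0") (auto simp: max_def)
  then show ?thesis by (intro that[of "max B 0"]) auto
qed

lemma test_support:
  assumes "\<phi> \<in> test_functions \<Omega>"
  obtains R where "0 < R" "\<And>x. R < norm x \<Longrightarrow> \<phi> x = 0"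
proof -
  have "bounded (closure {x. \<phi> x \<noteq> 0})"
    using assms by (auto simp: test_functions_def compact_imp_bounded)
  then obtain R where R: "0 < R" "\<And>x. x \<in> closure {x. \<phi> x \<noteq> 0} \<Longrightarrow> norm x \<le> R"
    by (auto simp: bounded_pos)
  show ?thesis
    by (rule that[OF R(1)]) (use R(2) closure_subset[of "{x. \<phi> x \<noteq> 0}"] in force)
qed

lemma test_derivative_expand:
  assumes "\<phi> \<in> test_functions \<Omega>"
  shows "frechet_derivative \<phi> (at x) h = (\<Sum>b\<in>Basis. (h \<bullet> b) * frechet_derivative \<phi> (at x) b)"
proof -
  have lin: "linear (frechet_derivative \<phi> (at x))"
    using test_has_derivative[OF assms] by (rule has_derivative_linear)
  have "frechet_derivative \<phi> (at x) (\<Sum>b\<in>Basis. (h \<bullet> b) *\<^sub>R b) = (\<Sum>b\<in>Basis. (h \<bullet> b) *\<^sub>R frechet_derivative \<phi> (at x) b)"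
    by (simp add: linear_sum[OF lin] linear_scale[OF lin])
  then show ?thesis by (simp add: euclidean_representation)
qed

lemma test_lipschitz:
  assumes \<phi>: "\<phi> \<in> test_functions \<Omega>"
  obtains L where "0 \<le> L" "\<And>x y. \<bar>\<phi> x - \<phi> y\<bar> \<le> L * norm (x - y)"
proof -
  have "\<exists>B. 0 \<le> B \<and> (\<forall>x. \<bar>frechet_derivative \<phi> (at x) b\<bar> \<le> B)" if "b \<in> Basis" for b
    using test_bounded[OF test_partial[OF \<phi> that]] by metis
  then obtain B where B: "\<And>b. b \<in> Basis \<Longrightarrow> 0 \<le> B b" "\<And>b x. b \<in> Basis \<Longrightarrow> \<bar>frechet_derivative \<phi> (at x) b\<bar> \<le> B b"
    by metis
  let ?L = "\<Sum>b\<in>Basis. B b"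
  have bd: "norm (frechet_derivative \<phi> (at x) h) \<le> ?L * norm h" for x h
  proof -
    have "norm (frechet_derivative \<phi> (at x) h) \<le> (\<Sum>b\<in>Basis. \<bar>(h \<bullet> b) * frechet_derivative \<phi> (at x) b\<bar>)"
      unfolding test_derivative_expand[OF \<phi>, of x h] real_norm_def by (rule sum_abs)
    also have "\<dots> \<le> (\<Sum>b\<in>Basis. norm h * B b)"
      unfolding abs_mult by (intro sum_mono mult_mono B Basis_le_norm) auto
    also have "\<dots> = ?L * norm h" by (subst sum_distrib_right) (simp only: mult.commute)
    finally show ?thesis .
  qed
  show ?thesis
  proof (rule that[of ?L])
    show "0 \<le> ?L" using B(1) by (rule sum_nonneg)
    fix x y
    have "norm (\<phi> x - \<phi> y) \<le> ?L * norm (x - y)"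
    proof (rule differentiable_bound[of UNIV])
      show "onorm (frechet_derivative \<phi> (at z)) \<le> ?L" for z
        by (rule onorm_le[OF bd])
    qed (use test_has_derivative[OF \<phi>] in auto)
    then show "\<bar>\<phi> x - \<phi> y\<bar> \<le> ?L * norm (x - y)" by simp
  qed
qed

lemma test_line_derivative:
  assumes "\<phi> \<in> test_functions \<Omega>"
  shows "((\<lambda>t. \<phi> (x + t *\<^sub>R h)) has_real_derivative frechet_derivative \<phi> (at (x + t *\<^sub>R h)) h) (at t)"
proof -
  have lin: "linear (frechet_derivative \<phi> (at (x + t *\<^sub>R h)))"
    using test_has_derivative[OF assms] by (rule has_derivative_linear)
  have "((\<lambda>t. \<phi> (x + t *\<^sub>R h)) has_derivative (\<lambda>r. frechet_derivative \<phi> (at (x + t *\<^sub>R h)) (r *\<^sub>R h))) (at t)"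
  proof (rule has_derivative_compose[OF _ test_has_derivative[OF assms]])
    show "((\<lambda>t. x + t *\<^sub>R h) has_derivative (\<lambda>r. r *\<^sub>R h)) (at t)"
      by (auto intro!: derivative_eq_intros)
  qed
  moreover have "(\<lambda>r. frechet_derivative \<phi> (at (x + t *\<^sub>R h)) (r *\<^sub>R h)) = (*) (frechet_derivative \<phi> (at (x + t *\<^sub>R h)) h)"
    by (simp add: fun_eq_iff linear_scale[OF lin])
  ultimately show ?thesis by (simp add: has_field_derivative_def)
qed

text \<open>Mean value theorem for the sum of the values at x + t h and x - t h: its derivative is a
  difference of first derivatives at points 2t|h| apart, and these are Lipschitz.\<close>

lemma test_second_difference:
  assumes \<phi>: "\<phi> \<in> test_functions \<Omega>"
  obtains L where "0 \<le> L" "\<And>x h. \<bar>2 * \<phi> x - \<phi> (x + h) - \<phi> (x - h)\<bar> \<le> L * (norm h)\<^sup>2"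
proof -
  let ?D = "\<lambda>b x. frechet_derivative \<phi> (at x) b"
  have "\<exists>L. 0 \<le> L \<and> (\<forall>x y. \<bar>?D b x - ?D b y\<bar> \<le> L * norm (x - y))" if "b \<in> Basis" for b
    using test_lipschitz[OF test_partial[OF \<phi> that]] by metis
  then obtain L where L: "\<And>b. b \<in> Basis \<Longrightarrow> 0 \<le> L b" "\<And>b x y. b \<in> Basis \<Longrightarrow> \<bar>?D b x - ?D b y\<bar> \<le> L b * norm (x - y)"
    by metis
  show ?thesis
  proof (rule that[of "2 * (\<Sum>b\<in>Basis. L b)"])
    show "0 \<le> 2 * (\<Sum>b\<in>Basis. L b)" using L(1) by (simp add: sum_nonneg)
    fix x h :: 'a
    define z where "z t = \<phi> (x + t *\<^sub>R h) + \<phi> (x + t *\<^sub>R (- h))" for t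
    define z' where "z' t = ?D h (x + t *\<^sub>R h) + ?D (- h) (x + t *\<^sub>R (- h))" for t
    have der: "(z has_real_derivative z' t) (at t)" for t
      unfolding z_def[abs_def] z'_def by (intro DERIV_add test_line_derivative[OF \<phi>])
    obtain t where t: "0 < t" "t < 1" "z 1 - z 0 = (1 - 0) * z' t"
      using MVT2[of 0 1 z z'] der by auto
    have "z' t = (\<Sum>b\<in>Basis. (h \<bullet> b) * (?D b (x + t *\<^sub>R h) - ?D b (x + t *\<^sub>R (- h))))"
      unfolding z'_def test_derivative_expand[OF \<phi>, of _ h] test_derivative_expand[OF \<phi>, of _ "- h"]
      by (simp add: right_diff_distrib sum_subtractf sum_negf)
    then have "\<bar>z' t\<bar> \<le> (\<Sum>b\<in>Basis. \<bar>h \<bullet> b\<bar> * \<bar>?D b (x + t *\<^sub>R h) - ?D b (x + t *\<^sub>R (- h))\<bar>)"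
      by (simp add: abs_mult[symmetric])
    also have "\<dots> \<le> (\<Sum>b\<in>Basis. norm h * (L b * (2 * norm h)))"
    proof (intro sum_mono mult_mono Basis_le_norm)
      fix b :: 'a assume b: "b \<in> Basis"
      have "\<bar>?D b (x + t *\<^sub>R h) - ?D b (x + t *\<^sub>R (- h))\<bar> \<le> L b * norm ((x + t *\<^sub>R h) - (x + t *\<^sub>R (- h)))"
        by (rule L(2)[OF b])
      also have "(x + t *\<^sub>R h) - (x + t *\<^sub>R (- h)) = (2 * t) *\<^sub>R h" by (simp add: algebra_simps scaleR_2[symmetric])
      also have "L b * norm ((2 * t) *\<^sub>R h) \<le> L b * (2 * norm h)"
        using t L(1)[OF b] by (intro mult_left_mono) (auto intro!: mult_left_le_one_le)
      finally show "\<bar>?D b (x + t *\<^sub>R h) - ?D b (x + t *\<^sub>R (- h))\<bar> \<le> L b * (2 * norm h)" .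
    qed auto
    also have "\<dots> = 2 * (\<Sum>b\<in>Basis. L b) * (norm h)\<^sup>2"
      by (simp add: sum_distrib_left sum_distrib_right power2_eq_square mult_ac)
    finally have "\<bar>z 1 - z 0\<bar> \<le> 2 * (\<Sum>b\<in>Basis. L b) * (norm h)\<^sup>2" using t(3) by simp
    then show "\<bar>2 * \<phi> x - \<phi> (x + h) - \<phi> (x - h)\<bar> \<le> 2 * (\<Sum>b\<in>Basis. L b) * (norm h)\<^sup>2"
      by (simp add: z_def)
  qed
qed

lemma test_L2:
  fixes \<phi> :: "'a::euclidean_space \<Rightarrow> real"
  assumes "\<phi> \<in> test_functions \<Omega>"
  shows "\<phi> \<in> L2"
proof -
  have [measurable]: "\<phi> \<in> borel_measurable borel" by (rule test_measurable[OF assms])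
  obtain B where B: "0 \<le> B" "\<And>x. \<bar>\<phi> x\<bar> \<le> B" using test_bounded[OF assms] by blast
  obtain R where R: "0 < R" "\<And>x. R < norm x \<Longrightarrow> \<phi> x = 0" using test_support[OF assms] by blast
  have "(\<integral>\<^sup>+x. ennreal ((\<phi> x)\<^sup>2) \<partial>lborel) \<le> (\<integral>\<^sup>+x. ennreal (B\<^sup>2) * indicator (cball 0 R) (x::'a) \<partial>lborel)"
  proof (rule nn_integral_mono)
    fix x :: 'a
    have "(\<phi> x)\<^sup>2 \<le> B\<^sup>2" using power_mono[OF B(2)[of x], of 2] by simp
    then show "ennreal ((\<phi> x)\<^sup>2) \<le> ennreal (B\<^sup>2) * indicator (cball 0 R) x"
      using R(2)[of x] by (cases "R < norm x") (auto intro: ennreal_leI)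
  qed
  also have "\<dots> < \<infinity>"
    using emeasure_lborel_cball_finite[of "0::'a" R] by (simp add: nn_integral_cmult_indicator ennreal_mult_less_top)
  finally show ?thesis by (intro L2I) auto
qed

section \<open>Existence of weak derivatives\<close>

text \<open>The quotient moves onto the test function with the increment reversed, whence the minus
  sign. Increments have length at most 1, so the quotients of \<phi> are dominated by L on the ball
  of radius R + 1 and vanish outside it.\<close>

lemma difference_quotient_test_tendsto:
  fixes w :: "'a::euclidean_space \<Rightarrow> real"
  assumes w: "w \<in> L2" and \<phi>: "\<phi> \<in> test_functions UNIV" and b: "b \<in> Basis"
  shows "(\<lambda>n. \<integral>x. (2 ^ n * sd ((1/2) ^ n *\<^sub>R b) w x) * \<phi> x \<partial>lborel) \<longlonglongrightarrow> - (\<integral>x. w x * frechet_derivative \<phi> (at x) b \<partial>lborel)"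
proof -
  have [measurable]: "w \<in> borel_measurable borel" "\<phi> \<in> borel_measurable borel"
      "(\<lambda>x. frechet_derivative \<phi> (at x) b) \<in> borel_measurable borel"
    using w test_measurable[OF \<phi>] test_measurable[OF test_partial[OF \<phi> b]] by auto
  obtain L where L: "0 \<le> L" "\<And>x y. \<bar>\<phi> x - \<phi> y\<bar> \<le> L * norm (x - y)" using test_lipschitz[OF \<phi>] by blast
  obtain R where R: "0 < R" "\<And>x. R < norm x \<Longrightarrow> \<phi> x = 0" using test_support[OF \<phi>] by blast
  have \<phi>L: "\<phi> \<in> L2" by (rule test_L2[OF \<phi>])
  define q where "q n x = 2 ^ n * (\<phi> (x + (- ((1/2) ^ n)) *\<^sub>R b) - \<phi> x)" for n :: nat and x
  have eq: "(\<integral>x. (2 ^ n * sd ((1/2) ^ n *\<^sub>R b) w x) * \<phi> x \<partial>lborel) = (\<integral>x. w x * q n x \<partial>lborel)" for n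
  proof -
    let ?h = "(1/2) ^ n *\<^sub>R b"
    have i: "integrable lborel (\<lambda>x. w (x + ?h) * \<phi> x)" "integrable lborel (\<lambda>x. w x * \<phi> x)"
      "integrable lborel (\<lambda>x. w x * \<phi> (x + - ?h))"
      by (intro L2_prod_integrable L2_shift w \<phi>L)+
    have "(\<integral>x. (2 ^ n * sd ?h w x) * \<phi> x \<partial>lborel) = 2 ^ n * ((\<integral>x. w (x + ?h) * \<phi> x \<partial>lborel) - (\<integral>x. w x * \<phi> x \<partial>lborel))"
    proof -
      have "(2 ^ n * sd ?h w x) * \<phi> x = 2 ^ n * (w (x + ?h) * \<phi> x - w x * \<phi> x)" for x
        by (simp add: sd_def algebra_simps)
      then show ?thesis using i(1,2) by (simp only: integral_mult_right_zero Bochner_Integration.integral_diff)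
    qed
    also have "(\<integral>x. w (x + ?h) * \<phi> x \<partial>lborel) = (\<integral>x. w x * \<phi> (x + - ?h) \<partial>lborel)"
      using integral_lborel_shift[of "\<lambda>x. w x * \<phi> (x + - ?h)" ?h] by simp
    also have "2 ^ n * ((\<integral>x. w x * \<phi> (x + - ?h) \<partial>lborel) - (\<integral>x. w x * \<phi> x \<partial>lborel)) = (\<integral>x. w x * q n x \<partial>lborel)"
    proof -
      have "w x * q n x = 2 ^ n * (w x * \<phi> (x + - ?h) - w x * \<phi> x)" for x
        by (simp add: q_def algebra_simps)
      then show ?thesis using i(2,3) by (simp only: integral_mult_right_zero Bochner_Integration.integral_diff)
    qed
    finally show ?thesis .
  qed
  have "(\<lambda>n. \<integral>x. w x * q n x \<partial>lborel) \<longlonglongrightarrow> (\<integral>x. w x * (- frechet_derivative \<phi> (at x) b) \<partial>lborel)"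
  proof (rule integral_dominated_convergence[where w = "\<lambda>x. \<bar>w x * (L * indicat_real (cball 0 (R + 1)) x)\<bar>"])
    show "integrable lborel (\<lambda>x. \<bar>w x * (L * indicat_real (cball 0 (R + 1)) x)\<bar>)"
    proof (intro integrable_abs L2_prod_integrable[OF w] L2_cmult)
      show "indicat_real (cball (0::'a) (R + 1)) \<in> L2"
      proof (rule L2I)
        have "(\<integral>\<^sup>+x. ennreal ((indicat_real (cball 0 (R + 1)) (x::'a))\<^sup>2) \<partial>lborel) = emeasure lborel (cball (0::'a) (R + 1))"
        proof -
          have "ennreal ((indicat_real (cball 0 (R + 1)) x)\<^sup>2) = indicator (cball 0 (R + 1)) x" for x :: 'a
            by (simp split: split_indicator)
          then show ?thesis by (simp only: nn_integral_indicator borel_closed[OF closed_cball] sets_lborel)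
        qed
        then show "(\<integral>\<^sup>+x. ennreal ((indicat_real (cball 0 (R + 1)) (x::'a))\<^sup>2) \<partial>lborel) < \<infinity>"
          using emeasure_lborel_cball_finite by simp
      qed (auto intro!: borel_measurable_indicator)
    qed
    show "AE x in lborel. (\<lambda>n. w x * q n x) \<longlonglongrightarrow> w x * (- frechet_derivative \<phi> (at x) b)"
    proof (intro AE_I2 tendsto_mult tendsto_const)
      fix x
      have "((\<lambda>t. (\<phi> (x + (0 + t) *\<^sub>R b) - \<phi> (x + 0 *\<^sub>R b)) / t) \<longlongrightarrow> frechet_derivative \<phi> (at (x + 0 *\<^sub>R b)) b) (at 0)"
        using test_line_derivative[OF \<phi>, of x b 0] by (simp add: DERIV_def)
      then have 1: "((\<lambda>t. (\<phi> (x + t *\<^sub>R b) - \<phi> x) / t) \<longlongrightarrow> frechet_derivative \<phi> (at x) b) (at 0)" by simp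
      have 2: "filterlim (\<lambda>n::nat. - ((1/2::real) ^ n)) (at 0) sequentially"
        unfolding filterlim_at
      proof
        have "(\<lambda>n::nat. - ((1/2::real) ^ n)) \<longlonglongrightarrow> - 0"
          by (intro tendsto_intros LIMSEQ_power_zero) auto
        then show "(\<lambda>n::nat. - ((1/2::real) ^ n)) \<longlonglongrightarrow> 0" by simp
      qed auto
      have "(\<lambda>n. - ((\<phi> (x + (- ((1/2) ^ n)) *\<^sub>R b) - \<phi> x) / (- ((1/2) ^ n)))) \<longlonglongrightarrow> - frechet_derivative \<phi> (at x) b"
        by (intro tendsto_minus filterlim_compose[OF 1 2])
      moreover have "- ((\<phi> (x + (- ((1/2) ^ n)) *\<^sub>R b) - \<phi> x) / (- ((1/2) ^ n))) = q n x" for n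
        by (simp add: q_def power_divide)
      ultimately show "(\<lambda>n. q n x) \<longlonglongrightarrow> - frechet_derivative \<phi> (at x) b" by simp
    qed
    show "AE x in lborel. norm (w x * q n x) \<le> \<bar>w x * (L * indicat_real (cball 0 (R + 1)) x)\<bar>" for n
    proof (rule AE_I2)
      fix x
      let ?h = "(- ((1/2) ^ n)) *\<^sub>R b"
      have nh: "norm ?h = (1/2) ^ n" using b by simp
      have h1: "norm ?h \<le> 1" unfolding nh by (rule power_le_one) auto
      have "\<bar>q n x\<bar> \<le> L * indicat_real (cball 0 (R + 1)) x"
      proof (cases "norm x \<le> R + 1")
        case True
        have "\<bar>q n x\<bar> \<le> 2 ^ n * (L * norm (x + ?h - x))"
          unfolding q_def abs_mult by (intro mult_mono L(2)) auto
        also have "\<dots> = L" using nh by (simp add: power_divide)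
        finally show ?thesis using True by simp
      next
        case False
        have "norm x \<le> norm (x + ?h) + norm ?h"
          using norm_triangle_ineq4[of "x + ?h" ?h] by simp
        then have "R < norm x" "R < norm (x + ?h)" using False h1 by auto
        then have "q n x = 0" unfolding q_def using R(2) by simp
        then show ?thesis using L(1) by simp
      qed
      then show "norm (w x * q n x) \<le> \<bar>w x * (L * indicat_real (cball 0 (R + 1)) x)\<bar>"
        unfolding real_norm_def abs_mult by (intro mult_left_mono) (use L(1) in auto)
    qed
    show "(\<lambda>x. w x * q n x) \<in> borel_measurable lborel" for n
      unfolding q_def by measurable
  qed measurable
  then show ?thesis unfolding eq by simp
qed

text \<open>The n-th quotient has an increment of length 2^(-n), and its Gaussian bound at t is
  available once 4^(-n) \<le> t; hence the restricted hypothesis on the majorant P. In place of a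
  weak limit of the quotients, a strong limit of elements of midpoint-convex sets around them
  inherits both the bound and the pairings with test functions.\<close>

lemma weak_derivative_exists:
  fixes w :: "'a::euclidean_space \<Rightarrow> real"
  assumes w: "w \<in> L2" and b: "b \<in> Basis" and C: "\<And>h. modulus w h \<le> C * (norm h)\<^sup>2"
    and P: "\<And>n t. 0 < t \<Longrightarrow> (1/4) ^ n \<le> t \<Longrightarrow> ennreal (psi (\<lambda>x. 2 ^ n * sd ((1/2) ^ n *\<^sub>R b) w x) t) \<le> P t"
  obtains g where "g \<in> L2"
    "\<And>\<phi>. \<phi> \<in> test_functions UNIV \<Longrightarrow> (\<integral>x. w x * frechet_derivative \<phi> (at x) b \<partial>lborel) = - (\<integral>x. g x * \<phi> x \<partial>lborel)"
    "\<And>t. 0 < t \<Longrightarrow> ennreal (psi g t) \<le> 2 * P t"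
proof -
  define v where "v n = (\<lambda>x. 2 ^ n * sd ((1/2) ^ n *\<^sub>R b) w x)" for n :: nat
  define lf where "lf \<phi> = - (\<integral>x. w x * frechet_derivative \<phi> (at x) b \<partial>lborel)" for \<phi> :: "'a \<Rightarrow> real"
  have vL: "v n \<in> L2" for n unfolding v_def by (intro L2_cmult sd_L2 w)
  have vlim: "(\<lambda>n. \<integral>x. v n x * \<phi> x \<partial>lborel) \<longlonglongrightarrow> lf \<phi>" if "\<phi> \<in> test_functions UNIV" for \<phi>
    unfolding v_def lf_def by (rule difference_quotient_test_tendsto[OF w that b])
  have vC: "sqnorm (v n) \<le> C" for n
  proof -
    have "sqnorm (v n) = (2 ^ n)\<^sup>2 * modulus w ((1/2) ^ n *\<^sub>R b)"
      by (simp add: v_def sqnorm_cmult modulus_def)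
    also have "\<dots> \<le> (2 ^ n)\<^sup>2 * (C * (norm ((1/2) ^ n *\<^sub>R b))\<^sup>2)"
      by (intro mult_left_mono C) auto
    also have "\<dots> = C" using b by (simp add: power_divide)
    finally show ?thesis .
  qed
  \<comment> \<open>\<open>T n\<close> plays the role of a convex hull of the quotients from index n
    on. Convergence of the pairings is encoded by asking that every error bound valid for all these
    quotients holds for f too, a condition that survives midpoints and tightens as n grows.\<close>
  define T where "T n = {f \<in> L2. (\<forall>t. 0 < t \<longrightarrow> (1/4) ^ n \<le> t \<longrightarrow> ennreal (psi f t) \<le> P t) \<and>
    (\<forall>\<phi>\<in>test_functions UNIV. \<forall>e. (\<forall>j\<ge>n. \<bar>(\<integral>x. v j x * \<phi> x \<partial>lborel) - lf \<phi>\<bar> \<le> e) \<longrightarrow> \<bar>(\<integral>x. f x * \<phi> x \<partial>lborel) - lf \<phi>\<bar> \<le> e)}" for n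
  have mid: "(\<lambda>x. (f x + g x) / 2) \<in> T n" if f: "f \<in> T n" and g: "g \<in> T n" for n f g
  proof -
    have fL: "f \<in> L2" and gL: "g \<in> L2" using f g by (auto simp: T_def)
    have h: "(\<lambda>x. (f x + g x) / 2) = (\<lambda>x. (1/2) * f x + (1/2) * g x)" by (auto simp: add_divide_distrib)
    have "(\<lambda>x. (f x + g x) / 2) \<in> L2" unfolding h by (intro L2_add L2_cmult fL gL)
    moreover have "ennreal (psi (\<lambda>x. (f x + g x) / 2) t) \<le> P t" if t: "0 < t" "(1/4) ^ n \<le> t" for t
    proof -
      \<comment> \<open>The factors 2 of \<open>psi_add_le\<close> meet the squares of the factors
        1/2, so midpoints keep the bound P without loss.\<close>
      have "psi (\<lambda>x. (f x + g x) / 2) t \<le> (psi f t + psi g t) / 2"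
        unfolding h using psi_add_le[OF t(1) L2_cmult[OF fL, of "1/2"] L2_cmult[OF gL, of "1/2"]]
        by (simp only: psi_cmult power_divide) simp
      also have "\<dots> \<le> max (psi f t) (psi g t)" by simp
      finally have "ennreal (psi (\<lambda>x. (f x + g x) / 2) t) \<le> ennreal (max (psi f t) (psi g t))" by (rule ennreal_leI)
      also have "\<dots> \<le> P t" using f g t by (auto simp: T_def max_def)
      finally show ?thesis .
    qed
    moreover have "\<bar>(\<integral>x. (f x + g x) / 2 * \<phi> x \<partial>lborel) - lf \<phi>\<bar> \<le> e"
      if \<phi>: "\<phi> \<in> test_functions UNIV" and e: "\<forall>j\<ge>n. \<bar>(\<integral>x. v j x * \<phi> x \<partial>lborel) - lf \<phi>\<bar> \<le> e" for \<phi> e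
    proof -
      have i: "integrable lborel (\<lambda>x. f x * \<phi> x)" "integrable lborel (\<lambda>x. g x * \<phi> x)"
        by (intro L2_prod_integrable fL gL test_L2[OF \<phi>])+
      have "(\<integral>x. (f x + g x) / 2 * \<phi> x \<partial>lborel) = (\<integral>x. (f x * \<phi> x) / 2 + (g x * \<phi> x) / 2 \<partial>lborel)"
        by (intro Bochner_Integration.integral_cong) (auto simp: field_simps)
      also have "\<dots> = (\<integral>x. f x * \<phi> x \<partial>lborel) / 2 + (\<integral>x. g x * \<phi> x \<partial>lborel) / 2"
        using i by simp
      finally have eq: "(\<integral>x. (f x + g x) / 2 * \<phi> x \<partial>lborel) = (\<integral>x. f x * \<phi> x \<partial>lborel) / 2 + (\<integral>x. g x * \<phi> x \<partial>lborel) / 2" .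
      have "\<bar>(\<integral>x. f x * \<phi> x \<partial>lborel) - lf \<phi>\<bar> \<le> e" "\<bar>(\<integral>x. g x * \<phi> x \<partial>lborel) - lf \<phi>\<bar> \<le> e"
        using f g \<phi> e by (auto simp: T_def)
      then show ?thesis unfolding eq abs_le_iff by linarith
    qed
    ultimately show ?thesis by (simp add: T_def)
  qed
  have dec: "T (Suc n) \<subseteq> T n" for n
  proof
    fix f assume f: "f \<in> T (Suc n)"
    have "(1/4::real) ^ Suc n \<le> (1/4) ^ n" by (rule power_decreasing) auto
    then show "f \<in> T n" using f unfolding T_def by fastforce
  qed
  have vT: "v n \<in> T n" for n
    using vL P unfolding T_def v_def by auto
  obtain f g where f: "\<And>n. f n \<in> T n" and g: "g \<in> L2" and lim: "(\<lambda>n. sqnorm (\<lambda>x. f n x - g x)) \<longlonglongrightarrow> 0"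
    by (rule convex_sets_limit[of T v C]) (use mid dec vT vC in \<open>auto simp: T_def\<close>)
  have fL: "f n \<in> L2" for n using f by (auto simp: T_def)
  show ?thesis
  proof (rule that[OF g])
    fix \<phi> :: "'a \<Rightarrow> real" assume \<phi>: "\<phi> \<in> test_functions UNIV"
    have "(\<lambda>n. \<integral>x. f n x * \<phi> x \<partial>lborel) \<longlonglongrightarrow> lf \<phi>"
    proof (rule LIMSEQ_I)
      fix e :: real assume e: "0 < e"
      then obtain N where N: "\<forall>j\<ge>N. norm ((\<integral>x. v j x * \<phi> x \<partial>lborel) - lf \<phi>) < e / 2"
        using LIMSEQ_D[OF vlim[OF \<phi>], of "e / 2"] by auto
      have "norm ((\<integral>x. f n x * \<phi> x \<partial>lborel) - lf \<phi>) < e" if "N \<le> n" for n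
      proof -
        have "\<forall>j\<ge>n. \<bar>(\<integral>x. v j x * \<phi> x \<partial>lborel) - lf \<phi>\<bar> \<le> e / 2"
          using N that by (metis less_imp_le order_trans real_norm_def)
        then have "\<bar>(\<integral>x. f n x * \<phi> x \<partial>lborel) - lf \<phi>\<bar> \<le> e / 2"
          using f[of n] \<phi> unfolding T_def by blast
        then show ?thesis using e unfolding real_norm_def by linarith
      qed
      then show "\<exists>N. \<forall>n\<ge>N. norm ((\<integral>x. f n x * \<phi> x \<partial>lborel) - lf \<phi>) < e"
        by blast
    qed
    moreover have "(\<lambda>n. \<integral>x. f n x * \<phi> x \<partial>lborel) \<longlonglongrightarrow> (\<integral>x. g x * \<phi> x \<partial>lborel)"
      by (rule L2_inner_tendsto[OF fL g test_L2[OF \<phi>] lim])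
    ultimately have "lf \<phi> = (\<integral>x. g x * \<phi> x \<partial>lborel)" by (rule LIMSEQ_unique)
    then show "(\<integral>x. w x * frechet_derivative \<phi> (at x) b \<partial>lborel) = - (\<integral>x. g x * \<phi> x \<partial>lborel)"
      by (simp add: lf_def)
  next
    fix t :: real assume t: "0 < t"
    show "ennreal (psi g t) \<le> 2 * P t"
    proof (rule ennreal_le_epsilon)
      fix e :: real assume e: "0 < e"
      have "(\<lambda>n. (1/4::real) ^ n) \<longlonglongrightarrow> 0" by (rule LIMSEQ_power_zero) simp
      then have "\<forall>\<^sub>F n in sequentially. (1/4) ^ n < t" using t by (rule order_tendstoD(2))
      moreover have "\<forall>\<^sub>F n in sequentially. sqnorm (\<lambda>x. f n x - g x) < e / 2"
        using lim e by (intro order_tendstoD(2)) auto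
      ultimately have "\<forall>\<^sub>F n in sequentially. (1/4) ^ n < t \<and> sqnorm (\<lambda>x. f n x - g x) < e / 2"
        by (rule eventually_conj)
      then obtain n where n: "(1/4) ^ n < t" "sqnorm (\<lambda>x. f n x - g x) < e / 2"
        by (auto simp: eventually_sequentially)
      \<comment> \<open>Writing g as f n minus the error costs the factor 2 of the conclusion; the
        error itself enters through \<open>psi_le\<close>.\<close>
      have "psi (\<lambda>x. f n x + (-1) * (f n x - g x)) t \<le> 2 * psi (f n) t + 2 * psi (\<lambda>x. (-1) * (f n x - g x)) t"
        by (intro psi_add_le t fL L2_cmult L2_diff g)
      then have "psi g t \<le> 2 * psi (f n) t + 2 * psi (\<lambda>x. f n x - g x) t"
        by (simp only: psi_cmult) simp
      also have "psi (\<lambda>x. f n x - g x) t \<le> sqnorm (\<lambda>x. f n x - g x)"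
        by (intro psi_le t L2_diff fL g)
      finally have "psi g t \<le> 2 * psi (f n) t + e" using n(2) by simp
      then have "ennreal (psi g t) \<le> ennreal (2 * psi (f n) t + e)" by (rule ennreal_leI)
      also have "\<dots> = 2 * ennreal (psi (f n) t) + ennreal e"
        using e by (simp add: psi_nonneg ennreal_mult)
      also have "\<dots> \<le> 2 * P t + ennreal e"
        using f[of n] t n(1) by (intro add_right_mono mult_left_mono) (auto simp: T_def)
      finally show "ennreal (psi g t) \<le> 2 * P t + ennreal e" .
    qed
  qed
qed

section \<open>The energy space on the whole space\<close>

text \<open>Up to constants it dominates the squared first differences and the second differences of
  a test function, and it is integrable against \<open>kern s\<close> for 0 < s < 1.\<close>

definition theta :: "'a::euclidean_space \<Rightarrow> real" where
  "theta h = min ((norm h)\<^sup>2) 1"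

lemma theta_measurable [measurable]: "theta \<in> borel_measurable borel"
  unfolding theta_def[abs_def] by measurable

lemma theta_nonneg [simp]: "0 \<le> theta h"
  by (simp add: theta_def)

lemma theta_uminus [simp]: "theta (- h) = theta h"
  by (simp add: theta_def)

text \<open>Half of the Gaussian exponent pays for the factor |h|^2: with x = |h|^2/t, the
  inequality x exp(-x) \<le> 2 exp(-x/2) leaves a Gaussian of parameter 2t, whose normalisation
  contributes 2^(N/2).\<close>

lemma heat_theta_le:
  fixes t :: real
  assumes t: "0 < t"
  shows "(\<integral>\<^sup>+h. ennreal (theta (h::'a::euclidean_space)) \<partial>heat t) \<le> ennreal (min 1 (2 * 2 powr (real DIM('a) / 2) * t))"
proof -
  let ?M = "2 * 2 powr (real DIM('a) / 2)"
  interpret prob_space "heat t :: 'a measure" using t by (rule prob_space_heat)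
  have "(\<integral>\<^sup>+h. ennreal (theta (h::'a)) \<partial>heat t) \<le> (\<integral>\<^sup>+h. 1 \<partial>(heat t :: 'a measure))"
    by (intro nn_integral_mono) (auto simp: theta_def simp flip: ennreal_1 intro!: ennreal_leI)
  also have "\<dots> = 1" using emeasure_space_1 by simp
  finally have 1: "(\<integral>\<^sup>+h. ennreal (theta (h::'a)) \<partial>heat t) \<le> ennreal 1" by simp
  have pt: "gauss t h * theta h \<le> ?M * t * gauss (2 * t) h" for h :: 'a
  proof -
    define x where "x = (norm h)\<^sup>2 / t"
    have x: "0 \<le> x" using t by (simp add: x_def)
    have "x / 2 \<le> exp (x / 2)" using exp_ge_add_one_self[of "x / 2"] by linarith
    then have "x / 2 * exp (- x) \<le> exp (x / 2) * exp (- x)" by (intro mult_right_mono) auto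
    also have "exp (x / 2) * exp (- x) = exp (- (x / 2))" by (simp add: mult_exp_exp)
    finally have e: "x * exp (- x) \<le> 2 * exp (- (x / 2))" by simp
    define g where "g = gauss_mass TYPE('a) * t powr (real DIM('a) / 2)"
    have g: "0 < g" using t gauss_mass_pos[where 'a='a] by (simp add: g_def)
    have g1: "gauss t h = exp (- x) / g" by (simp add: gauss_def g_def x_def)
    have g2: "2 powr (real DIM('a) / 2) * gauss (2 * t) h = exp (- (x / 2)) / g"
      using t by (simp add: gauss_def g_def x_def powr_mult)
    have "gauss t h * theta h \<le> gauss t h * (norm h)\<^sup>2" by (intro mult_left_mono) (auto simp: theta_def)
    also have "\<dots> = t * (x * exp (- x)) / g" using t by (simp add: g1 x_def)
    also have "\<dots> \<le> t * (2 * exp (- (x / 2))) / g" using t g e by (intro divide_right_mono mult_left_mono) auto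
    also have "\<dots> = 2 * t * (2 powr (real DIM('a) / 2) * gauss (2 * t) h)" unfolding g2 by simp
    finally show ?thesis by (simp add: mult_ac)
  qed
  have "(\<integral>\<^sup>+h. ennreal (theta (h::'a)) \<partial>heat t) = (\<integral>\<^sup>+h. ennreal (gauss t h * theta (h::'a)) \<partial>lborel)"
    by (simp add: nn_integral_heat ennreal_mult)
  also have "\<dots> \<le> (\<integral>\<^sup>+h. ennreal (?M * t) * ennreal (gauss (2 * t) (h::'a)) \<partial>lborel)"
    using pt t by (intro nn_integral_mono) (simp add: ennreal_mult[symmetric] ennreal_leI)
  also have "\<dots> = ennreal (?M * t)"
    using t by (simp add: nn_integral_cmult nn_integral_gauss)
  finally show ?thesis using 1 by (auto simp: min_def)
qed

text \<open>In the Gaussian mixture the average of \<open>theta\<close> is at most a multiple of t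
  for t \<le> 1, leaving t^(-s), integrable at 0 since s < 1; beyond 1 it is at most 1, leaving
  t^(-1-s), integrable at infinity since s > 0.\<close>

lemma kern_theta_finite:
  assumes s: "0 < s" "s < 1"
  shows "(\<integral>\<^sup>+h. ennreal (kern s (h::'a::euclidean_space)) * ennreal (theta h) \<partial>lborel) < \<infinity>"
proof -
  let ?M = "2 * 2 powr (real DIM('a) / 2)"
  obtain C where C: "0 < C" "\<And>f :: 'a \<Rightarrow> ennreal. f \<in> borel_measurable borel \<Longrightarrow>
    ennreal C * (\<integral>\<^sup>+h. ennreal (kern s h) * f h \<partial>lborel) = (\<integral>\<^sup>+t. pw (-1 - s) t * (\<integral>\<^sup>+h. f h \<partial>heat t) \<partial>lborel)"
    using nn_integral_kern_mixture[OF s(1)] by blast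
  have "ennreal C * (\<integral>\<^sup>+h. ennreal (kern s (h::'a)) * ennreal (theta h) \<partial>lborel)
     = (\<integral>\<^sup>+t. pw (-1 - s) t * (\<integral>\<^sup>+h. ennreal (theta (h::'a)) \<partial>heat t) \<partial>lborel)"
    by (rule C(2)) measurable
  also have "\<dots> \<le> (\<integral>\<^sup>+t. ennreal ?M * (pw (- s) t * indicator {..1} t) + pw (-1 - s) t * indicator {1..} t \<partial>lborel)"
  proof (rule nn_integral_mono)
    fix t :: real
    let ?I = "\<integral>\<^sup>+h. ennreal (theta (h::'a)) \<partial>heat t"
    consider "t \<le> 0" | "0 < t" "t \<le> 1" | "1 < t" by linarith
    then show "pw (-1 - s) t * ?I \<le> ennreal ?M * (pw (- s) t * indicator {..1} t) + pw (-1 - s) t * indicator {1..} t"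
    proof cases
      case 2
      have "pw (-1 - s) t * ?I \<le> pw (-1 - s) t * ennreal (?M * t)"
      proof (intro mult_left_mono)
        show "?I \<le> ennreal (?M * t)"
          by (rule order_trans[OF heat_theta_le[OF 2(1)]]) (intro ennreal_leI, simp)
      qed simp
      also have "\<dots> = ennreal ?M * pw (- s) t"
      proof -
        have "t powr (-1 - s) * t = t powr (- s)"
          using powr_add[of t "-1 - s" 1] 2(1) by simp
        then have "t powr (-1 - s) * (?M * t) = ?M * t powr (- s)"
          using mult.left_commute[of "t powr (-1 - s)" ?M t] by simp
        then show ?thesis using 2(1) by (simp add: pw_def ennreal_mult[symmetric])
      qed
      finally show ?thesis using 2 by (simp add: add_increasing2)
    next
      case 3
      have "pw (-1 - s) t * ?I \<le> pw (-1 - s) t * 1"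
      proof (intro mult_left_mono)
        have "?I \<le> ennreal 1"
          by (rule order_trans[OF heat_theta_le]) (use 3 in \<open>auto intro!: ennreal_leI\<close>)
        then show "?I \<le> 1" by simp
      qed simp
      then show ?thesis using 3 by simp
    qed (simp add: pw_def)
  qed
  also have "\<dots> = ennreal ?M * (\<integral>\<^sup>+t. pw (- s) t * indicator {..1} t \<partial>lborel) + (\<integral>\<^sup>+t. pw (-1 - s) t * indicator {1..} t \<partial>lborel)"
    by (subst nn_integral_add) (auto simp: nn_integral_cmult)
  also have "\<dots> < \<infinity>"
    using pw_head_finite[of "- s"] pw_tail_finite[OF s(1), of 1] s(2) by (simp add: ennreal_mult_less_top)
  finally show ?thesis using C(1) by (auto simp: ennreal_mult_less_top)
qed

section \<open>The fractional Sobolev space of Borel functions and its bilinear form\<close>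

definition Hs :: "real \<Rightarrow> ('a::euclidean_space \<Rightarrow> real) set" where
  "Hs s = {g \<in> L2. gag s g < \<infinity>}"

lemma Hs_L2: "g \<in> Hs s \<Longrightarrow> g \<in> L2"
  by (simp add: Hs_def)

lemma gag_double:
  assumes "g \<in> L2"
  shows "gag s g = (\<integral>\<^sup>+h. (\<integral>\<^sup>+x. ennreal (kern s h * (sd h g x)\<^sup>2) \<partial>lborel) \<partial>lborel)"
proof -
  have "ennreal (kern s h) * ennreal (modulus g h) = (\<integral>\<^sup>+x. ennreal (kern s h * (sd h g x)\<^sup>2) \<partial>lborel)" for h
  proof -
    have [measurable]: "sd h g \<in> borel_measurable borel" using sd_L2[OF assms] by auto
    show ?thesis
      unfolding modulus_def L2_nn_integral[OF sd_L2[OF assms], symmetric]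
      by (simp add: ennreal_mult nn_integral_cmult)
  qed
  then show ?thesis by (simp add: gag_def)
qed

lemma gag_double':
  assumes "g \<in> L2"
  shows "gag s g = (\<integral>\<^sup>+x. (\<integral>\<^sup>+h. ennreal (kern s h * (sd h g x)\<^sup>2) \<partial>lborel) \<partial>lborel)"
proof -
  have [measurable]: "g \<in> borel_measurable borel" using assms by auto
  show ?thesis
    unfolding gag_double[OF assms] sd_def by (rule lborel_pair.Fubini') measurable
qed

lemma Hs_integrable:
  assumes "g \<in> Hs s"
  shows "integrable (lborel \<Otimes>\<^sub>M lborel) (\<lambda>(h, x). kern s h * (sd h g x)\<^sup>2)"
proof (rule integrableI_bounded)
  have [measurable]: "g \<in> borel_measurable borel" using Hs_L2[OF assms] by auto
  show "(\<lambda>(h, x). kern s h * (sd h g x)\<^sup>2) \<in> borel_measurable (lborel \<Otimes>\<^sub>M lborel)"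
    unfolding sd_def by measurable
  have "(\<integral>\<^sup>+p. ennreal (norm (case p of (h, x) \<Rightarrow> kern s h * (sd h g x)\<^sup>2)) \<partial>(lborel \<Otimes>\<^sub>M lborel)) = gag s g"
    unfolding gag_double[OF Hs_L2[OF assms]] sd_def
    by (subst lborel.nn_integral_fst[symmetric]) auto
  then show "(\<integral>\<^sup>+p. ennreal (norm (case p of (h, x) \<Rightarrow> kern s h * (sd h g x)\<^sup>2)) \<partial>(lborel \<Otimes>\<^sub>M lborel)) < \<infinity>"
    using assms by (simp add: Hs_def)
qed

lemma gag_mono2:
  assumes "\<And>h. modulus f h \<le> A * modulus g h" "0 \<le> A" "g \<in> L2"
  shows "gag s f \<le> ennreal A * gag s g"
proof -
  have [measurable]: "modulus g \<in> borel_measurable borel" using assms(3) by auto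
  have "gag s f \<le> (\<integral>\<^sup>+h. ennreal A * (ennreal (kern s h) * ennreal (modulus g h)) \<partial>lborel)"
    unfolding gag_def
  proof (rule nn_integral_mono)
    fix h
    have "kern s h * modulus f h \<le> A * (kern s h * modulus g h)"
      using mult_left_mono[OF assms(1)[of h], of "kern s h"] by (simp add: mult_ac)
    then show "ennreal (kern s h) * ennreal (modulus f h) \<le> ennreal A * (ennreal (kern s h) * ennreal (modulus g h))"
      using assms(2) by (simp add: ennreal_mult[symmetric] modulus_nonneg ennreal_leI)
  qed
  also have "\<dots> = ennreal A * gag s g"
    unfolding gag_def by (rule nn_integral_cmult) measurable
  finally show ?thesis .
qed

lemma Hs_add:
  assumes f: "f \<in> Hs s" and g: "g \<in> Hs s"
  shows "(\<lambda>x. f x + g x) \<in> Hs s"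
proof -
  have fL: "f \<in> L2" and gL: "g \<in> L2" using f g by (auto simp: Hs_def)
  have [measurable]: "modulus f \<in> borel_measurable borel" "modulus g \<in> borel_measurable borel" using fL gL by auto
  have "gag s (\<lambda>x. f x + g x) \<le> (\<integral>\<^sup>+h. 2 * (ennreal (kern s h) * ennreal (modulus f h)) + 2 * (ennreal (kern s h) * ennreal (modulus g h)) \<partial>lborel)"
    unfolding gag_def
  proof (rule nn_integral_mono)
    fix h
    have "ennreal (modulus (\<lambda>x. f x + g x) h) \<le> ennreal (2 * modulus f h + 2 * modulus g h)"
      by (intro ennreal_leI modulus_add_le fL gL)
    also have "\<dots> = 2 * ennreal (modulus f h) + 2 * ennreal (modulus g h)"
      by (simp add: modulus_nonneg ennreal_mult)
    finally have "ennreal (kern s h) * ennreal (modulus (\<lambda>x. f x + g x) h) \<le> ennreal (kern s h) * (2 * ennreal (modulus f h) + 2 * ennreal (modulus g h))"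
      by (intro mult_left_mono) auto
    then show "ennreal (kern s h) * ennreal (modulus (\<lambda>x. f x + g x) h) \<le> 2 * (ennreal (kern s h) * ennreal (modulus f h)) + 2 * (ennreal (kern s h) * ennreal (modulus g h))"
      by (simp add: distrib_left mult.left_commute)
  qed
  also have "\<dots> = 2 * gag s f + 2 * gag s g"
    unfolding gag_def by (subst nn_integral_add) (auto simp: nn_integral_cmult)
  also have "\<dots> < \<infinity>" using f g by (simp add: Hs_def ennreal_mult_less_top)
  finally show ?thesis using L2_add[OF fL gL] by (simp add: Hs_def)
qed

lemma Hs_cmult:
  assumes "g \<in> Hs s"
  shows "(\<lambda>x. c * g x) \<in> Hs s"
proof -
  have "gag s (\<lambda>x. c * g x) \<le> ennreal (c\<^sup>2) * gag s g"
    using assms by (intro gag_mono2) (auto simp: modulus_cmult Hs_def)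
  also have "\<dots> < \<infinity>" using assms by (simp add: Hs_def ennreal_mult_less_top)
  finally show ?thesis using assms by (simp add: Hs_def L2_cmult)
qed

lemma Hs_shift: "g \<in> Hs s \<Longrightarrow> (\<lambda>x. g (x + h)) \<in> Hs s"
  by (simp add: Hs_def L2_shift gag_def modulus_shift)

lemma modulus_sd_le:
  assumes "g \<in> L2"
  shows "modulus (sd h g) k \<le> 4 * modulus g k"
proof -
  have "sd h g = (\<lambda>x. g (x + h) + (-1) * g x)" by (auto simp: sd_def)
  then show ?thesis
    using modulus_add_le[OF L2_shift[OF assms, of h] L2_cmult[OF assms, of "-1"], of k]
    by (simp only: modulus_shift[OF assms] modulus_cmult) simp
qed

lemma gag_sd_finite:
  assumes "g \<in> Hs s"
  shows "gag s (sd h g) < \<infinity>"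
proof -
  have "gag s (sd h g) \<le> ennreal 4 * gag s g"
    using assms by (intro gag_mono2 modulus_sd_le) (auto simp: Hs_def)
  also have "\<dots> < \<infinity>" using assms by (simp add: Hs_def ennreal_mult_less_top)
  finally show ?thesis .
qed

text \<open>The energy without its constant, in the variables h = y - x and x, as one integral over
  the product measure. On \<open>Hs s\<close> it converges absolutely, so both orders of iteration
  are available.\<close>

definition form :: "real \<Rightarrow> ('a::euclidean_space \<Rightarrow> real) \<Rightarrow> ('a \<Rightarrow> real) \<Rightarrow> real" where
  "form s u v = (\<integral>p. kern s (fst p) * (sd (fst p) u (snd p) * sd (fst p) v (snd p)) \<partial>(lborel \<Otimes>\<^sub>M lborel))"

lemma form_integrable:
  assumes "u \<in> Hs s" "v \<in> Hs s"
  shows "integrable (lborel \<Otimes>\<^sub>M lborel) (\<lambda>(h, x). kern s h * (sd h u x * sd h v x))"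
proof (rule Bochner_Integration.integrable_bound)
  have [measurable]: "u \<in> borel_measurable borel" "v \<in> borel_measurable borel"
    using assms by (auto dest: Hs_L2)
  show "integrable (lborel \<Otimes>\<^sub>M lborel) (\<lambda>p. (case p of (h, x) \<Rightarrow> kern s h * (sd h u x)\<^sup>2) + (case p of (h, x) \<Rightarrow> kern s h * (sd h v x)\<^sup>2))"
    using assms by (intro Bochner_Integration.integrable_add Hs_integrable)
  show "(\<lambda>(h, x). kern s h * (sd h u x * sd h v x)) \<in> borel_measurable (lborel \<Otimes>\<^sub>M lborel)"
    unfolding sd_def by measurable
  show "AE p in lborel \<Otimes>\<^sub>M lborel. norm (case p of (h, x) \<Rightarrow> kern s h * (sd h u x * sd h v x))
      \<le> norm ((case p of (h, x) \<Rightarrow> kern s h * (sd h u x)\<^sup>2) + (case p of (h, x) \<Rightarrow> kern s h * (sd h v x)\<^sup>2))"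
  proof (rule AE_I2, clarify)
    fix h x :: 'a
    have "2 * \<bar>sd h u x\<bar> * \<bar>sd h v x\<bar> \<le> \<bar>sd h u x\<bar>\<^sup>2 + \<bar>sd h v x\<bar>\<^sup>2" by (rule sum_squares_bound)
    moreover have "0 \<le> \<bar>sd h u x\<bar> * \<bar>sd h v x\<bar>" by simp
    ultimately have "\<bar>sd h u x\<bar> * \<bar>sd h v x\<bar> \<le> (sd h u x)\<^sup>2 + (sd h v x)\<^sup>2" unfolding power2_abs by linarith
    then have "kern s h * (\<bar>sd h u x\<bar> * \<bar>sd h v x\<bar>) \<le> kern s h * ((sd h u x)\<^sup>2 + (sd h v x)\<^sup>2)" by (intro mult_left_mono) auto
    then show "norm (kern s h * (sd h u x * sd h v x)) \<le> norm (kern s h * (sd h u x)\<^sup>2 + kern s h * (sd h v x)\<^sup>2)"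
      by (simp add: abs_mult distrib_left)
  qed
qed

lemma form_iterated:
  assumes "u \<in> Hs s" "v \<in> Hs s"
  shows "form s u v = (\<integral>h. kern s h * (\<integral>x. sd h u x * sd h v x \<partial>lborel) \<partial>lborel)"
  using lborel_pair.integral_fst'[OF form_integrable[OF assms, unfolded case_prod_beta]]
  by (simp add: form_def)

lemma test_difference_bounds:
  assumes "\<eta> \<in> test_functions \<Omega>"
  obtains A where "0 \<le> A" "\<And>h x. (sd h \<eta> x)\<^sup>2 \<le> A * theta h" "\<And>h x. \<bar>2 * \<eta> x - \<eta> (x + h) - \<eta> (x - h)\<bar> \<le> A * theta h"
proof -
  obtain B where B: "0 \<le> B" "\<And>x. \<bar>\<eta> x\<bar> \<le> B" using test_bounded[OF assms] by blast
  obtain L where L: "0 \<le> L" "\<And>x y. \<bar>\<eta> x - \<eta> y\<bar> \<le> L * norm (x - y)" using test_lipschitz[OF assms] by blast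
  obtain M where M: "0 \<le> M" "\<And>x h. \<bar>2 * \<eta> x - \<eta> (x + h) - \<eta> (x - h)\<bar> \<le> M * (norm h)\<^sup>2" using test_second_difference[OF assms] by blast
  \<comment> \<open>One constant above all four bounds: the quadratic ones serve for |h| \<le> 1,
    the constant ones for |h| > 1.\<close>
  define A where "A = (2 * B)\<^sup>2 + L\<^sup>2 + M + 4 * B"
  have A: "(2 * B)\<^sup>2 \<le> A" "L\<^sup>2 \<le> A" "M \<le> A" "4 * B \<le> A" "0 \<le> A" using B(1) M(1) by (auto simp: A_def)
  have *: "a \<le> A * theta h" if "a \<le> c1 * (norm h)\<^sup>2" "a \<le> c2" "c1 \<le> A" "c2 \<le> A" for a c1 c2 and h :: 'a
  proof (cases "(norm h)\<^sup>2 \<le> 1")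
    case True
    have "a \<le> A * (norm h)\<^sup>2" using that(1) mult_right_mono[OF that(3), of "(norm h)\<^sup>2"] by simp
    then show ?thesis using True by (simp add: theta_def)
  next
    case False
    then show ?thesis using that by (simp add: theta_def)
  qed
  show ?thesis
  proof (rule that[OF A(5)])
    fix h x :: 'a
    show "(sd h \<eta> x)\<^sup>2 \<le> A * theta h"
    proof (rule *[OF _ _ A(2) A(1)])
      have "\<bar>sd h \<eta> x\<bar> \<le> L * norm h" unfolding sd_def using L(2)[of "x + h" x] by simp
      from power_mono[OF this, of 2] show "(sd h \<eta> x)\<^sup>2 \<le> L\<^sup>2 * (norm h)\<^sup>2" by (simp add: power_mult_distrib)
      have "\<bar>sd h \<eta> x\<bar> \<le> 2 * B" unfolding sd_def using B(2)[of "x + h"] B(2)[of x] by linarith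
      from power_mono[OF this, of 2] show "(sd h \<eta> x)\<^sup>2 \<le> (2 * B)\<^sup>2" by simp
    qed
    show "\<bar>2 * \<eta> x - \<eta> (x + h) - \<eta> (x - h)\<bar> \<le> A * theta h"
      by (rule *[OF M(2) _ A(3) A(4)]) (use B(2)[of x] B(2)[of "x + h"] B(2)[of "x - h"] in linarith)
  qed
qed

text \<open>Leibniz rule for differences: one term has an increment of v and a bounded factor, the
  other an increment of \<eta>, whose square is of size \<open>theta h\<close> and hence integrable
  against the kernel.\<close>

lemma Hs_test_mult:
  fixes v :: "'a::euclidean_space \<Rightarrow> real"
  assumes s: "0 < s" "s < 1" and \<eta>: "\<eta> \<in> test_functions \<Omega>" and v: "v \<in> Hs s"
  shows "(\<lambda>x. \<eta> x * v x) \<in> Hs s"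
proof -
  obtain B where B: "0 \<le> B" "\<And>x. \<bar>\<eta> x\<bar> \<le> B" using test_bounded[OF \<eta>] by blast
  obtain A where A: "0 \<le> A" "\<And>h x. (sd h \<eta> x)\<^sup>2 \<le> A * theta h"
    "\<And>h x. \<bar>2 * \<eta> x - \<eta> (x + h) - \<eta> (x - h)\<bar> \<le> A * theta h" using test_difference_bounds[OF \<eta>] by blast
  have vL: "v \<in> L2" by (rule Hs_L2[OF v])
  have [measurable]: "v \<in> borel_measurable borel" "\<eta> \<in> borel_measurable borel"
    using vL test_measurable[OF \<eta>] by auto
  have L: "(\<lambda>x. \<eta> x * v x) \<in> L2" by (rule L2_bounded_mult[OF vL _ B(2)]) measurable
  have bd: "modulus (\<lambda>x. \<eta> x * v x) h \<le> 2 * B\<^sup>2 * modulus v h + 2 * A * theta h * sqnorm v" for h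
  proof -
    have "sqnorm (sd h (\<lambda>x. \<eta> x * v x)) \<le> 2 * sqnorm (\<lambda>x. \<eta> (x + h) * sd h v x) + 2 * sqnorm (\<lambda>x. sd h \<eta> x * v x)"
    proof -
      have "sd h (\<lambda>x. \<eta> x * v x) = (\<lambda>x. \<eta> (x + h) * sd h v x + sd h \<eta> x * v x)"
        by (auto simp: sd_def algebra_simps)
      moreover have "(\<lambda>x. \<eta> (x + h) * sd h v x) \<in> L2"
        by (rule L2_bounded_mult[OF sd_L2[OF vL] _ B(2)]) measurable
      moreover have "(\<lambda>x. sd h \<eta> x * v x) \<in> L2"
      proof (rule L2_bounded_mult[OF vL])
        show "\<bar>sd h \<eta> x\<bar> \<le> 2 * B" for x unfolding sd_def using B(2)[of "x + h"] B(2)[of x] by linarith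
        show "sd h \<eta> \<in> borel_measurable borel" unfolding sd_def by measurable
      qed
      ultimately show ?thesis using sqnorm_add_le by simp
    qed
    moreover have "sqnorm (\<lambda>x. \<eta> (x + h) * sd h v x) \<le> (\<integral>x. B\<^sup>2 * (sd h v x)\<^sup>2 \<partial>lborel)"
      unfolding sqnorm_def
    proof (rule integral_mono)
      show "integrable lborel (\<lambda>x. (\<eta> (x + h) * sd h v x)\<^sup>2)"
        by (rule L2_integrable, rule L2_bounded_mult[OF sd_L2[OF vL] _ B(2)]) measurable
      show "integrable lborel (\<lambda>x. B\<^sup>2 * (sd h v x)\<^sup>2)" by (intro integrable_mult_right L2_integrable sd_L2 vL)
      show "(\<eta> (x + h) * sd h v x)\<^sup>2 \<le> B\<^sup>2 * (sd h v x)\<^sup>2" for x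
        unfolding power_mult_distrib using power_mono[OF B(2)[of "x + h"], of 2] by (intro mult_right_mono) auto
    qed
    moreover have "sqnorm (\<lambda>x. sd h \<eta> x * v x) \<le> (\<integral>x. A * theta h * (v x)\<^sup>2 \<partial>lborel)"
      unfolding sqnorm_def
    proof (rule integral_mono)
      show "integrable lborel (\<lambda>x. (sd h \<eta> x * v x)\<^sup>2)"
      proof (rule L2_integrable, rule L2_bounded_mult[OF vL])
        show "\<bar>sd h \<eta> x\<bar> \<le> 2 * B" for x unfolding sd_def using B(2)[of "x + h"] B(2)[of x] by linarith
        show "sd h \<eta> \<in> borel_measurable borel" unfolding sd_def by measurable
      qed
      show "integrable lborel (\<lambda>x. A * theta h * (v x)\<^sup>2)" by (intro integrable_mult_right L2_integrable vL)
      show "(sd h \<eta> x * v x)\<^sup>2 \<le> A * theta h * (v x)\<^sup>2" for x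
        unfolding power_mult_distrib using A(2) by (intro mult_right_mono) auto
    qed
    ultimately show ?thesis by (simp add: modulus_def sqnorm_def)
  qed
  have "gag s (\<lambda>x. \<eta> x * v x) \<le> (\<integral>\<^sup>+h. ennreal (2 * B\<^sup>2) * (ennreal (kern s h) * ennreal (modulus v h))
      + ennreal (2 * A * sqnorm v) * (ennreal (kern s h) * ennreal (theta h)) \<partial>lborel)"
    unfolding gag_def
  proof (rule nn_integral_mono)
    fix h :: 'a
    have "kern s h * modulus (\<lambda>x. \<eta> x * v x) h \<le> kern s h * (2 * B\<^sup>2 * modulus v h + 2 * A * theta h * sqnorm v)"
      by (intro mult_left_mono bd) simp
    also have "\<dots> = 2 * B\<^sup>2 * (kern s h * modulus v h) + 2 * A * sqnorm v * (kern s h * theta h)"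
      by (simp add: algebra_simps)
    finally have "ennreal (kern s h * modulus (\<lambda>x. \<eta> x * v x) h) \<le> ennreal (2 * B\<^sup>2 * (kern s h * modulus v h) + 2 * A * sqnorm v * (kern s h * theta h))"
      by (rule ennreal_leI)
    then show "ennreal (kern s h) * ennreal (modulus (\<lambda>x. \<eta> x * v x) h) \<le> ennreal (2 * B\<^sup>2) * (ennreal (kern s h) * ennreal (modulus v h))
      + ennreal (2 * A * sqnorm v) * (ennreal (kern s h) * ennreal (theta h))"
      using A(1) by (simp add: ennreal_mult modulus_nonneg sqnorm_nonneg)
  qed
  also have "\<dots> = ennreal (2 * B\<^sup>2) * gag s v + ennreal (2 * A * sqnorm v) * (\<integral>\<^sup>+h. ennreal (kern s (h::'a)) * ennreal (theta h) \<partial>lborel)"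
  proof -
    have [measurable]: "modulus v \<in> borel_measurable borel" using vL by auto
    show ?thesis unfolding gag_def by (subst nn_integral_add) (auto simp: nn_integral_cmult)
  qed
  also have "\<dots> < \<infinity>"
    using v kern_theta_finite[OF s, where 'a='a] by (simp add: Hs_def ennreal_mult_less_top)
  finally show ?thesis using L by (simp add: Hs_def)
qed

section \<open>Localisation\<close>

text \<open>Pairing the increments \<open>h\<close> and \<open>- h\<close> makes the commutator absolutely convergent, so that no
  principal value occurs.\<close>

lemma form_commutator:
  fixes u :: "'a::euclidean_space \<Rightarrow> real"
  assumes s: "0 < s" "s < 1" and \<eta>: "\<eta> \<in> test_functions \<Omega>" and u: "u \<in> Hs s"
  obtains G where "G \<in> L2"
    "\<And>v. v \<in> Hs s \<Longrightarrow> form s (\<lambda>x. \<eta> x * u x) v - form s u (\<lambda>x. \<eta> x * v x) = (\<integral>x. G x * v x \<partial>lborel)"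
proof -
  obtain B where B: "0 \<le> B" "\<And>x. \<bar>\<eta> x\<bar> \<le> B" using test_bounded[OF \<eta>] by blast
  obtain A where A: "0 \<le> A" "\<And>h x. (sd h \<eta> x)\<^sup>2 \<le> A * theta h"
    "\<And>h x. \<bar>2 * \<eta> x - \<eta> (x + h) - \<eta> (x - h)\<bar> \<le> A * theta h" using test_difference_bounds[OF \<eta>] by blast
  have uL: "u \<in> L2" by (rule Hs_L2[OF u])
  have um [measurable]: "u \<in> borel_measurable borel" and \<eta>m [measurable]: "\<eta> \<in> borel_measurable borel"
    using uL test_measurable[OF \<eta>] by auto
  \<comment> \<open>Each summand alone is in general only of first order in h near 0; in the sum,
    the multiples of u(x) combine to a second difference of \<eta>.\<close>
  define R where "R h x = (\<eta> x - \<eta> (x + h)) * u (x + h) + (\<eta> x - \<eta> (x - h)) * u (x - h)" for h x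
  have Rm [measurable]: "(\<lambda>(h, x). R h x) \<in> borel_measurable (borel \<Otimes>\<^sub>M borel)"
    unfolding R_def by measurable
  have Rm' [measurable]: "(\<lambda>(x, h). R h x) \<in> borel_measurable (borel \<Otimes>\<^sub>M borel)"
    unfolding R_def by measurable
  define c where "c = (\<integral>\<^sup>+h. ennreal (kern s (h::'a)) * ennreal (theta h) \<partial>lborel)"
  have c: "c < \<infinity>" unfolding c_def by (rule kern_theta_finite[OF s])
  define N where "N x = (\<integral>\<^sup>+h. ennreal (kern s h * \<bar>R h x\<bar>) \<partial>lborel)" for x
  have [measurable]: "N \<in> borel_measurable borel" unfolding N_def[abs_def] by measurable
  have Rbd: "\<bar>R h x\<bar> \<le> sqrt (A * theta h) * (\<bar>sd h u x\<bar> + \<bar>sd (- h) u x\<bar> + sqrt (A * theta h) * \<bar>u x\<bar>)" for h x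
  proof -
    define m where "m = sqrt (A * theta h)"
    have m2: "m * m = A * theta h" using A(1) by (simp add: m_def)
    have e1: "\<bar>sd h \<eta> x\<bar> \<le> m" unfolding m_def using A(2)[of h x] by (intro real_le_rsqrt) simp
    have e2: "\<bar>sd (- h) \<eta> x\<bar> \<le> m" unfolding m_def using A(2)[of "- h" x] by (intro real_le_rsqrt) simp
    \<comment> \<open>Substituting u(x + h) = u(x) + \<open>sd h u x\<close>, and likewise for -h,
      separates products of two increments from the second difference of \<eta>.\<close>
    have "R h x = - (sd h \<eta> x * sd h u x) - sd (- h) \<eta> x * sd (- h) u x + (2 * \<eta> x - \<eta> (x + h) - \<eta> (x - h)) * u x"
      by (simp add: R_def sd_def algebra_simps)
    then have "\<bar>R h x\<bar> \<le> \<bar>sd h \<eta> x\<bar> * \<bar>sd h u x\<bar> + \<bar>sd (- h) \<eta> x\<bar> * \<bar>sd (- h) u x\<bar> + \<bar>2 * \<eta> x - \<eta> (x + h) - \<eta> (x - h)\<bar> * \<bar>u x\<bar>"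
      unfolding abs_mult[symmetric] by linarith
    also have "\<dots> \<le> m * \<bar>sd h u x\<bar> + m * \<bar>sd (- h) u x\<bar> + (m * m) * \<bar>u x\<bar>"
      unfolding m2 by (intro add_mono mult_right_mono e1 e2 A(3)) auto
    finally show ?thesis by (simp add: m_def[symmetric] distrib_left mult.assoc)
  qed
  \<comment> \<open>Cauchy-Schwarz in h: the root of \<open>A * theta h\<close> takes one square
    root of the kernel and is square integrable with it by \<open>kern_theta_finite\<close>; the
    other factor leaves the seminorm densities of u at x and a multiple of u(x)^2.\<close>
  have N2: "(N x)\<^sup>2 \<le> (ennreal A * c) * (\<integral>\<^sup>+h. 3 * (ennreal (kern s h * (sd h u x)\<^sup>2) + ennreal (kern s h * (sd (- h) u x)\<^sup>2)
      + ennreal (A * (u x)\<^sup>2) * (ennreal (kern s h) * ennreal (theta h))) \<partial>lborel)" for x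
  proof -
    let ?a = "\<lambda>h::'a. ennreal (sqrt (kern s h) * sqrt (A * theta h))"
    let ?b = "\<lambda>h::'a. ennreal (sqrt (kern s h) * (\<bar>sd h u x\<bar> + \<bar>sd (- h) u x\<bar> + sqrt (A * theta h) * \<bar>u x\<bar>))"
    have am: "?a \<in> borel_measurable lborel" by measurable
    have bm: "?b \<in> borel_measurable lborel" unfolding sd_def by measurable
    have "N x \<le> (\<integral>\<^sup>+h. ?a h * ?b h \<partial>lborel)"
      unfolding N_def
    proof (rule nn_integral_mono)
      fix h
      let ?q = "\<bar>sd h u x\<bar> + \<bar>sd (- h) u x\<bar> + sqrt (A * theta h) * \<bar>u x\<bar>"
      have q: "0 \<le> ?q" using A(1) by simp
      have "kern s h * \<bar>R h x\<bar> \<le> (sqrt (kern s h) * sqrt (kern s h)) * (sqrt (A * theta h) * ?q)"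
        using Rbd[of h x] by (simp add: mult_left_mono)
      also have "\<dots> = (sqrt (kern s h) * sqrt (A * theta h)) * (sqrt (kern s h) * ?q)"
        by (simp only: mult_ac)
      finally show "ennreal (kern s h * \<bar>R h x\<bar>) \<le> ?a h * ?b h"
        using A(1) q by (subst ennreal_mult[symmetric]) (auto intro!: ennreal_leI mult_nonneg_nonneg)
    qed
    then have "(N x)\<^sup>2 \<le> (\<integral>\<^sup>+h. ?a h * ?b h \<partial>lborel)\<^sup>2" by (rule power_mono) simp
    also have "\<dots> \<le> (\<integral>\<^sup>+h. (?a h)\<^sup>2 \<partial>lborel) * (\<integral>\<^sup>+h. (?b h)\<^sup>2 \<partial>lborel)"
      by (rule Cauchy_Schwarz_nn_integral[OF am bm])
    also have "(\<integral>\<^sup>+h. (?a h)\<^sup>2 \<partial>lborel) = ennreal A * c"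
    proof -
      have "(?a h)\<^sup>2 = ennreal A * (ennreal (kern s h) * ennreal (theta h))" for h
        using A(1) by (simp add: ennreal_power power_mult_distrib ennreal_mult[symmetric] mult_ac)
      then show ?thesis by (simp add: c_def nn_integral_cmult)
    qed
    also have "(\<integral>\<^sup>+h. (?b h)\<^sup>2 \<partial>lborel) \<le> (\<integral>\<^sup>+h. 3 * (ennreal (kern s h * (sd h u x)\<^sup>2) + ennreal (kern s h * (sd (- h) u x)\<^sup>2)
      + ennreal (A * (u x)\<^sup>2) * (ennreal (kern s h) * ennreal (theta h))) \<partial>lborel)"
    proof (rule nn_integral_mono)
      fix h
      have sq3: "(p + q + r)\<^sup>2 \<le> 3 * (p\<^sup>2 + q\<^sup>2 + r\<^sup>2)" for p q r :: real
        using sum_squares_ge_zero[of "p - q" "q - r"] zero_le_power2[of "p - r"]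
        by (simp add: power2_eq_square algebra_simps)
      let ?q = "\<bar>sd h u x\<bar> + \<bar>sd (- h) u x\<bar> + sqrt (A * theta h) * \<bar>u x\<bar>"
      have "(sqrt (kern s h) * ?q)\<^sup>2 = kern s h * ?q\<^sup>2" by (simp add: power_mult_distrib)
      also have "\<dots> \<le> kern s h * (3 * (\<bar>sd h u x\<bar>\<^sup>2 + \<bar>sd (- h) u x\<bar>\<^sup>2 + (sqrt (A * theta h) * \<bar>u x\<bar>)\<^sup>2))"
        by (intro mult_left_mono sq3) simp
      also have "\<dots> = 3 * (kern s h * (sd h u x)\<^sup>2 + kern s h * (sd (- h) u x)\<^sup>2 + (A * (u x)\<^sup>2) * (kern s h * theta h))"
        using A(1) by (simp add: power_mult_distrib algebra_simps)
      finally have "ennreal ((sqrt (kern s h) * ?q)\<^sup>2) \<le> ennreal (3 * (kern s h * (sd h u x)\<^sup>2 + kern s h * (sd (- h) u x)\<^sup>2 + (A * (u x)\<^sup>2) * (kern s h * theta h)))"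
        by (rule ennreal_leI)
      moreover have "(?b h)\<^sup>2 = ennreal ((sqrt (kern s h) * ?q)\<^sup>2)"
        using A(1) by (intro ennreal_power mult_nonneg_nonneg add_nonneg_nonneg) auto
      ultimately show "(?b h)\<^sup>2 \<le> 3 * (ennreal (kern s h * (sd h u x)\<^sup>2) + ennreal (kern s h * (sd (- h) u x)\<^sup>2) + ennreal (A * (u x)\<^sup>2) * (ennreal (kern s h) * ennreal (theta h)))"
        using A(1) by (simp only:) (simp add: ennreal_mult ennreal_mult')
    qed
    finally show ?thesis by (simp add: mult_left_mono)
  qed
  have Nfin: "(\<integral>\<^sup>+x. (N x)\<^sup>2 \<partial>lborel) < \<infinity>"
  proof -
    define I1 where "I1 x = (\<integral>\<^sup>+h. ennreal (kern s h * (sd h u x)\<^sup>2) \<partial>lborel)" for x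
    have I1m [measurable]: "I1 \<in> borel_measurable borel" unfolding I1_def[abs_def] sd_def by measurable
    have I2: "(\<integral>\<^sup>+h. ennreal (kern s h * (sd (- h) u x)\<^sup>2) \<partial>lborel) = I1 x" for x
    proof -
      have "(\<lambda>h. ennreal (kern s h * (sd h u x)\<^sup>2)) \<in> borel_measurable borel" unfolding sd_def by measurable
      from nn_integral_lborel_uminus[OF this] show ?thesis by (simp add: I1_def)
    qed
    have inner: "(\<integral>\<^sup>+h. 3 * (ennreal (kern s h * (sd h u x)\<^sup>2) + ennreal (kern s h * (sd (- h) u x)\<^sup>2)
      + ennreal (A * (u x)\<^sup>2) * (ennreal (kern s h) * ennreal (theta h))) \<partial>lborel) = 3 * (I1 x + I1 x + ennreal (A * (u x)\<^sup>2) * c)" for x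
    proof -
      let ?a = "\<lambda>h. ennreal (kern s h * (sd h u x)\<^sup>2)" and ?b = "\<lambda>h. ennreal (kern s h * (sd (- h) u x)\<^sup>2)"
      let ?e = "\<lambda>h::'a. ennreal (A * (u x)\<^sup>2) * (ennreal (kern s h) * ennreal (theta h))"
      have [measurable]: "?a \<in> borel_measurable lborel" "?b \<in> borel_measurable lborel" unfolding sd_def by measurable
      have "(\<integral>\<^sup>+h. 3 * (?a h + ?b h + ?e h) \<partial>lborel) = 3 * (\<integral>\<^sup>+h. ?a h + ?b h + ?e h \<partial>lborel)"
        by (rule nn_integral_cmult) measurable
      also have "(\<integral>\<^sup>+h. ?a h + ?b h + ?e h \<partial>lborel) = (\<integral>\<^sup>+h. ?a h + ?b h \<partial>lborel) + (\<integral>\<^sup>+h. ?e h \<partial>lborel)"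
        by (rule nn_integral_add) measurable
      also have "(\<integral>\<^sup>+h. ?a h + ?b h \<partial>lborel) = (\<integral>\<^sup>+h. ?a h \<partial>lborel) + (\<integral>\<^sup>+h. ?b h \<partial>lborel)"
        by (rule nn_integral_add) measurable
      also have "(\<integral>\<^sup>+h. ?e h \<partial>lborel) = ennreal (A * (u x)\<^sup>2) * c"
        unfolding c_def by (rule nn_integral_cmult) measurable
      finally show ?thesis by (simp only: I2 I1_def)
    qed
    have "(\<integral>\<^sup>+x. (N x)\<^sup>2 \<partial>lborel) \<le> (\<integral>\<^sup>+x. (ennreal A * c) * (3 * (I1 x + I1 x + ennreal (A * (u x)\<^sup>2) * c)) \<partial>lborel)"
      using N2 unfolding inner by (intro nn_integral_mono) auto
    also have "\<dots> = (ennreal A * c) * (3 * (gag s u + gag s u + (\<integral>\<^sup>+x. ennreal (A * (u x)\<^sup>2) \<partial>lborel) * c))"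
    proof -
      have "(\<integral>\<^sup>+x. I1 x \<partial>lborel) = gag s u" unfolding I1_def by (rule gag_double'[OF uL, symmetric])
      then show ?thesis by (simp add: nn_integral_cmult nn_integral_add nn_integral_multc)
    qed
    also have "(\<integral>\<^sup>+x. ennreal (A * (u x)\<^sup>2) \<partial>lborel) = ennreal A * ennreal (sqnorm u)"
      using A(1) by (simp add: ennreal_mult nn_integral_cmult L2_nn_integral[OF uL])
    also have "(ennreal A * c) * (3 * (gag s u + gag s u + (ennreal A * ennreal (sqnorm u)) * c)) < \<infinity>"
      using c u by (simp add: Hs_def ennreal_mult_less_top)
    finally show ?thesis .
  qed
  define G where "G x = (\<integral>h. kern s h * R h x \<partial>lborel)" for x
  have [measurable]: "G \<in> borel_measurable borel" unfolding G_def[abs_def] by measurable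
  have GN: "ennreal \<bar>G x\<bar> \<le> N x" for x
  proof (cases "integrable lborel (\<lambda>h. kern s h * R h x)")
    case True
    then show ?thesis
      using integral_norm_bound_ennreal[OF True] by (simp add: G_def N_def abs_mult)
  next
    case False
    then show ?thesis by (simp add: G_def not_integrable_integral_eq)
  qed
  have GL: "G \<in> L2"
  proof (rule L2I)
    have "(\<integral>\<^sup>+x. ennreal ((G x)\<^sup>2) \<partial>lborel) \<le> (\<integral>\<^sup>+x. (N x)\<^sup>2 \<partial>lborel)"
    proof (rule nn_integral_mono)
      fix x
      have "ennreal ((G x)\<^sup>2) = (ennreal \<bar>G x\<bar>)\<^sup>2" by (simp add: ennreal_power)
      also have "\<dots> \<le> (N x)\<^sup>2" by (rule power_mono[OF GN]) simp
      finally show "ennreal ((G x)\<^sup>2) \<le> (N x)\<^sup>2" .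
    qed
    then show "(\<integral>\<^sup>+x. ennreal ((G x)\<^sup>2) \<partial>lborel) < \<infinity>" using Nfin by (rule le_less_trans)
  qed measurable
  show ?thesis
  proof (rule that[OF GL])
    fix v :: "'a \<Rightarrow> real" assume v: "v \<in> Hs s"
    have vL: "v \<in> L2" by (rule Hs_L2[OF v])
    have [measurable]: "v \<in> borel_measurable borel" using vL by auto
    \<comment> \<open>After cancellation only cross terms between x and x + h remain; translating
      the one that contains v(x + h) by -h turns it into the -h part of
      \<open>R h x * v x\<close>.\<close>
    have slice: "(\<integral>x. sd h (\<lambda>x. \<eta> x * u x) x * sd h v x - sd h u x * sd h (\<lambda>x. \<eta> x * v x) x \<partial>lborel) = (\<integral>x. R h x * v x \<partial>lborel)" for h
    proof -
      have B2: "\<bar>\<eta> x - \<eta> y\<bar> \<le> 2 * B" for x y using B(2)[of x] B(2)[of y] by linarith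
      have L1: "(\<lambda>x. (\<eta> x - \<eta> (x + k)) * u (x + k)) \<in> L2" for k
        by (rule L2_bounded_mult[OF L2_shift[OF uL] _ B2]) measurable
      have L2': "(\<lambda>x. (\<eta> x - \<eta> (x + h)) * u x) \<in> L2"
        by (rule L2_bounded_mult[OF uL _ B2]) measurable
      have i: "integrable lborel (\<lambda>x. (\<eta> x - \<eta> (x + h)) * u (x + h) * v x)"
        "integrable lborel (\<lambda>x. (\<eta> x - \<eta> (x + - h)) * u (x + - h) * v x)"
        "integrable lborel (\<lambda>x. (\<eta> x - \<eta> (x + h)) * u x * v (x + h))"
        by (intro L2_prod_integrable L1 L2' vL L2_shift)+
      have "(\<integral>x. sd h (\<lambda>x. \<eta> x * u x) x * sd h v x - sd h u x * sd h (\<lambda>x. \<eta> x * v x) x \<partial>lborel)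
        = (\<integral>x. (\<eta> x - \<eta> (x + h)) * u (x + h) * v x - (\<eta> x - \<eta> (x + h)) * u x * v (x + h) \<partial>lborel)"
        by (intro Bochner_Integration.integral_cong refl) (simp add: sd_def algebra_simps)
      also have "\<dots> = (\<integral>x. (\<eta> x - \<eta> (x + h)) * u (x + h) * v x \<partial>lborel) - (\<integral>x. (\<eta> x - \<eta> (x + h)) * u x * v (x + h) \<partial>lborel)"
        by (rule Bochner_Integration.integral_diff[OF i(1,3)])
      also have "(\<integral>x. (\<eta> x - \<eta> (x + h)) * u x * v (x + h) \<partial>lborel) = (\<integral>x. (\<eta> (x + - h) - \<eta> (x + - h + h)) * u (x + - h) * v (x + - h + h) \<partial>lborel)"
        by (rule integral_lborel_shift[symmetric]) measurable
      also have "\<dots> = - (\<integral>x. (\<eta> x - \<eta> (x + - h)) * u (x + - h) * v x \<partial>lborel)"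
        by (subst Bochner_Integration.integral_minus[symmetric]) (simp add: algebra_simps)
      also have "(\<integral>x. (\<eta> x - \<eta> (x + h)) * u (x + h) * v x \<partial>lborel) - - (\<integral>x. (\<eta> x - \<eta> (x + - h)) * u (x + - h) * v x \<partial>lborel)
        = (\<integral>x. (\<eta> x - \<eta> (x + h)) * u (x + h) * v x + (\<eta> x - \<eta> (x + - h)) * u (x + - h) * v x \<partial>lborel)"
        using i(1,2) by simp
      also have "\<dots> = (\<integral>x. R h x * v x \<partial>lborel)"
        by (simp add: R_def distrib_right)
      finally show ?thesis .
    qed
    have Rv: "integrable (lborel \<Otimes>\<^sub>M lborel) (\<lambda>(x, h). kern s h * R h x * v x)"
    proof (rule integrableI_bounded)
      have "(\<integral>\<^sup>+p. ennreal (norm (case p of (x, h) \<Rightarrow> kern s h * R h x * v x)) \<partial>(lborel \<Otimes>\<^sub>M lborel))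
        = (\<integral>\<^sup>+x. (\<integral>\<^sup>+h. ennreal (kern s h * \<bar>R h x\<bar>) * ennreal \<bar>v x\<bar> \<partial>lborel) \<partial>lborel)"
        by (subst lborel.nn_integral_fst[symmetric]) (auto simp: abs_mult ennreal_mult)
      also have "\<dots> = (\<integral>\<^sup>+x. N x * ennreal \<bar>v x\<bar> \<partial>lborel)"
        by (simp add: nn_integral_multc N_def)
      finally have eq: "(\<integral>\<^sup>+p. ennreal (norm (case p of (x, h) \<Rightarrow> kern s h * R h x * v x)) \<partial>(lborel \<Otimes>\<^sub>M lborel)) = (\<integral>\<^sup>+x. N x * ennreal \<bar>v x\<bar> \<partial>lborel)" .
      have "(\<integral>\<^sup>+x. N x * ennreal \<bar>v x\<bar> \<partial>lborel)\<^sup>2 \<le> (\<integral>\<^sup>+x. (N x)\<^sup>2 \<partial>lborel) * (\<integral>\<^sup>+x. (ennreal \<bar>v x\<bar>)\<^sup>2 \<partial>lborel)"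
        by (rule Cauchy_Schwarz_nn_integral) auto
      also have "(\<integral>\<^sup>+x. (ennreal \<bar>v x\<bar>)\<^sup>2 \<partial>lborel) = ennreal (sqnorm v)"
        using L2_nn_integral[OF vL] by (simp add: ennreal_power)
      also have "(\<integral>\<^sup>+x. (N x)\<^sup>2 \<partial>lborel) * ennreal (sqnorm v) < \<infinity>"
        using Nfin by (simp add: ennreal_mult_less_top)
      finally show "(\<integral>\<^sup>+p. ennreal (norm (case p of (x, h) \<Rightarrow> kern s h * R h x * v x)) \<partial>(lborel \<Otimes>\<^sub>M lborel)) < \<infinity>"
        unfolding eq by (simp add: power_less_top_ennreal)
    qed measurable
    note I1 = form_integrable[OF Hs_test_mult[OF s \<eta> u] v]
    note I2 = form_integrable[OF u Hs_test_mult[OF s \<eta> v]]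
    have "form s (\<lambda>x. \<eta> x * u x) v - form s u (\<lambda>x. \<eta> x * v x)
      = (\<integral>p. kern s (fst p) * (sd (fst p) (\<lambda>x. \<eta> x * u x) (snd p) * sd (fst p) v (snd p) - sd (fst p) u (snd p) * sd (fst p) (\<lambda>x. \<eta> x * v x) (snd p)) \<partial>(lborel \<Otimes>\<^sub>M lborel))"
      unfolding form_def right_diff_distrib
      by (rule Bochner_Integration.integral_diff[OF I1[unfolded case_prod_beta] I2[unfolded case_prod_beta], symmetric])
    also have "\<dots> = (\<integral>h. (\<integral>x. kern s h * (sd h (\<lambda>x. \<eta> x * u x) x * sd h v x - sd h u x * sd h (\<lambda>x. \<eta> x * v x) x) \<partial>lborel) \<partial>lborel)"
      using Bochner_Integration.integrable_diff[OF I1 I2]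
      by (subst lborel_pair.integral_fst'[symmetric]) (simp_all add: case_prod_beta right_diff_distrib)
    also have "\<dots> = (\<integral>h. (\<integral>x. kern s h * R h x * v x \<partial>lborel) \<partial>lborel)"
      by (simp add: slice mult.assoc)
    also have "\<dots> = (\<integral>x. (\<integral>h. kern s h * R h x * v x \<partial>lborel) \<partial>lborel)"
      by (rule lborel_pair.Fubini_integral[OF Rv])
    also have "\<dots> = (\<integral>x. G x * v x \<partial>lborel)"
      by (simp add: G_def)
    finally show "form s (\<lambda>x. \<eta> x * u x) v - form s u (\<lambda>x. \<eta> x * v x) = (\<integral>x. G x * v x \<partial>lborel)" .
  qed
qed

section \<open>The global estimate\<close>

text \<open>This is \<open>sd h\<close> followed by its L2 adjoint, hence a positive operator, with
  the sign of the negative Laplacian.\<close>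

definition lap :: "'a::euclidean_space \<Rightarrow> ('a \<Rightarrow> real) \<Rightarrow> 'a \<Rightarrow> real" where
  "lap h g = (\<lambda>x. 2 * g x - g (x + h) - g (x - h))"

lemma lap_Hs:
  assumes "g \<in> Hs s"
  shows "lap h g \<in> Hs s"
proof -
  have "lap h g = (\<lambda>x. 2 * g x + ((-1) * g (x + h) + (-1) * g (x + - h)))"
    by (simp add: lap_def fun_eq_iff)
  also have "\<dots> \<in> Hs s" by (intro Hs_add Hs_cmult Hs_shift assms)
  finally show ?thesis .
qed

lemma lap_L2:
  assumes "g \<in> L2"
  shows "lap h g \<in> L2"
proof -
  have "lap h g = (\<lambda>x. 2 * g x + ((-1) * g (x + h) + (-1) * g (x + - h)))"
    by (simp add: lap_def fun_eq_iff)
  also have "\<dots> \<in> L2" by (intro L2_add L2_cmult L2_shift assms)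
  finally show ?thesis .
qed

lemma sd_lap: "sd k (lap h g) = lap h (sd k g)"
  by (auto simp: lap_def sd_def algebra_simps)

lemma inner_lap:
  assumes f: "f \<in> L2" and g: "g \<in> L2"
  shows "(\<integral>x. f x * lap k g x \<partial>lborel) = (\<integral>x. sd k f x * sd k g x \<partial>lborel)"
proof -
  have [measurable]: "f \<in> borel_measurable borel" "g \<in> borel_measurable borel" using f g by auto
  have i: "integrable lborel (\<lambda>x. f (x + a) * g (x + b))" for a b
    by (intro L2_prod_integrable L2_shift f g)
  have i0: "integrable lborel (\<lambda>x. f x * g x)" "integrable lborel (\<lambda>x. f x * g (x + b))" "integrable lborel (\<lambda>x. f (x + b) * g x)" for b
    by (intro L2_prod_integrable L2_shift f g)+
  have "(\<integral>x. sd k f x * sd k g x \<partial>lborel) = (\<integral>x. f (x + k) * g (x + k) - f (x + k) * g x - f x * g (x + k) + f x * g x \<partial>lborel)"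
    by (simp add: sd_def algebra_simps)
  also have "\<dots> = (\<integral>x. f (x + k) * g (x + k) \<partial>lborel) - (\<integral>x. f (x + k) * g x \<partial>lborel) - (\<integral>x. f x * g (x + k) \<partial>lborel) + (\<integral>x. f x * g x \<partial>lborel)"
    using i i0 by simp
  also have "(\<integral>x. f (x + k) * g (x + k) \<partial>lborel) = (\<integral>x. f x * g x \<partial>lborel)"
    by (rule integral_lborel_shift[where f = "\<lambda>x. f x * g x"]) measurable
  also have "(\<integral>x. f (x + k) * g x \<partial>lborel) = (\<integral>x. f x * g (x + - k) \<partial>lborel)"
    using integral_lborel_shift[of "\<lambda>x. f x * g (x + - k)" k] by simp
  finally have eq: "(\<integral>x. sd k f x * sd k g x \<partial>lborel) = 2 * (\<integral>x. f x * g x \<partial>lborel) - (\<integral>x. f x * g (x + - k) \<partial>lborel) - (\<integral>x. f x * g (x + k) \<partial>lborel)"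
    by simp
  have "(\<integral>x. f x * lap k g x \<partial>lborel) = (\<integral>x. 2 * (f x * g x) - f x * g (x + k) - f x * g (x + - k) \<partial>lborel)"
    by (intro Bochner_Integration.integral_cong refl) (simp add: lap_def algebra_simps)
  also have "\<dots> = 2 * (\<integral>x. f x * g x \<partial>lborel) - (\<integral>x. f x * g (x + k) \<partial>lborel) - (\<integral>x. f x * g (x + - k) \<partial>lborel)"
    using i0 by (simp del: add_uminus_conv_diff)
  finally show ?thesis unfolding eq by simp
qed

text \<open>The operators commute and each is a difference followed by its adjoint; sharing the
  differences evenly between both factors leaves the squared norm of a mixed difference. The inner
  product is therefore nonnegative, which permits enlarging the kernel in either variable.\<close>

lemma inner_lap_lap:
  assumes g: "g \<in> L2"
  shows "(\<integral>x. lap h g x * lap k g x \<partial>lborel) = modulus (sd h g) k"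
proof -
  have "(\<integral>x. lap h g x * lap k g x \<partial>lborel) = (\<integral>x. sd k g x * lap h (sd k g) x \<partial>lborel)"
    by (simp add: inner_lap lap_L2 g sd_lap mult.commute)
  also have "\<dots> = (\<integral>x. sd h (sd k g) x * sd h (sd k g) x \<partial>lborel)"
    by (intro inner_lap sd_L2 g)
  finally show ?thesis
    unfolding modulus_def sqnorm_def by (simp only: sd_commute[of h k] power2_eq_square)
qed

text \<open>Testing the equation with \<^term>\<open>lap h w\<close> and integrating over \<open>h\<close> compares
  \<open>\<parallel>\<Lambda>\<parallel>\<^sup>2\<close> with \<open>\<langle>F, \<Lambda>\<rangle>\<close> for a truncated fractional Laplacian \<open>\<Lambda>\<close> of \<open>w\<close>.\<close>

lemma fractional_laplacian_estimate:
  fixes w :: "'a::euclidean_space \<Rightarrow> real"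
  assumes s: "0 < s" and w: "w \<in> Hs s" and F: "F \<in> L2" and c: "0 < c"
    and eq: "\<And>v. v \<in> Hs s \<Longrightarrow> c * form s w v = (\<integral>x. F x * v x \<partial>lborel)"
  shows "(\<integral>\<^sup>+h. ennreal (kern s h) * gag s (sd h w) \<partial>lborel) < \<infinity>"
proof -
  have wL: "w \<in> L2" by (rule Hs_L2[OF w])
  have wm [measurable]: "w \<in> borel_measurable borel" using wL by auto
  note gm [measurable] = gag_sd_measurable[OF wL]
  define G where "G h = enn2real (gag s (sd h w))" for h
  have [measurable]: "G \<in> borel_measurable borel" unfolding G_def[abs_def] by measurable
  have G: "gag s (sd h w) = ennreal (G h)" for h
    using gag_sd_finite[OF w, of h] by (simp add: G_def)
  have G0: "0 \<le> G h" for h by (simp add: G_def)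
  \<comment> \<open>With \<open>lap h w\<close> as test function the form becomes the squared
    seminorm of \<open>sd h w\<close>, so the equation expresses that seminorm as a pairing with
    F.\<close>
  have cG: "c * G h = (\<integral>x. F x * lap h w x \<partial>lborel)" for h
  proof -
    have "form s w (lap h w) = (\<integral>k. kern s k * (\<integral>x. sd k w x * lap h (sd k w) x \<partial>lborel) \<partial>lborel)"
      by (simp add: form_iterated[OF w lap_Hs[OF w]] sd_lap)
    also have "\<dots> = (\<integral>k. kern s k * modulus (sd h w) k \<partial>lborel)"
      by (simp add: inner_lap sd_L2 wL) (simp add: modulus_def sqnorm_def power2_eq_square sd_commute[of h])
    also have "\<dots> = G h"
    proof -
      have [measurable]: "modulus (sd h w) \<in> borel_measurable borel" using sd_L2[OF wL] by auto
      have "(\<integral>k. kern s k * modulus (sd h w) k \<partial>lborel) = enn2real (\<integral>\<^sup>+k. ennreal (kern s k * modulus (sd h w) k) \<partial>lborel)"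
        by (rule integral_eq_nn_integral) (auto simp: modulus_nonneg)
      then show ?thesis by (simp add: G_def gag_def ennreal_mult modulus_nonneg)
    qed
    finally have f: "form s w (lap h w) = G h" .
    show ?thesis using eq[OF lap_Hs[OF w, of h]] unfolding f .
  qed
  have Gb: "G h \<le> 4 * enn2real (gag s w)" for h
  proof -
    have "ennreal (G h) \<le> ennreal 4 * gag s w"
      unfolding G[symmetric] using w by (intro gag_mono2 modulus_sd_le) (auto simp: Hs_def)
    also have "\<dots> = ennreal (4 * enn2real (gag s w))"
      using w by (simp add: Hs_def ennreal_mult)
    finally show ?thesis by (simp add: ennreal_le_iff)
  qed
  \<comment> \<open>Truncation by a multiple of a positive integrable function: the weight defines a
    finite measure, which makes Q below finite, and at each h it equals the full kernel for large
    n.\<close>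
  define \<kappa> where "\<kappa> n h = min (kern s h) (real n * gauss 1 h)" for n :: nat and h :: 'a
  have [measurable]: "\<kappa> n \<in> borel_measurable borel" for n unfolding \<kappa>_def[abs_def] by measurable
  have \<kappa>0: "0 \<le> \<kappa> n h" for n h by (simp add: \<kappa>_def)
  define K where "K = sqnorm F / c\<^sup>2"
  have bound: "(\<integral>\<^sup>+h. ennreal (\<kappa> n h) * gag s (sd h w) \<partial>lborel) \<le> ennreal K" for n
  proof -
    define \<nu> where "\<nu> = density lborel (\<lambda>h. ennreal (\<kappa> n h))"
    have sets\<nu> [measurable_cong]: "sets \<nu> = sets borel" by (simp add: \<nu>_def)
    have nn\<nu>: "(\<integral>\<^sup>+h. f h \<partial>\<nu>) = (\<integral>\<^sup>+h. ennreal (\<kappa> n h) * f h \<partial>lborel)" if "f \<in> borel_measurable borel" for f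
      unfolding \<nu>_def using that by (subst nn_integral_density) auto
    have fin: "finite_measure \<nu>"
    proof
      have "emeasure \<nu> (space \<nu>) = (\<integral>\<^sup>+h. ennreal (\<kappa> n h) \<partial>lborel)" by (simp add: \<nu>_def emeasure_density)
      also have "\<dots> \<le> (\<integral>\<^sup>+h. ennreal (real n) * ennreal (gauss 1 (h::'a)) \<partial>lborel)"
        by (intro nn_integral_mono) (auto simp: \<kappa>_def ennreal_mult[symmetric] intro!: ennreal_leI)
      also have "\<dots> < \<infinity>" by (simp add: nn_integral_cmult nn_integral_gauss)
      finally show "emeasure \<nu> (space \<nu>) \<noteq> \<infinity>" by simp
    qed
    interpret \<nu>: finite_measure \<nu> by (rule fin)
    have lm: "(\<lambda>(h, x). lap h w x) \<in> borel_measurable (borel \<Otimes>\<^sub>M borel)" unfolding lap_def by measurable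
    have lb: "sqnorm (lap h w) \<le> (4 * sqrt (sqnorm w))\<^sup>2" for h
    proof -
      have "sqnorm (lap h w) = modulus (sd h w) h"
        using inner_lap_lap[OF wL, of h h] by (simp add: sqnorm_def power2_eq_square)
      also have "\<dots> \<le> 4 * (4 * sqnorm w)"
        using modulus_sd_le[OF wL, of h h] modulus_le[OF wL, of h] by linarith
      finally show ?thesis by (simp add: power_mult_distrib sqnorm_nonneg)
    qed
    note mix = L2_mixture[OF fin sets\<nu> lm lap_L2[OF wL] lb]
    define \<Lambda> where "\<Lambda> x = (\<integral>h. lap h w x \<partial>\<nu>)" for x
    define Q where "Q = (\<integral>h. G h \<partial>\<nu>)"
    have Gi: "integrable \<nu> G"
      by (rule \<nu>.integrable_const_bound[where B = "4 * enn2real (gag s w)"]) (use Gb G0 in auto)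
    have Q0: "0 \<le> Q" unfolding Q_def using G0 by simp
    have "c * Q = (\<integral>h. c * G h \<partial>\<nu>)" by (simp add: Q_def)
    also have "\<dots> = (\<integral>x. F x * \<Lambda> x \<partial>lborel)"
      unfolding cG \<Lambda>_def by (rule mix(2)[OF F, symmetric])
    finally have cQ: "c * Q = (\<integral>x. F x * \<Lambda> x \<partial>lborel)" .
    have \<Lambda>L: "\<Lambda> \<in> L2" unfolding \<Lambda>_def[abs_def] by (rule mix(1))
    \<comment> \<open>Only one of the two integrations in the squared norm of \<Lambda> is enlarged
      to the full kernel and yields \<open>G h\<close>; the other stays over \<nu> and yields
      Q.\<close>
    have inner: "(\<integral>k. modulus (sd h w) k \<partial>\<nu>) \<le> G h" for h
    proof -
      have [measurable]: "modulus (sd h w) \<in> borel_measurable borel" using sd_L2[OF wL] by auto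
      have "(\<integral>k. modulus (sd h w) k \<partial>\<nu>) = enn2real (\<integral>\<^sup>+k. ennreal (modulus (sd h w) k) \<partial>\<nu>)"
        by (rule integral_eq_nn_integral) (auto simp: modulus_nonneg)
      also have "\<dots> \<le> enn2real (gag s (sd h w))"
      proof (rule enn2real_mono)
        show "(\<integral>\<^sup>+k. ennreal (modulus (sd h w) k) \<partial>\<nu>) \<le> gag s (sd h w)"
          unfolding gag_def by (subst nn\<nu>) (auto intro!: nn_integral_mono mult_right_mono ennreal_leI simp: \<kappa>_def)
      qed (use gag_sd_finite[OF w] in auto)
      finally show ?thesis by (simp add: G_def)
    qed
    have "sqnorm \<Lambda> = (\<integral>h. (\<integral>k. modulus (sd h w) k \<partial>\<nu>) \<partial>\<nu>)"
      unfolding \<Lambda>_def[abs_def] by (subst mix(3)) (simp add: inner_lap_lap[OF wL])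
    also have "\<dots> \<le> Q"
      unfolding Q_def
    proof (rule integral_mono[OF _ Gi inner])
      have m: "(\<lambda>h. \<integral>k. modulus (sd h w) k \<partial>\<nu>) \<in> borel_measurable \<nu>"
      proof -
        have [measurable]: "(\<lambda>(h, k). modulus (sd h w) k) \<in> borel_measurable (borel \<Otimes>\<^sub>M borel)"
          using modulus_sd_measurable[OF wL] by (simp add: split_beta')
        show ?thesis by measurable
      qed
      show "integrable \<nu> (\<lambda>h. \<integral>k. modulus (sd h w) k \<partial>\<nu>)"
      proof (rule \<nu>.integrable_const_bound[where B = "4 * enn2real (gag s w)", OF _ m], rule AE_I2)
        fix h
        have "0 \<le> (\<integral>k. modulus (sd h w) k \<partial>\<nu>)" by (simp add: modulus_nonneg)
        then show "norm (\<integral>k. modulus (sd h w) k \<partial>\<nu>) \<le> 4 * enn2real (gag s w)"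
          using inner[of h] Gb[of h] by simp
      qed
    qed
    finally have \<Lambda>Q: "sqnorm \<Lambda> \<le> Q" .
    \<comment> \<open>Q is bounded by a multiple of its own square root; being finite it can be
      absorbed, and the resulting bound K does not involve n.\<close>
    have "c * Q \<le> sqrt (sqnorm F) * sqrt (sqnorm \<Lambda>)"
      using L2_Cauchy_Schwarz[OF F \<Lambda>L] unfolding cQ by linarith
    also have "\<dots> \<le> sqrt (sqnorm F) * sqrt Q"
      using \<Lambda>Q by (intro mult_left_mono) (auto simp: sqnorm_nonneg)
    finally have "(c * Q)\<^sup>2 \<le> (sqrt (sqnorm F) * sqrt Q)\<^sup>2"
      using c Q0 by (intro power_mono) auto
    also have "(sqrt (sqnorm F) * sqrt Q)\<^sup>2 = sqnorm F * Q"
      using Q0 by (simp add: power_mult_distrib sqnorm_nonneg)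
    finally have "c\<^sup>2 * Q * Q \<le> sqnorm F * Q"
      by (simp add: power2_eq_square mult_ac)
    then have "c\<^sup>2 * Q \<le> sqnorm F"
      using Q0 sqnorm_nonneg[of F] by (cases "Q = 0") auto
    then have "Q \<le> K" using c by (simp add: K_def pos_le_divide_eq mult.commute)
    have "(\<integral>\<^sup>+h. ennreal (\<kappa> n h) * gag s (sd h w) \<partial>lborel) = (\<integral>\<^sup>+h. ennreal (G h) \<partial>\<nu>)"
      by (simp add: nn\<nu> G)
    also have "\<dots> = ennreal Q"
      unfolding Q_def by (rule nn_integral_eq_integral[OF Gi]) (simp add: G0)
    finally show ?thesis using \<open>Q \<le> K\<close> by (simp add: ennreal_leI)
  qed
  have "(\<integral>\<^sup>+h. ennreal (kern s h) * gag s (sd h w) \<partial>lborel) = (\<integral>\<^sup>+h. liminf (\<lambda>n. ennreal (\<kappa> n h) * gag s (sd h w)) \<partial>lborel)"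
  proof (rule nn_integral_cong)
    fix h :: 'a
    obtain n0 :: nat where n0: "kern s h / gauss 1 h \<le> real n0" using real_arch_simple by blast
    have "\<kappa> n h = kern s h" if "n0 \<le> n" for n
    proof -
      have g: "0 < gauss 1 h" by (rule gauss_pos) simp
      have "kern s h \<le> real n0 * gauss 1 h" using n0 g by (simp add: pos_divide_le_eq)
      also have "\<dots> \<le> real n * gauss 1 h" using that g by (intro mult_right_mono) auto
      finally show ?thesis by (simp add: \<kappa>_def)
    qed
    then have "\<forall>\<^sub>F n in sequentially. ennreal (\<kappa> n h) * gag s (sd h w) = ennreal (kern s h) * gag s (sd h w)"
      by (intro eventually_sequentiallyI[of n0]) simp
    then have "(\<lambda>n. ennreal (\<kappa> n h) * gag s (sd h w)) \<longlonglongrightarrow> ennreal (kern s h) * gag s (sd h w)"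
      by (rule tendsto_eventually)
    from lim_imp_Liminf[OF trivial_limit_sequentially this]
    show "ennreal (kern s h) * gag s (sd h w) = liminf (\<lambda>n. ennreal (\<kappa> n h) * gag s (sd h w))" by (rule sym)
  qed
  also have "\<dots> \<le> liminf (\<lambda>n. \<integral>\<^sup>+h. ennreal (\<kappa> n h) * gag s (sd h w) \<partial>lborel)"
    by (rule nn_integral_liminf) measurable
  also have "\<dots> \<le> ennreal K"
    by (rule Liminf_le) (auto intro: always_eventually bound)
  finally show ?thesis by (rule le_less_trans) simp
qed

section \<open>Borel representatives\<close>

lemma lebesgue_measurable_AE:
  fixes f g :: "'a::euclidean_space \<Rightarrow> real"
  assumes g: "g \<in> borel_measurable borel" and ae: "AE x in lborel. f x = g x"
  shows "f \<in> borel_measurable lebesgue"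
proof (rule measurableI)
  fix A :: "real set" assume A: "A \<in> sets borel"
  show "f -` A \<inter> space lebesgue \<in> sets lebesgue"
  proof (rule completion.in_sets_AE)
    show "AE x in lebesgue. x \<in> g -` A \<longleftrightarrow> x \<in> f -` A \<inter> space lebesgue"
      by (rule AE_completion) (use ae in \<open>auto elim!: eventually_mono\<close>)
    show "g -` A \<in> sets lebesgue"
      using measurable_sets[OF g A] by auto
  qed auto
qed simp

text \<open>Bridge between the definitions, phrased with \<open>lebesgue\<close>, and the proof,
  which works with \<open>lborel\<close>. Completeness of Lebesgue measure makes f
  measurable.\<close>

lemma integral_lebesgue_AE:
  fixes f g :: "'a::euclidean_space \<Rightarrow> real"
  assumes g: "g \<in> borel_measurable borel" and ae: "AE x in lborel. f x = g x"
  shows "(LINT x|lebesgue. f x) = (\<integral>x. g x \<partial>lborel)"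
    and "integrable lebesgue f \<longleftrightarrow> integrable lborel g"
proof -
  have g': "g \<in> borel_measurable lebesgue" and g'': "g \<in> borel_measurable lborel"
    using g by (auto intro: measurable_completion)
  note f' = lebesgue_measurable_AE[OF assms]
  have ae': "AE x in lebesgue. f x = g x" using ae by (rule AE_completion)
  show "(LINT x|lebesgue. f x) = (\<integral>x. g x \<partial>lborel)"
    using integral_cong_AE[OF f' g' ae'] integral_completion[OF g''] by simp
  show "integrable lebesgue f \<longleftrightarrow> integrable lborel g"
    using integrable_cong_AE[OF f' g' ae'] integrable_completion[OF g''] by simp
qed

lemma abs_powr_2: "\<bar>a\<bar> powr 2 = (a::real)\<^sup>2"
  by (cases "a = 0") auto

lemma Lp_2_iff:
  fixes f g :: "'a::euclidean_space \<Rightarrow> real"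
  assumes g: "g \<in> borel_measurable borel" and ae: "AE x in lborel. f x = g x"
  shows "f \<in> Lp 2 UNIV \<longleftrightarrow> g \<in> L2"
proof -
  have ae2: "AE x in lborel. (f x)\<^sup>2 = (g x)\<^sup>2" using ae by eventually_elim simp
  have "(\<lambda>x. (g x)\<^sup>2) \<in> borel_measurable borel" using g by measurable
  from integral_lebesgue_AE(2)[OF this ae2]
  have "integrable lebesgue (\<lambda>x. (f x)\<^sup>2) \<longleftrightarrow> integrable lborel (\<lambda>x. (g x)\<^sup>2)" .
  then show ?thesis
    using lebesgue_measurable_AE[OF assms] g
    by (simp add: Lp_def L2_def set_borel_measurable_def set_integrable_def abs_powr_2)
qed

lemma Lp_2_representative:
  assumes "f \<in> Lp 2 UNIV"
  obtains g where "g \<in> L2" "AE x in lborel. f x = g x"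
proof -
  have "f \<in> borel_measurable lebesgue"
    using assms by (simp add: Lp_def set_borel_measurable_def)
  then obtain g where g: "g \<in> borel_measurable lborel" "AE x in lborel. f x = g x"
    using completion_ex_borel_measurable_real by blast
  then have "g \<in> L2" using Lp_2_iff[of g f] assms by simp
  then show ?thesis using g(2) by (rule that)
qed

text \<open>Nonnegative integrals do not distinguish a measure from its completion, so f may be
  replaced by g in each variable off a null set; the shift y = x + h then gives the increment
  form.\<close>

lemma gagliardo_eq_gag:
  fixes f g :: "'a::euclidean_space \<Rightarrow> real"
  assumes g: "g \<in> L2" and ae: "AE x in lborel. f x = g x"
  shows "gagliardo \<sigma> 2 f = gag \<sigma> g"
proof -
  have [measurable]: "g \<in> borel_measurable borel" using g by auto
  let ?\<Phi> = "\<lambda>u x y. ennreal (\<bar>u x - u y\<bar> powr 2 / norm (x - y) powr (real DIM('a) + \<sigma> * 2)) :: ennreal"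
  have "gagliardo \<sigma> 2 f = (\<integral>\<^sup>+x. (\<integral>\<^sup>+y. ?\<Phi> f x y \<partial>lborel) \<partial>lborel)"
    by (simp add: gagliardo_def nn_integral_completion)
  also have "\<dots> = (\<integral>\<^sup>+x. (\<integral>\<^sup>+y. ?\<Phi> g x y \<partial>lborel) \<partial>lborel)"
  proof (rule nn_integral_cong_AE, use ae in eventually_elim)
    fix x assume x: "f x = g x"
    show "(\<integral>\<^sup>+y. ?\<Phi> f x y \<partial>lborel) = (\<integral>\<^sup>+y. ?\<Phi> g x y \<partial>lborel)"
      by (rule nn_integral_cong_AE, use ae in eventually_elim) (simp add: x)
  qed
  also have "\<dots> = (\<integral>\<^sup>+x. (\<integral>\<^sup>+h. ennreal (kern \<sigma> h * (sd h g x)\<^sup>2) \<partial>lborel) \<partial>lborel)"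
  proof (rule nn_integral_cong)
    fix x
    have "(\<integral>\<^sup>+y. ?\<Phi> g x y \<partial>lborel) = (\<integral>\<^sup>+h. ?\<Phi> g x (h + x) \<partial>lborel)"
      by (rule nn_integral_lborel_shift[symmetric]) measurable
    also have "\<dots> = (\<integral>\<^sup>+h. ennreal (kern \<sigma> h * (sd h g x)\<^sup>2) \<partial>lborel)"
    proof (rule nn_integral_cong)
      fix h
      have "norm (x - (h + x)) = norm h" by simp
      then show "?\<Phi> g x (h + x) = ennreal (kern \<sigma> h * (sd h g x)\<^sup>2)"
        unfolding abs_powr_2 kern_def sd_def powr_minus
        by (simp add: divide_inverse mult.commute add.commute power2_commute)
    qed
    finally show "(\<integral>\<^sup>+y. ?\<Phi> g x y \<partial>lborel) = (\<integral>\<^sup>+h. ennreal (kern \<sigma> h * (sd h g x)\<^sup>2) \<partial>lborel)" .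
  qed
  also have "\<dots> = gag \<sigma> g" by (rule gag_double'[OF g, symmetric])
  finally show ?thesis .
qed

lemma W_frac_2_iff:
  assumes "g \<in> borel_measurable borel" "AE x in lborel. f x = g x"
  shows "f \<in> W_frac \<sigma> 2 \<longleftrightarrow> g \<in> Hs \<sigma>"
  using Lp_2_iff[OF assms] gagliardo_eq_gag[OF _ assms(2)] by (auto simp: W_frac_def Hs_def)

lemma L2_set_integrable:
  assumes g: "g \<in> L2" and ae: "AE x in lborel. f x = g x" and K: "compact K"
  shows "set_integrable lebesgue K f"
proof -
  have Kb: "K \<in> sets borel" using K by (simp add: borel_compact)
  have K2: "indicat_real K \<in> L2"
  proof (rule L2I)
    have "ennreal ((indicat_real K x)\<^sup>2) = indicator K x" for x
      by (simp split: split_indicator)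
    then show "(\<integral>\<^sup>+x. ennreal ((indicat_real K x)\<^sup>2) \<partial>lborel) < \<infinity>"
      using emeasure_compact_finite[OF K] Kb by simp
  qed (use Kb in auto)
  have ae2: "AE x in lborel. indicat_real K x *\<^sub>R f x = indicat_real K x * g x"
    using ae by eventually_elim simp
  have "(\<lambda>x. indicat_real K x * g x) \<in> borel_measurable borel"
    using g Kb by measurable
  from integral_lebesgue_AE(2)[OF this ae2] show ?thesis
    unfolding set_integrable_def using L2_prod_integrable[OF K2 g] by (rule iffD2)
qed

lemma weak_partialI:
  fixes w g f :: "'a::euclidean_space \<Rightarrow> real"
  assumes b: "b \<in> Basis" and w: "w \<in> L2" and g: "g \<in> L2" and ae: "AE x in lborel. f x = w x"
    and eq: "\<And>\<phi>. \<phi> \<in> test_functions UNIV \<Longrightarrow> (\<integral>x. w x * frechet_derivative \<phi> (at x) b \<partial>lborel) = - (\<integral>x. g x * \<phi> x \<partial>lborel)"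
  shows "weak_partial b f g"
proof -
  have [measurable]: "w \<in> borel_measurable borel" "g \<in> borel_measurable borel" using w g by auto
  have "(LINT x|lebesgue. f x * frechet_derivative \<phi> (at x) b) = - (LINT x|lebesgue. g x * \<phi> x)"
    if \<phi>: "\<phi> \<in> test_functions UNIV" for \<phi>
  proof -
    have [measurable]: "\<phi> \<in> borel_measurable borel" "(\<lambda>x. frechet_derivative \<phi> (at x) b) \<in> borel_measurable borel"
      using test_measurable[OF \<phi>] test_measurable[OF test_partial[OF \<phi> b]] by auto
    have "(LINT x|lebesgue. f x * frechet_derivative \<phi> (at x) b) = (\<integral>x. w x * frechet_derivative \<phi> (at x) b \<partial>lborel)"
      by (rule integral_lebesgue_AE(1)) (measurable, use ae in \<open>auto elim!: eventually_mono\<close>)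
    also have "\<dots> = - (\<integral>x. g x * \<phi> x \<partial>lborel)" by (rule eq[OF \<phi>])
    also have "(\<integral>x. g x * \<phi> x \<partial>lborel) = (LINT x|lebesgue. g x * \<phi> x)"
      by (rule integral_lebesgue_AE(1)[symmetric]) auto
    finally show ?thesis .
  qed
  then show ?thesis
    using L2_set_integrable[OF w ae] L2_set_integrable[OF g, of g] by (auto simp: weak_partial_def)
qed

lemma W0_representative:
  assumes s: "0 < s" "s < 1" and u: "u \<in> W0 s \<Omega>"
  obtains v where "v \<in> Hs s" "AE x in lborel. u x = v x"
proof -
  have W: "u \<in> W_frac s 2" using u s by (simp add: W0_def Sobolev_def)
  then have "u \<in> Lp 2 UNIV" by (simp add: W_frac_def)
  then obtain v where v: "v \<in> L2" "AE x in lborel. u x = v x" by (rule Lp_2_representative)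
  then have "v \<in> Hs s" using W W_frac_2_iff[of v u s] by auto
  then show ?thesis using v(2) by (rule that)
qed

lemma Hs_W0:
  assumes s: "0 < s" "s < 1" and v: "v \<in> Hs s" and z: "\<And>x. x \<notin> \<Omega> \<Longrightarrow> v x = 0"
  shows "v \<in> W0 s \<Omega>"
proof -
  have "v \<in> borel_measurable borel" using Hs_L2[OF v] by auto
  then have "v \<in> W_frac s 2" using W_frac_2_iff[of v v s] v by simp
  then show ?thesis using s z by (simp add: W0_def Sobolev_def)
qed

text \<open>The first argument is a solution known only up to null sets, the second a Borel test
  function. The substitution y = x + h in the inner integral, and Fubini by
  \<open>form_integrable\<close>, lead to the product integral.\<close>

lemma energy_eq_form:
  fixes u v w :: "'a::euclidean_space \<Rightarrow> real"
  assumes u: "u \<in> Hs s" and v: "v \<in> Hs s" and ae: "AE x in lborel. w x = u x"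
  shows "energy s w v = frac_const (real DIM('a)) s / 2 * form s u v"
proof -
  have [measurable]: "u \<in> borel_measurable borel" "v \<in> borel_measurable borel"
    using Hs_L2[OF u] Hs_L2[OF v] by auto
  let ?\<Phi> = "\<lambda>w x y. (w x - w y) * (v x - v y) / norm (x - y) powr (real DIM('a) + 2 * s)"
  have inner: "(LINT y|lebesgue. ?\<Phi> w x y) = (\<integral>y. ?\<Phi> u x y \<partial>lborel)" if x: "w x = u x" for x
    by (rule integral_lebesgue_AE(1)) (measurable, use ae x in \<open>auto elim!: eventually_mono\<close>)
  have "(LINT x|lebesgue. (LINT y|lebesgue. ?\<Phi> w x y)) = (\<integral>x. (\<integral>y. ?\<Phi> u x y \<partial>lborel) \<partial>lborel)"
    by (rule integral_lebesgue_AE(1)) (measurable, use ae inner in \<open>auto elim!: eventually_mono\<close>)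
  also have "\<dots> = (\<integral>x. (\<integral>h. kern s h * (sd h u x * sd h v x) \<partial>lborel) \<partial>lborel)"
  proof (rule Bochner_Integration.integral_cong[OF refl])
    fix x
    have "(\<integral>y. ?\<Phi> u x y \<partial>lborel) = (\<integral>h. ?\<Phi> u x (h + x) \<partial>lborel)"
      by (rule integral_lborel_shift[symmetric]) measurable
    also have "\<dots> = (\<integral>h. kern s h * (sd h u x * sd h v x) \<partial>lborel)"
    proof (rule Bochner_Integration.integral_cong[OF refl])
      fix h
      have "norm (x - (h + x)) = norm h" by simp
      moreover have "(u x - u (h + x)) * (v x - v (h + x)) = sd h u x * sd h v x"
        by (simp add: sd_def add.commute algebra_simps)
      ultimately show "?\<Phi> u x (h + x) = kern s h * (sd h u x * sd h v x)"
        unfolding kern_def powr_minus by (simp add: divide_inverse mult.commute)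
    qed
    finally show "(\<integral>y. ?\<Phi> u x y \<partial>lborel) = (\<integral>h. kern s h * (sd h u x * sd h v x) \<partial>lborel)" .
  qed
  also have "\<dots> = (\<integral>h. (\<integral>x. kern s h * (sd h u x * sd h v x) \<partial>lborel) \<partial>lborel)"
    by (rule lborel_pair.Fubini_integral[OF form_integrable[OF u v]])
  also have "\<dots> = form s u v"
    by (simp add: form_iterated[OF u v])
  finally show ?thesis by (simp add: energy_def)
qed

lemma frac_const_pos:
  assumes "0 < s" "s < 1" "0 < N"
  shows "0 < frac_const N s"
  using assms by (simp add: frac_const_def Gamma_real_pos)

section \<open>Interior regularity\<close>

text \<open>For every v in \<open>Hs s\<close> the product of \<eta> and v vanishes off \<Omega> and
  is admissible in the weak formulation; this turns the equation on \<Omega> into one for w on the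
  whole space.\<close>

lemma solution_diagonal_estimate:
  fixes s :: real and \<Omega> :: "'a::euclidean_space set"
  assumes s: "0 < s" "s < 1" and sol: "finite_energy_solution s \<Omega> f u" and L2f: "f \<in> L2_functionals s \<Omega>"
    and \<eta>: "\<eta> \<in> test_functions \<Omega>"
  obtains w where "w \<in> Hs s" "AE x in lborel. u x * \<eta> x = w x"
    "(\<integral>\<^sup>+t. pw (-1 - 2 * s) t * ennreal (psi2 w t t) \<partial>lborel) < \<infinity>"
proof -
  define c where "c = frac_const (real DIM('a)) s / 2"
  have c: "0 < c" using frac_const_pos[OF s, of "real DIM('a)"] by (simp add: c_def)
  have uW: "u \<in> W0 s \<Omega>" using sol by (simp add: finite_energy_solution_def)
  obtain u' where u': "u' \<in> Hs s" "AE x in lborel. u x = u' x" by (rule W0_representative[OF s uW])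
  obtain g where g: "g \<in> Lp 2 \<Omega>" "\<And>v. v \<in> W0 s \<Omega> \<Longrightarrow> f v = (LINT x:\<Omega>|lebesgue. g x * v x)"
    using L2f by (auto simp: L2_functionals_def)
  have "(\<lambda>x. indicator \<Omega> x * g x) \<in> Lp 2 UNIV"
  proof -
    have "\<bar>indicator \<Omega> x * g x\<bar> powr 2 = indicator \<Omega> x * \<bar>g x\<bar> powr 2" for x
      by (simp split: split_indicator)
    then show ?thesis using g(1) by (simp add: Lp_def set_borel_measurable_def set_integrable_def)
  qed
  then obtain g' where g': "g' \<in> L2" "AE x in lborel. indicator \<Omega> x * g x = g' x"
    by (rule Lp_2_representative)
  have \<eta>m [measurable]: "\<eta> \<in> borel_measurable borel" by (rule test_measurable[OF \<eta>])
  obtain B where B: "0 \<le> B" "\<And>x. \<bar>\<eta> x\<bar> \<le> B" using test_bounded[OF \<eta>] by blast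
  have \<eta>0: "\<eta> x = 0" if "x \<notin> \<Omega>" for x
    using \<eta> that closure_subset[of "{x. \<eta> x \<noteq> 0}"] by (auto simp: test_functions_def)
  obtain G where G: "G \<in> L2"
    "\<And>v. v \<in> Hs s \<Longrightarrow> form s (\<lambda>x. \<eta> x * u' x) v - form s u' (\<lambda>x. \<eta> x * v x) = (\<integral>x. G x * v x \<partial>lborel)"
    using form_commutator[OF s \<eta> u'(1)] by blast
  define w where "w = (\<lambda>x. \<eta> x * u' x)"
  have w: "w \<in> Hs s" unfolding w_def by (rule Hs_test_mult[OF s \<eta> u'(1)])
  \<comment> \<open>The datum, extended by zero and cut off, plus the commutator, weighted with the
    constant c in front of the energy.\<close>
  define F where "F = (\<lambda>x. \<eta> x * g' x + c * G x)"
  have FL: "F \<in> L2" unfolding F_def by (intro L2_add L2_cmult G(1) L2_bounded_mult[OF g'(1) \<eta>m B(2)])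
  have "c * form s w v = (\<integral>x. F x * v x \<partial>lborel)" if v: "v \<in> Hs s" for v
  proof -
    have vL: "v \<in> L2" by (rule Hs_L2[OF v])
    have [measurable]: "v \<in> borel_measurable borel" "g' \<in> borel_measurable borel" using vL g'(1) by auto
    have \<eta>v: "(\<lambda>x. \<eta> x * v x) \<in> Hs s" by (rule Hs_test_mult[OF s \<eta> v])
    have vW: "(\<lambda>x. \<eta> x * v x) \<in> W0 s \<Omega>" by (rule Hs_W0[OF s \<eta>v]) (simp add: \<eta>0)
    have "c * form s u' (\<lambda>x. \<eta> x * v x) = f (\<lambda>x. \<eta> x * v x)"
      using sol vW energy_eq_form[OF u'(1) \<eta>v u'(2)] by (simp add: finite_energy_solution_def c_def)
    also have "\<dots> = (LINT x|lebesgue. indicator \<Omega> x *\<^sub>R (g x * (\<eta> x * v x)))"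
      by (simp add: g(2)[OF vW] set_lebesgue_integral_def)
    also have "\<dots> = (\<integral>x. g' x * (\<eta> x * v x) \<partial>lborel)"
    proof (rule integral_lebesgue_AE(1))
      show "AE x in lborel. indicator \<Omega> x *\<^sub>R (g x * (\<eta> x * v x)) = g' x * (\<eta> x * v x)"
        using g'(2)
      proof eventually_elim
        case (elim x)
        have "indicator \<Omega> x *\<^sub>R (g x * (\<eta> x * v x)) = (indicator \<Omega> x * g x) * (\<eta> x * v x)" by simp
        then show ?case by (simp only: elim)
      qed
    qed measurable
    finally have 1: "c * form s u' (\<lambda>x. \<eta> x * v x) = (\<integral>x. \<eta> x * g' x * v x \<partial>lborel)"
      by (simp add: mult_ac)
    have i: "integrable lborel (\<lambda>x. \<eta> x * g' x * v x)" "integrable lborel (\<lambda>x. G x * v x)"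
      by (intro L2_prod_integrable vL G(1) L2_bounded_mult[OF g'(1) \<eta>m B(2)])+
    have "form s w v = form s u' (\<lambda>x. \<eta> x * v x) + (\<integral>x. G x * v x \<partial>lborel)"
      using G(2)[OF v] by (simp add: w_def)
    then have "c * form s w v = (\<integral>x. \<eta> x * g' x * v x \<partial>lborel) + c * (\<integral>x. G x * v x \<partial>lborel)"
      by (simp only: distrib_left 1)
    also have "\<dots> = (\<integral>x. \<eta> x * g' x * v x + c * (G x * v x) \<partial>lborel)"
      using i by simp
    also have "\<dots> = (\<integral>x. F x * v x \<partial>lborel)"
      by (simp add: F_def distrib_right mult.assoc)
    finally show ?thesis .
  qed
  from fractional_laplacian_estimate[OF s(1) w FL c this]
  have "(\<integral>\<^sup>+t. pw (-1 - 2 * s) t * ennreal (psi2 w t t) \<partial>lborel) < \<infinity>"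
    by (rule diagonal_estimate[OF s(1) Hs_L2[OF w]])
  moreover have "AE x in lborel. u x * \<eta> x = w x"
    using u'(2) by eventually_elim (simp add: w_def)
  ultimately show ?thesis using w by (intro that) auto
qed

text \<open>The squared length of the n-th increment is r = 4^(-n). \<open>psi_sd_bound\<close>
  leads to \<open>psi2 w r t\<close>, which \<open>psi2_linear_bound\<close> makes linear in r for r
  \<le> t, and the square of the factor 2^n of the quotient is exactly 1/r.\<close>

lemma difference_quotient_psi_bound:
  obtains C where "0 < C"
    "\<And>(w :: 'a::euclidean_space \<Rightarrow> real) b n t. w \<in> L2 \<Longrightarrow> b \<in> Basis \<Longrightarrow> 0 < t \<Longrightarrow> (1/4) ^ n \<le> t \<Longrightarrow>
      ennreal (psi (\<lambda>x. 2 ^ n * sd ((1/2) ^ n *\<^sub>R b) w x) t) \<le> ennreal C * dyad w t"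
proof -
  obtain K where K: "0 < K"
    "\<And>(g :: 'a \<Rightarrow> real) t h. g \<in> L2 \<Longrightarrow> 0 < t \<Longrightarrow> h \<noteq> 0 \<Longrightarrow> psi (sd h g) t \<le> K * psi2 g ((norm h)\<^sup>2) t"
    using psi_sd_bound by blast
  show ?thesis
  proof (rule that[of "2 * K"])
    fix w :: "'a \<Rightarrow> real" and b :: 'a and n :: nat and t :: real
    assume w: "w \<in> L2" and b: "b \<in> Basis" and t: "0 < t" "(1/4) ^ n \<le> t"
    show "ennreal (psi (\<lambda>x. 2 ^ n * sd ((1/2) ^ n *\<^sub>R b) w x) t) \<le> ennreal (2 * K) * dyad w t"
    proof (cases "dyad w t < \<infinity>")
      case False
      then have "dyad w t = \<top>" by (simp add: less_top[symmetric])
      then show ?thesis using K(1) by (simp add: ennreal_mult_top)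
    next
      case True
      define r :: real where "r = (1/4) ^ n"
      have nr: "(norm ((1/2) ^ n *\<^sub>R b))\<^sup>2 = r"
      proof -
        have "norm ((1/2) ^ n *\<^sub>R b) = (1/2) ^ n" using b by simp
        moreover have "((1/2::real) ^ n)\<^sup>2 = ((1/2)\<^sup>2) ^ n" by (simp only: power_mult[symmetric] mult.commute)
        moreover have "(1/2::real)\<^sup>2 = 1/4" by (simp add: power2_eq_square)
        ultimately show ?thesis by (simp only: r_def)
      qed
      have r: "0 < r" "r \<le> t" using t by (auto simp: r_def)
      have four: "(2 ^ n)\<^sup>2 * r = 1"
      proof -
        have "((2::real) ^ n)\<^sup>2 = (2\<^sup>2) ^ n" by (simp only: power_mult[symmetric] mult.commute)
        then have "(2 ^ n)\<^sup>2 * r = (2\<^sup>2 * (1/4)) ^ n" by (simp only: r_def power_mult_distrib)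
        then show ?thesis by simp
      qed
      have h0: "(1/2) ^ n *\<^sub>R b \<noteq> 0" using b by auto
      have "psi (\<lambda>x. 2 ^ n * sd ((1/2) ^ n *\<^sub>R b) w x) t = (2 ^ n)\<^sup>2 * psi (sd ((1/2) ^ n *\<^sub>R b) w) t"
        by (rule psi_cmult)
      also have "\<dots> \<le> (2 ^ n)\<^sup>2 * (K * psi2 w r t)"
        using K(2)[OF w t(1) h0] unfolding nr by (intro mult_left_mono) auto
      also have "\<dots> \<le> (2 ^ n)\<^sup>2 * (K * (2 * r * enn2real (dyad w t)))"
        using K(1) psi2_linear_bound[OF t(1) r w True] by (intro mult_left_mono) auto
      also have "\<dots> = ((2 ^ n)\<^sup>2 * r) * (2 * K * enn2real (dyad w t))" by (simp only: mult_ac)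
      also have "\<dots> = 2 * K * enn2real (dyad w t)" unfolding four by simp
      finally have "ennreal (psi (\<lambda>x. 2 ^ n * sd ((1/2) ^ n *\<^sub>R b) w x) t) \<le> ennreal (2 * K * enn2real (dyad w t))"
        by (rule ennreal_leI)
      also have "\<dots> = ennreal (2 * K) * dyad w t"
        using K(1) True by (subst ennreal_mult) auto
      finally show ?thesis .
    qed
  qed (use K(1) in auto)
qed

lemma Sobolev_low_order:
  assumes s: "0 < s" "2 * s < 1" and w: "w \<in> L2" and ae: "AE x in lborel. f x = w x"
    and fin: "(\<integral>\<^sup>+t. pw (-1 - 2 * s) t * ennreal (psi2 w t t) \<partial>lborel) < \<infinity>"
  shows "f \<in> Sobolev (2 * s) 2"
proof -
  have "gag (2 * s) w < \<infinity>"
    using low_order_estimate[OF s w fin] s w by (subst gag_finite_iff) auto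
  then have "w \<in> Hs (2 * s)" using w by (simp add: Hs_def)
  then have "f \<in> W_frac (2 * s) 2" using W_frac_2_iff[OF _ ae] w by auto
  then show ?thesis using s by (simp add: Sobolev_def)
qed

text \<open>One finite value of \<open>dyad\<close> bounds the difference quotients and yields the
  weak gradient, which settles 2s = 1. For 2s > 1 the bound of \<open>psi g\<close> by
  \<open>dyad w\<close>, integrated over all scales, gives the gradient its remaining order 2s -
  1.\<close>

lemma Sobolev_high_order:
  fixes w :: "'a::euclidean_space \<Rightarrow> real"
  assumes s: "1 \<le> 2 * s" "s < 1" and w: "w \<in> L2" and ae: "AE x in lborel. f x = w x"
    and fin: "(\<integral>\<^sup>+t. pw (-1 - 2 * s) t * ennreal (psi2 w t t) \<partial>lborel) < \<infinity>"
  shows "f \<in> Sobolev (2 * s) 2"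
proof -
  obtain t0 where t0: "0 < t0" "dyad w t0 < \<infinity>" by (rule critical_order_estimate[OF s(1) w fin])
  obtain M where M: "\<And>t. 0 < t \<Longrightarrow> psi w t \<le> M * t" using psi_linear_bound[OF t0(1) w t0(2)] by blast
  obtain C where C: "0 \<le> C" "\<And>h. modulus w h \<le> C * (norm h)\<^sup>2" using modulus_quadratic_bound[OF w M] by blast
  obtain K where K: "0 < K"
    "\<And>(w :: 'a \<Rightarrow> real) b n t. w \<in> L2 \<Longrightarrow> b \<in> Basis \<Longrightarrow> 0 < t \<Longrightarrow> (1/4) ^ n \<le> t \<Longrightarrow>
      ennreal (psi (\<lambda>x. 2 ^ n * sd ((1/2) ^ n *\<^sub>R b) w x) t) \<le> ennreal K * dyad w t"
    using difference_quotient_psi_bound by blast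
  have deriv: "\<exists>g\<in>L2. weak_partial b f g \<and> (1 < 2 * s \<longrightarrow> g \<in> W_frac (2 * s - 1) 2)" if b: "b \<in> Basis" for b
  proof -
    obtain g where g: "g \<in> L2"
      "\<And>\<phi>. \<phi> \<in> test_functions UNIV \<Longrightarrow> (\<integral>x. w x * frechet_derivative \<phi> (at x) b \<partial>lborel) = - (\<integral>x. g x * \<phi> x \<partial>lborel)"
      "\<And>t. 0 < t \<Longrightarrow> ennreal (psi g t) \<le> 2 * (ennreal K * dyad w t)"
      using weak_derivative_exists[OF w b C(2), of "\<lambda>t. ennreal K * dyad w t"] K(2)[OF w b] by blast
    have "weak_partial b f g" by (rule weak_partialI[OF b w g(1) ae g(2)])
    moreover have "g \<in> W_frac (2 * s - 1) 2" if s1: "1 < 2 * s"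
    proof -
      note [measurable] = dyad_measurable[OF w]
      have "(\<integral>\<^sup>+t. pw (-1 - (2 * s - 1)) t * ennreal (psi g t) \<partial>lborel)
        \<le> (\<integral>\<^sup>+t. (2 * ennreal K) * (pw (- 2 * s) t * dyad w t) \<partial>lborel)"
      proof (rule nn_integral_mono)
        fix t
        have "pw (-1 - (2 * s - 1)) t * ennreal (psi g t) \<le> pw (- 2 * s) t * (2 * (ennreal K * dyad w t))"
          using g(3)[of t] by (cases "0 < t") (auto simp: pw_def intro!: mult_left_mono)
        then show "pw (-1 - (2 * s - 1)) t * ennreal (psi g t) \<le> (2 * ennreal K) * (pw (- 2 * s) t * dyad w t)"
          by (simp only: mult_ac)
      qed
      also have "\<dots> = (2 * ennreal K) * (\<integral>\<^sup>+t. pw (- 2 * s) t * dyad w t \<partial>lborel)"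
        by (rule nn_integral_cmult) measurable
      also have "\<dots> < \<infinity>"
        using high_order_estimate[OF s1 w fin] by (simp add: ennreal_mult_less_top)
      finally have "gag (2 * s - 1) g < \<infinity>"
        using s1 g(1) by (subst gag_finite_iff) auto
      then have "g \<in> Hs (2 * s - 1)" using g(1) by (simp add: Hs_def)
      then show ?thesis using W_frac_2_iff[of g g] g(1) by auto
    qed
    ultimately show ?thesis using g(1) by blast
  qed
  have fL: "f \<in> Lp 2 UNIV" using Lp_2_iff[OF _ ae] w by auto
  have L2Lp: "g \<in> Lp 2 UNIV" if "g \<in> L2" for g :: "'a \<Rightarrow> real" using Lp_2_iff[of g g] that by auto
  have W1: "f \<in> W_one 2" using fL deriv L2Lp unfolding W_one_def by blast
  show ?thesis
  proof (cases "2 * s = 1")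
    case True
    then show ?thesis using W1 by (simp add: Sobolev_def)
  next
    case False
    then have "1 < 2 * s" using s by simp
    moreover have "2 * s < 2" using s by simp
    ultimately show ?thesis using W1 deriv by (auto simp: Sobolev_def)
  qed
qed

theorem theorem1p3:
  fixes s :: real and \<Omega> :: "'a::euclidean_space set"
    and f :: "('a \<Rightarrow> real) \<Rightarrow> real" and u :: "'a \<Rightarrow> real"
  assumes "0 < s" and "s < 1"
    and "open \<Omega>" and "bounded \<Omega>"
    and "f \<in> W0_dual s \<Omega>"
    and "finite_energy_solution s \<Omega> f u"
    and "f \<in> L2_functionals s \<Omega>"
  shows "u \<in> Sobolev_loc (2 * s) 2 \<Omega>"
proof -
  have "(\<lambda>x. u x * \<eta> x) \<in> Sobolev (2 * s) 2" if \<eta>: "\<eta> \<in> test_functions \<Omega>" for \<eta>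
  proof -
    obtain w where w: "w \<in> Hs s" "AE x in lborel. u x * \<eta> x = w x"
      "(\<integral>\<^sup>+t. pw (-1 - 2 * s) t * ennreal (psi2 w t t) \<partial>lborel) < \<infinity>"
      by (rule solution_diagonal_estimate[OF assms(1,2,6,7) \<eta>])
    show ?thesis
    proof (cases "2 * s < 1")
      case True
      then show ?thesis by (rule Sobolev_low_order[OF assms(1) _ Hs_L2[OF w(1)] w(2,3)])
    next
      case False
      then have "1 \<le> 2 * s" by simp
      then show ?thesis by (rule Sobolev_high_order[OF _ assms(2) Hs_L2[OF w(1)] w(2,3)])
    qed
  qed
  then show ?thesis by (simp add: Sobolev_loc_def)
qed

end
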